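(* Let $B>0$, let $1\le r\le\infty$, $\bar r=\max(2,r)$, $r^*=\min(r,2)$, and suppose $\alpha\ge1-1/r^*$. Let $\{\phi_k,\psi_{\ell k}\}$ be an $N$-regular Cohen–Daubechies–Vial wavelet basis of $L^2([0,1])$ with $N>\alpha$, let $u_{0k},u_{\ell k}$ be i.i.d. uniform $U(-B,B)$ random variables, let $$U_\alpha(x)=\sum_ku_{0k}\phi_k(x)+\sum_{\ell=J_0}^\infty\sum_k2^{-\ell(\alpha+1/2)}u_{\ell k}\psi_{\ell k}(x),\qquad p^{U,\alpha}(x)=\frac{e^{U_\alpha(x)}}{\int_0^1e^{U_\alpha(y)}dy},\quad x\in[0,1],$$ and let the prior $\Pi^\alpha$ be the law of $p^{U,\alpha}$ on $C([0,1])$. Let $X_1,\dots,X_n$ be i.i.d. on $[0,1]$ with law $P_0$ and density $p_0$ satisfying $\|\log p_0\|_{\alpha,\infty,\infty}\le B$. Then there exist finite positive constants $M$ and $\eta=\eta(\alpha,r)$ such that, as $n\to\infty$, $$\Pi^\alpha\Big\{p\in\mathcal P:\|p-p_0\|_r\ge Mn^{-\frac{\alpha-1/2+1/\bar r}{2\alpha+1}}(\log n)^\eta\,\Big|\,X_1,\dots,X_n\Big\}\to0$$ in $P_0^{\mathbb N}$-probability.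
   Context: $\mathcal P$ is the class of probability densities on $[0,1]$; $\|\cdot\|_r$ is the $L^r([0,1])$-norm, with $\|\cdot\|_\infty$ the supremum norm and $1/\bar r=0$ if $r=\infty$. The posterior is $\Pi(A|X_1,\dots,X_n)=\int_A\prod_{i=1}^np(X_i)\,d\Pi(p)\big/\int\prod_{i=1}^np(X_i)\,d\Pi(p)$. $N$-regular Cohen–Daubechies–Vial (CDV) basis: the orthonormal wavelet basis of $L^2([0,1])$ (Cohen, Daubechies, Vial 1993, Theorem 4.4) built from a compactly supported Daubechies scaling function $\phi$ and wavelet $\psi$ of sufficiently large order that they are $N$-times continuously differentiable, starting at a fixed resolution level $J_0$. It consists of finitely many scaling functions $\phi_k$ and of wavelets $\psi_{\ell k}$, $\ell\ge J_0$, $0\le k<2^\ell$; the wavelets supported in the interior of $[0,1]$ are the usual dilated translates $\psi_{\ell k}=2^{\ell/2}\psi(2^\ell\cdot-k)$, complemented by boundary-corrected functions. For $0\le s<N$, $\|f\|_{s,\infty,\infty}=\sup_k|\int_0^1\phi_kf|+\sup_{\ell\ge J_0}2^{\ell(s+1/2)}\sup_k|\int_0^1\psi_{\ell k}f|$ is the norm of the Besov space $B^s_{\infty\infty}([0,1])$, which for $s>0$ is the Hölder(–Zygmund) space $\mathcal C^s([0,1])$. *)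

theory Defs
  imports "HOL-Probability.Probability"
begin

definition k_times_cont_diff :: "nat \<Rightarrow> (real \<Rightarrow> real) \<Rightarrow> bool" where
  "k_times_cont_diff N f \<longleftrightarrow>
     (\<forall>i<N. \<forall>x. ((deriv ^^ i) f) field_differentiable (at x)) \<and>
     continuous_on UNIV ((deriv ^^ N) f)"


text \<open>
  Daubechies scaling function and wavelet of order \<open>K\<close>, with the normalisation in which both are
  supported in \<open>[1 - K, K]\<close>. A Daubechies filter of order \<open>K\<close> is an orthonormal filter of minimal
  length \<open>2 K\<close> whose wavelet has \<open>K\<close> vanishing moments; every spectral factor (extremal phase,
  least asymmetric, \<dots>) is admitted.
\<close>

definition daubechies_filter :: "nat \<Rightarrow> (int \<Rightarrow> real) \<Rightarrow> bool" where
  "daubechies_filter K h \<longleftrightarrow>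
     0 < K \<and>
     (\<forall>n. n \<notin> {1 - int K..int K} \<longrightarrow> h n = 0) \<and>
     (\<Sum>n=1 - int K..int K. h n) = sqrt 2 \<and>
     (\<forall>m. (\<Sum>n=1 - int K..int K. h n * h (n + 2 * m)) = (if m = 0 then 1 else 0)) \<and>
     (\<forall>j<K. (\<Sum>n=1 - int K..int K. (-1) powi n * of_int n ^ j * h n) = 0)"

definition daubechies_pair :: "nat \<Rightarrow> (real \<Rightarrow> real) \<Rightarrow> (real \<Rightarrow> real) \<Rightarrow> bool" where
  "daubechies_pair K \<phi> \<psi> \<longleftrightarrow>
     (\<exists>h. daubechies_filter K h \<and>
        (\<forall>x. \<phi> x = sqrt 2 * (\<Sum>n=1 - int K..int K. h n * \<phi> (2 * x - of_int n))) \<and>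
        (\<forall>x. \<psi> x = sqrt 2 * (\<Sum>n=1 - int K..int K. (-1) powi n * h (1 - n) * \<phi> (2 * x - of_int n)))) \<and>
     (\<forall>x. x \<notin> {1 - real K..real K} \<longrightarrow> \<phi> x = 0) \<and>
     integrable lborel \<phi> \<and> (LBINT x. \<phi> x) = 1 \<and>
     (\<forall>m::int. (LBINT x. \<phi> x * \<phi> (x - of_int m)) = (if m = 0 then 1 else 0))"


text \<open>
  Boundary correction on the half line \<open>[0, \<infinity>)\<close>. The translates \<open>\<phi> (\<cdot> - m)\<close>, \<open>m \<ge> K\<close>, are kept and
  supplemented by the \<open>K\<close> functions \<open>edge_scal_raw\<close>, which are what is needed to reproduce
  polynomials of degree less than \<open>K\<close> up to the boundary. The raw edge wavelets are the scaled edge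
  functions minus their projection onto the scaling space; they are automatically orthogonal to
  \<open>\<phi> (\<cdot> - m)\<close> and \<open>\<psi> (\<cdot> - m)\<close> for \<open>m \<ge> K\<close>.
\<close>

definition edge_scal_raw :: "nat \<Rightarrow> (real \<Rightarrow> real) \<Rightarrow> nat \<Rightarrow> real \<Rightarrow> real" where
  "edge_scal_raw K \<phi> k x = (\<Sum>n=k..2 * K - 2. real (n choose k) * \<phi> (x + real n - real K + 1))"

definition edge_wav_raw :: "nat \<Rightarrow> (nat \<Rightarrow> real \<Rightarrow> real) \<Rightarrow> nat \<Rightarrow> real \<Rightarrow> real" where
  "edge_wav_raw K e k x =
     sqrt 2 * e k (2 * x) -
     (\<Sum>l<K. (LBINT y:{0..}. sqrt 2 * e k (2 * y) * e l y) * e l x)"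

text \<open>
  Orthonormalisation in \<open>L\<^sup>2([0, \<infinity>))\<close>. The order and sign conventions of the Gram-Schmidt
  process are left open, so that every orthonormal basis of the edge space is admitted.
\<close>

definition half_line_onb_of_span ::
    "nat \<Rightarrow> (nat \<Rightarrow> real \<Rightarrow> real) \<Rightarrow> (nat \<Rightarrow> real \<Rightarrow> real) \<Rightarrow> bool" where
  "half_line_onb_of_span K e g \<longleftrightarrow>
     (\<forall>i<K. \<exists>c. \<forall>x\<ge>0. e i x = (\<Sum>j<K. c j * g j x)) \<and>
     (\<forall>i<K. \<exists>c. \<forall>x\<ge>0. g i x = (\<Sum>j<K. c j * e j x)) \<and>
     (\<forall>i<K. \<forall>j<K. (LBINT x:{0..}. e i x * e j x) = (if i = j then 1 else 0))"

definition cdv_edge ::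
    "nat \<Rightarrow> (real \<Rightarrow> real) \<Rightarrow> (nat \<Rightarrow> real \<Rightarrow> real) \<Rightarrow> (nat \<Rightarrow> real \<Rightarrow> real) \<Rightarrow> bool" where
  "cdv_edge K \<phi> e w \<longleftrightarrow>
     half_line_onb_of_span K e (edge_scal_raw K \<phi>) \<and>
     half_line_onb_of_span K w (edge_wav_raw K e)"

text \<open>
  The \<open>2 ^ j\<close> functions of level \<open>j\<close> on \<open>[0, 1]\<close>, where \<open>2 ^ j \<ge> 2 * K\<close> and \<open>k < 2 ^ j\<close>: \<open>K\<close> left
  edge functions, the ordinary dilated translates of \<open>f\<close>, and \<open>K\<close> right edge functions. The right
  edge functions live on \<open>[0, \<infinity>)\<close> as well and are transported by \<open>x \<mapsto> 1 - x\<close>.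
\<close>

definition cdv_level ::
    "nat \<Rightarrow> (nat \<Rightarrow> real \<Rightarrow> real) \<Rightarrow> (real \<Rightarrow> real) \<Rightarrow> (nat \<Rightarrow> real \<Rightarrow> real) \<Rightarrow>
     nat \<Rightarrow> nat \<Rightarrow> real \<Rightarrow> real" where
  "cdv_level K eL f eR j k x =
     2 powr (real j / 2) *
     (if k < K then eL k (2 ^ j * x)
      else if k < 2 ^ j - K then f (2 ^ j * x - real k)
      else eR (2 ^ j - 1 - k) (2 ^ j * (1 - x)))"

definition L2_01 :: "(real \<Rightarrow> real) \<Rightarrow> bool" where
  "L2_01 f \<longleftrightarrow> set_borel_measurable lborel {0..1} f \<and> set_integrable lborel {0..1} (\<lambda>x. (f x)\<^sup>2)"

definition ip01 :: "(real \<Rightarrow> real) \<Rightarrow> (real \<Rightarrow> real) \<Rightarrow> real" where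
  "ip01 f g = (LBINT x:{0..1}. f x * g x)"

definition wavelet_onb_01 ::
    "nat \<Rightarrow> (nat \<Rightarrow> real \<Rightarrow> real) \<Rightarrow> (nat \<Rightarrow> nat \<Rightarrow> real \<Rightarrow> real) \<Rightarrow> bool" where
  "wavelet_onb_01 J0 \<Phi> \<Psi> \<longleftrightarrow>
     (\<forall>k<2 ^ J0. L2_01 (\<Phi> k)) \<and>
     (\<forall>l\<ge>J0. \<forall>k<2 ^ l. L2_01 (\<Psi> l k)) \<and>
     (\<forall>k<2 ^ J0. \<forall>k'<2 ^ J0. ip01 (\<Phi> k) (\<Phi> k') = (if k = k' then 1 else 0)) \<and>
     (\<forall>k<2 ^ J0. \<forall>l\<ge>J0. \<forall>k'<2 ^ l. ip01 (\<Phi> k) (\<Psi> l k') = 0) \<and>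
     (\<forall>l\<ge>J0. \<forall>k<2 ^ l. \<forall>l'\<ge>J0. \<forall>k'<2 ^ l'.
        ip01 (\<Psi> l k) (\<Psi> l' k') = (if l = l' \<and> k = k' then 1 else 0)) \<and>
     (\<forall>f. L2_01 f \<longrightarrow>
        (\<lambda>L. LBINT x:{0..1}.
           (f x - ((\<Sum>k<2 ^ J0. ip01 (\<Phi> k) f * \<Phi> k x) +
                   (\<Sum>l=J0..<L. \<Sum>k<2 ^ l. ip01 (\<Psi> l k) f * \<Psi> l k x)))\<^sup>2) \<longlonglongrightarrow> 0)"

text \<open>
  \<open>N\<close>-regular Cohen-Daubechies-Vial basis with coarsest level \<open>J0\<close>. The right edge is the left edge
  construction for the reflected pair \<open>\<phi> (1 - \<cdot>)\<close>, whose support is again \<open>[1 - K, K]\<close>. The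
  last conjunct is a theorem about the construction; it is recorded here because being an
  orthonormal basis of \<open>L\<^sup>2([0, 1])\<close> is part of the notion.
\<close>

definition cdv_basis ::
    "nat \<Rightarrow> nat \<Rightarrow> (nat \<Rightarrow> real \<Rightarrow> real) \<Rightarrow> (nat \<Rightarrow> nat \<Rightarrow> real \<Rightarrow> real) \<Rightarrow> bool" where
  "cdv_basis N J0 \<Phi> \<Psi> \<longleftrightarrow>
     (\<exists>K \<phi> \<psi> \<phi>L \<psi>L \<phi>R \<psi>R.
        daubechies_pair K \<phi> \<psi> \<and>
        k_times_cont_diff N \<phi> \<and> k_times_cont_diff N \<psi> \<and>
        2 * K \<le> 2 ^ J0 \<and>
        cdv_edge K \<phi> \<phi>L \<psi>L \<and>
        cdv_edge K (\<lambda>x. \<phi> (1 - x)) \<phi>R \<psi>R \<and>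
        (\<forall>k<2 ^ J0. \<forall>x\<in>{0..1}. \<Phi> k x = cdv_level K \<phi>L \<phi> \<phi>R J0 k x) \<and>
        (\<forall>l\<ge>J0. \<forall>k<2 ^ l. \<forall>x\<in>{0..1}. \<Psi> l k x = cdv_level K \<psi>L \<psi> \<psi>R l k x)) \<and>
     wavelet_onb_01 J0 \<Phi> \<Psi>"


definition besov_norm ::
    "nat \<Rightarrow> (nat \<Rightarrow> real \<Rightarrow> real) \<Rightarrow> (nat \<Rightarrow> nat \<Rightarrow> real \<Rightarrow> real) \<Rightarrow> real \<Rightarrow>
     (real \<Rightarrow> real) \<Rightarrow> ennreal" where
  "besov_norm J0 \<Phi> \<Psi> s f =
     (SUP k\<in>{..<2 ^ J0}. ennreal \<bar>ip01 (\<Phi> k) f\<bar>) +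
     (SUP l\<in>{J0..}. ennreal (2 powr (real l * (s + 1/2))) *
        (SUP k\<in>{..<2 ^ l}. ennreal \<bar>ip01 (\<Psi> l k) f\<bar>))"

text \<open>
  The norm sees \<open>f\<close> only up to null sets. For \<open>s > 0\<close> the space is a space of Hoelder-Zygmund
  functions, so its elements are the continuous representatives.
\<close>

definition besov_space ::
    "nat \<Rightarrow> (nat \<Rightarrow> real \<Rightarrow> real) \<Rightarrow> (nat \<Rightarrow> nat \<Rightarrow> real \<Rightarrow> real) \<Rightarrow> real \<Rightarrow>
     (real \<Rightarrow> real) set" where
  "besov_space J0 \<Phi> \<Psi> s =
     {f. set_integrable lborel {0..1} f \<and> (0 < s \<longrightarrow> continuous_on {0..1} f) \<and>
         besov_norm J0 \<Phi> \<Psi> s f < \<infinity>}"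


definition densities_01 :: "(real \<Rightarrow> real) set" where
  "densities_01 =
     {p. (\<forall>x\<in>{0..1}. 0 \<le> p x) \<and> set_integrable lborel {0..1} p \<and> (LBINT x:{0..1}. p x) = 1}"

definition Lr_norm :: "ereal \<Rightarrow> (real \<Rightarrow> real) \<Rightarrow> real" where
  "Lr_norm r f =
     (if r = \<infinity> then (SUP x\<in>{0..1}. \<bar>f x\<bar>)
      else (LBINT x:{0..1}. \<bar>f x\<bar> powr real_of_ereal r) powr (1 / real_of_ereal r))"


text \<open>\<open>C([0, 1])\<close> with the supremum metric (elements are extensional on \<open>[0, 1]\<close>) and its Borel sets.\<close>

definition C01 :: "(real \<Rightarrow> real) metric" where
  "C01 = cfunspace (top_of_set {0..1}) euclidean_metric"

definition borel_C01 :: "(real \<Rightarrow> real) measure" where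
  "borel_C01 = sigma (mspace C01) {A. openin (mtopology_of C01) A}"

text \<open>
  I.i.d. \<open>U(-B, B)\<close> coefficients on their canonical product space: \<open>Inl k\<close> is the index of \<open>u\<^sub>0\<^sub>k\<close> and
  \<open>Inr (l, k)\<close> that of \<open>u\<^sub>l\<^sub>k\<close>. The underlying space of each factor is the open interval
  itself, so that for \<open>\<alpha> > 0\<close> the series converges uniformly at every sample point and
  not merely almost surely.
\<close>

definition coeff_law :: "real \<Rightarrow> nat \<Rightarrow> (nat + nat \<times> nat \<Rightarrow> real) measure" where
  "coeff_law B J0 =
     PiM ({..<2 ^ J0} <+> (SIGMA l:{J0..}. {..<2 ^ l}))
       (\<lambda>_. restrict_space (uniform_measure lborel {-B<..<B}) {-B<..<B})"

definition wavelet_series ::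
    "nat \<Rightarrow> (nat \<Rightarrow> real \<Rightarrow> real) \<Rightarrow> (nat \<Rightarrow> nat \<Rightarrow> real \<Rightarrow> real) \<Rightarrow> real \<Rightarrow>
     (nat + nat \<times> nat \<Rightarrow> real) \<Rightarrow> real \<Rightarrow> real" where
  "wavelet_series J0 \<Phi> \<Psi> \<alpha> u x =
     (\<Sum>k<2 ^ J0. u (Inl k) * \<Phi> k x) +
     (\<Sum>i. let l = J0 + i in
        \<Sum>k<2 ^ l. 2 powr (- real l * (\<alpha> + 1/2)) * u (Inr (l, k)) * \<Psi> l k x)"

definition exp_density :: "(real \<Rightarrow> real) \<Rightarrow> real \<Rightarrow> real" where
  "exp_density U = (\<lambda>x\<in>{0..1}. exp (U x) / (LBINT y:{0..1}. exp (U y)))"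

definition wavelet_prior ::
    "nat \<Rightarrow> (nat \<Rightarrow> real \<Rightarrow> real) \<Rightarrow> (nat \<Rightarrow> nat \<Rightarrow> real \<Rightarrow> real) \<Rightarrow> real \<Rightarrow> real \<Rightarrow>
     (real \<Rightarrow> real) measure" where
  "wavelet_prior J0 \<Phi> \<Psi> B \<alpha> =
     distr (coeff_law B J0) borel_C01 (\<lambda>u. exp_density (wavelet_series J0 \<Phi> \<Psi> \<alpha> u))"

text \<open>The observations \<open>X\<^sub>1, \<dots>, X\<^sub>n\<close> are \<open>X 0, \<dots>, X (n - 1)\<close>.\<close>

definition posterior ::
    "(real \<Rightarrow> real) measure \<Rightarrow> nat \<Rightarrow> (nat \<Rightarrow> real) \<Rightarrow> (real \<Rightarrow> real) set \<Rightarrow> real" where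
  "posterior Q n X A =
     (LINT p:A|Q. (\<Prod>i<n. p (X i))) / (LINT p|Q. (\<Prod>i<n. p (X i)))"

definition law_of_density :: "(real \<Rightarrow> real) \<Rightarrow> real measure" where
  "law_of_density p = density (restrict_space lborel {0..1}) (\<lambda>x. ennreal (p x))"

definition iid_law :: "'a measure \<Rightarrow> (nat \<Rightarrow> 'a) measure" where
  "iid_law P = PiM UNIV (\<lambda>_. P)"

definition tendsto_zero_in_prob :: "'a measure \<Rightarrow> (nat \<Rightarrow> 'a \<Rightarrow> real) \<Rightarrow> bool" where
  "tendsto_zero_in_prob M Y \<longleftrightarrow>
     (\<forall>\<epsilon>>0. (\<lambda>n. measure M {\<omega> \<in> space M. \<bar>Y n \<omega>\<bar> > \<epsilon>}) \<longlonglongrightarrow> 0)"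

end

(*
Let L be the resolution level with 2^L of the order n^(1/(2 alpha + 1)) and e = 2^(-alpha L), so that
n e^2 is of the order 2^L.

Prior mass: all coefficients of log p0 lie in [-B, B], and the series moves by O(e) in supremum norm
when the 2^L coefficients of levels below L are moved by at most B e and all others arbitrarily. Hence a
neighbourhood of p0 of radius O(e) has prior mass at least (e/2)^(2^L), and by Markov's inequality
for the integral of the inverse likelihood ratio over it, the denominator of the posterior is at
least exp(-C 2^L L) times the likelihood of p0.

Tests: a grid on the coefficients below level L splits the parameter space into about (2/e)^(2^L)
cells of diameter O(e). For the centre p_j of a cell put f = p_j - p0; the statistic
exp(s (f - c)), with s small and c halfway between the means of f under p0 and under p_j, has
expectation at most exp(-s |f|_2^2 / 8) under p0, and so does its inverse under every density of
the cell. Both errors beat the entropy and the loss in the denominator as soon as |f|_2^2 is a large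
multiple of e^2 L, which gives contraction in L^2 at the rate e sqrt L.

Other norms: log p - log p0 is again a wavelet series with bounded coefficients, because constants
belong to the coarsest scaling space. The projection onto the first 2^L basis functions costs a
factor O(2^(L/2)) from L^2 to the supremum norm and the remainder is O(e), so the supremum norm
contracts at the rate 2^(L/2) e sqrt L, and interpolation gives every L^r.
*)
theory Submission
  imports Defs
begin

section \<open>Cohen-Daubechies-Vial bases\<close>

text \<open>All densities charged by the prior, and \<open>p0\<close> itself, lie in one band
  [1/b, b], where \<open>b\<close> depends only on the basis, on \<open>B\<close> and on \<alpha>.
  Inside such a band the squared L2 distance controls the chi-square divergence, the moments of the
  tests and the distance between logarithms, so that the single quantity \<open>sq_dist\<close>
  serves for prior mass, testing and the change of norm. A test has to keep its power against a
  whole cell, whose densities agree with the centre only up to O(e). Bounded tilts do: to first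
  order, the exponential moment depends on the density only through an integral that is linear in
  it. The factor L is the price of hitting 2^L windows of relative width e with independent uniform
  variables: the logarithms of the prior mass and of the number of cells are both of order 2^L L. It
  is the origin of the power of log n in the rate. The geometric decay over levels needs \<alpha> >
  0. The condition on \<alpha> and r admits \<alpha> = 0 only together with r = 1; there the claimed
  rate is a multiple of a power of log n and finally exceeds every L1 distance of densities.\<close>

lemma k_times_cont_diff_continuous:
  assumes "k_times_cont_diff N f" "0 < N"
  shows "continuous_on UNIV f"
proof -
  have "f field_differentiable (at x)" for x
    using assms unfolding k_times_cont_diff_def by (metis funpow_0)
  then have "isCont f x" for x
    using field_differentiable_imp_continuous_at by blast
  then show ?thesis
    by (simp add: continuous_on_eq_continuous_at)
qed

lemma continuous_compact_support_bounded:
  fixes f :: "real \<Rightarrow> real"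
  assumes "continuous_on UNIV f" "\<And>x. x \<notin> {a..b} \<Longrightarrow> f x = 0"
  obtains C where "0 \<le> C" "\<And>x. \<bar>f x\<bar> \<le> C"
proof -
  have "compact (f ` {a..b})"
    using assms(1) by (intro compact_continuous_image) (auto intro: continuous_on_subset)
  then obtain C where C: "\<And>y. y \<in> f ` {a..b} \<Longrightarrow> norm y \<le> C"
    using compact_imp_bounded bounded_iff by metis
  have "\<bar>f x\<bar> \<le> max C 0" for x
    using C[of "f x"] assms(2)[of x] by (cases "x \<in> {a..b}") auto
  then show ?thesis using that[of "max C 0"] by auto
qed

text \<open>The vanishing zeroth moment says that the even and the odd part of the filter have equal
  sums, so each is half of \<open>sqrt 2\<close>. This is the sum rule behind the partition of
  unity.\<close>

lemma daubechies_filter_parity_sum: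
  assumes "daubechies_filter K h"
    and F: "finite F" "\<And>m. j - 2 * m \<in> {1 - int K..int K} \<Longrightarrow> m \<in> F"
  shows "sqrt 2 * (\<Sum>m\<in>F. h (j - 2 * m)) = 1"
proof -
  let ?I = "{1 - int K..int K}"
  have h0: "\<And>n. n \<notin> ?I \<Longrightarrow> h n = 0" and s1: "(\<Sum>n\<in>?I. h n) = sqrt 2"
    using assms(1) unfolding daubechies_filter_def by auto
  have s2: "(\<Sum>n\<in>?I. (-1) powi n * h n) = 0"
    using assms(1) unfolding daubechies_filter_def by (auto dest: spec[of _ 0])
  have "(\<Sum>m\<in>F. h (j - 2 * m)) = (\<Sum>m\<in>{m. j - 2 * m \<in> ?I}. h (j - 2 * m))"
    using F h0 by (intro sum.mono_neutral_right) auto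
  also have "\<dots> = (\<Sum>n\<in>{n\<in>?I. even (n - j)}. h n)"
    by (rule sum.reindex_bij_witness[of _ "\<lambda>n. (j - n) div 2" "\<lambda>m. j - 2 * m"]) auto
  also have "\<dots> = (\<Sum>n\<in>?I. if even (n - j) then h n else 0)"
    by (rule sum.inter_filter) simp
  \<comment> \<open>Averaging over the sign \<open>(-1) powi (n + j)\<close> selects the parity
    class of \<open>j\<close>.\<close>
  also have "\<dots> = (\<Sum>n\<in>?I. (h n + (-1) powi j * ((-1) powi n * h n)) / 2)"
    by (intro sum.cong) (auto simp: power_int_minus_left)
  also have "\<dots> = ((\<Sum>n\<in>?I. h n) + (-1) powi j * (\<Sum>n\<in>?I. (-1) powi n * h n)) / 2"
    by (simp add: sum.distrib sum_distrib_left sum_divide_distrib[symmetric])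
  also have "\<dots> = sqrt 2 / 2"
    using s1 s2 by simp
  finally have "sqrt 2 * (\<Sum>m\<in>F. h (j - 2 * m)) = sqrt 2 * (sqrt 2 / 2)" by (rule arg_cong)
  then show ?thesis by simp
qed

text \<open>The refinement equation and the sum rule make the sum S of all integer translates
  invariant under doubling of the argument. Hence S(x) = S(x / 2^n), which tends to S(0) by
  continuity, so S is constant. Quantifying over every finite \<open>F\<close> that contains the
  active indices lets an application choose its own index range.\<close>

lemma daubechies_partition_of_unity:
  assumes pair: "daubechies_pair K \<phi> \<psi>" and cont: "continuous_on UNIV \<phi>"
  shows "\<exists>c>0. \<forall>x F. finite F \<longrightarrow> (\<forall>m::int. \<phi> (x - of_int m) \<noteq> 0 \<longrightarrow> m \<in> F) \<longrightarrow>
    (\<Sum>m\<in>F. \<phi> (x - of_int m)) = c"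
proof -
  obtain h where h: "daubechies_filter K h"
    "\<And>x. \<phi> x = sqrt 2 * (\<Sum>n=1 - int K..int K. h n * \<phi> (2 * x - of_int n))"
    using pair unfolding daubechies_pair_def by auto
  have supp: "\<And>x. x \<notin> {1 - real K..real K} \<Longrightarrow> \<phi> x = 0"
    and int: "integrable lborel \<phi>" and int1: "(LBINT x. \<phi> x) = 1"
    and on: "\<And>m::int. (LBINT x. \<phi> x * \<phi> (x - of_int m)) = (if m = 0 then 1 else 0)"
    using pair unfolding daubechies_pair_def by auto
  have h0: "\<And>n. n \<notin> {1 - int K..int K} \<Longrightarrow> h n = 0"
    using h(1) unfolding daubechies_filter_def by auto
  define S where "S x = (\<Sum>m\<in>{\<lfloor>x\<rfloor> - int K..\<lceil>x\<rceil> + int K}. \<phi> (x - of_int m))" for x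
  have nz: "m \<in> {\<lfloor>x\<rfloor> - int K..\<lceil>x\<rceil> + int K}" if "\<phi> (x - of_int m) \<noteq> 0" for x m
  proof -
    have "x - of_int m \<in> {1 - real K..real K}" using supp that by blast
    then show ?thesis by (auto simp: floor_le_iff le_ceiling_iff; linarith)
  qed
  have S: "(\<Sum>m\<in>F. \<phi> (x - of_int m)) = S x"
    if "finite F" "\<And>m. \<phi> (x - of_int m) \<noteq> 0 \<Longrightarrow> m \<in> F" for x F
  proof -
    have "(\<Sum>m\<in>F. \<phi> (x - of_int m)) = (\<Sum>m\<in>{m. \<phi> (x - of_int m) \<noteq> 0}. \<phi> (x - of_int m))"
      using that by (intro sum.mono_neutral_right) auto
    also have "\<dots> = S x"
      unfolding S_def using nz by (intro sum.mono_neutral_left) auto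
    finally show ?thesis .
  qed
  have double: "S x = S (2 * x)" for x
  proof -
    \<comment> \<open>The window is wide enough for two purposes: \<open>F\<close> contains every
      translate that is nonzero at \<open>x\<close>, and also every \<open>m\<close> with
      \<open>h (j - 2 * m)\<close> nonzero for some \<open>j\<close> active at
      \<open>2 * x\<close>.\<close>
    define R where "R = \<lceil>\<bar>x\<bar>\<rceil> + 2 * int K + 2"
    define F where "F = {-R..R}"
    define G where "G = {-2 * R - int K..2 * R + int K}"
    have xR: "\<bar>x\<bar> + 2 * real K + 2 \<le> of_int R" unfolding R_def by simp
    have inF: "m \<in> F" if "\<phi> (x - of_int m) \<noteq> 0" for m
    proof -
      have "x - of_int m \<in> {1 - real K..real K}" using supp that by blast
      then have "\<bar>of_int m\<bar> \<le> (of_int R :: real)" using xR by auto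
      then show ?thesis unfolding F_def by (auto simp: abs_le_iff)
    qed
    have "S x = (\<Sum>m\<in>F. \<phi> (x - of_int m))"
      using inF by (intro S[symmetric]) (simp add: F_def, blast)
    also have "\<dots> = (\<Sum>m\<in>F. sqrt 2 * (\<Sum>j\<in>G. h (j - 2 * m) * \<phi> (2 * x - of_int j)))"
    proof (intro sum.cong refl)
      fix m assume m: "m \<in> F"
      have "\<phi> (x - of_int m) = sqrt 2 * (\<Sum>n=1 - int K..int K. h n * \<phi> (2 * (x - of_int m) - of_int n))"
        by (rule h(2))
      also have "(\<Sum>n=1 - int K..int K. h n * \<phi> (2 * (x - of_int m) - of_int n)) =
          (\<Sum>j\<in>{1 - int K + 2 * m..int K + 2 * m}. h (j - 2 * m) * \<phi> (2 * x - of_int j))"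
        by (rule sum.reindex_bij_witness[of _ "\<lambda>j. j - 2 * m" "\<lambda>n. n + 2 * m"]) (auto simp: algebra_simps)
      also have "\<dots> = (\<Sum>j\<in>G. h (j - 2 * m) * \<phi> (2 * x - of_int j))"
        using m h0 by (intro sum.mono_neutral_left) (auto simp: G_def F_def)
      finally show "\<phi> (x - of_int m) = sqrt 2 * (\<Sum>j\<in>G. h (j - 2 * m) * \<phi> (2 * x - of_int j))" .
    qed
    also have "\<dots> = (\<Sum>j\<in>G. \<phi> (2 * x - of_int j) * (sqrt 2 * (\<Sum>m\<in>F. h (j - 2 * m))))"
      unfolding sum_distrib_left by (subst sum.swap) (simp add: mult_ac)
    also have "\<dots> = (\<Sum>j\<in>G. \<phi> (2 * x - of_int j))"
    proof (intro sum.cong refl)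
      fix j assume "j \<in> G"
      show "\<phi> (2 * x - of_int j) * (sqrt 2 * (\<Sum>m\<in>F. h (j - 2 * m))) = \<phi> (2 * x - of_int j)"
      proof (cases "\<phi> (2 * x - of_int j) = 0")
        case False
        then have "2 * x - of_int j \<in> {1 - real K..real K}" using supp by blast
        then have j: "\<bar>of_int j :: real\<bar> \<le> 2 * \<bar>x\<bar> + real K" by auto
        have "sqrt 2 * (\<Sum>m\<in>F. h (j - 2 * m)) = 1"
        proof (rule daubechies_filter_parity_sum[OF h(1)])
          fix m assume "j - 2 * m \<in> {1 - int K..int K}"
          then have "\<bar>2 * m\<bar> \<le> \<bar>j\<bar> + int K" by auto
          then have "\<bar>2 * of_int m :: real\<bar> \<le> \<bar>of_int j\<bar> + real K"
            by (metis (mono_tags, lifting) of_int_abs of_int_add of_int_le_iff of_int_mult of_int_numeral of_int_of_nat_eq)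
          with j xR have "\<bar>of_int m\<bar> \<le> (of_int R :: real)" by (simp add: abs_mult)
          then show "m \<in> F" unfolding F_def by (auto simp: abs_le_iff)
        qed (simp add: F_def)
        then show ?thesis by simp
      qed simp
    qed
    also have "\<dots> = S (2 * x)"
    proof (rule S)
      show "finite G" by (simp add: G_def)
      fix j assume "\<phi> (2 * x - of_int j) \<noteq> 0"
      then have "2 * x - of_int j \<in> {1 - real K..real K}" using supp by blast
      then have "\<bar>of_int j\<bar> \<le> (of_int (2 * R + int K) :: real)" using xR by auto
      then have "\<bar>j\<bar> \<le> 2 * R + int K" by (metis of_int_abs of_int_le_iff)
      then show "j \<in> G" unfolding G_def by auto
    qed
    finally show ?thesis .
  qed
  have iter: "S x = S (x / 2 ^ n)" for x n
  proof (induction n)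
    case (Suc n)
    then show ?case using double[of "x / 2 ^ Suc n"] by simp
  qed simp
  \<comment> \<open>The summation range of \<open>S\<close> moves with the argument. Near 0 a fixed
    range suffices, which exhibits \<open>S\<close> there as a finite sum of continuous
    functions.\<close>
  define T where "T x = (\<Sum>m\<in>{-1 - int K..1 + int K}. \<phi> (x - of_int m))" for x
  have ST: "S x = T x" if "\<bar>x\<bar> < 1" for x
    unfolding T_def
  proof (rule S[symmetric])
    fix m assume "\<phi> (x - of_int m) \<noteq> 0"
    then have "x - of_int m \<in> {1 - real K..real K}" using supp by blast
    then have "\<bar>of_int m\<bar> \<le> (of_int (1 + int K) :: real)" using that by auto
    then have "\<bar>m\<bar> \<le> 1 + int K" by (metis of_int_abs of_int_le_iff)
    then show "m \<in> {-1 - int K..1 + int K}" by auto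
  qed simp
  have cT: "continuous_on UNIV T"
    unfolding T_def by (intro continuous_intros continuous_on_compose2[OF cont]) auto
  have const: "S x = S 0" for x
  proof -
    have "(\<lambda>n. x / 2 ^ n) \<longlonglongrightarrow> 0"
      using LIMSEQ_divide_realpow_zero[of 2 x] by simp
    then have "(\<lambda>n. T (x / 2 ^ n)) \<longlonglongrightarrow> T 0" and ev: "\<forall>\<^sub>F n in sequentially. \<bar>x / 2 ^ n\<bar> < 1"
      using cT by (auto intro: continuous_on_tendsto_compose dest: tendstoD[of _ _ _ 1] simp: dist_real_def)
    moreover have "\<forall>\<^sub>F n in sequentially. T (x / 2 ^ n) = S x"
      using ev by eventually_elim (metis ST iter)
    ultimately have "(\<lambda>n. S x) \<longlonglongrightarrow> T 0"
      using tendsto_cong by force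
    then show ?thesis using ST[of 0] LIMSEQ_const_iff by auto
  qed
  obtain C where C: "\<And>x. \<bar>\<phi> x\<bar> \<le> C"
    using continuous_compact_support_bounded[OF cont supp] by blast
  have pint: "integrable lborel (\<lambda>x. \<phi> x * \<phi> (x - of_int m))" for m
  proof (rule Bochner_Integration.integrable_bound)
    show "integrable lborel (\<lambda>x. C * \<phi> x)" using int by simp
    have "\<phi> \<in> borel_measurable borel" using cont by (rule borel_measurable_continuous_onI)
    then show "(\<lambda>x. \<phi> x * \<phi> (x - of_int m)) \<in> borel_measurable lborel" by simp
    show "AE x in lborel. norm (\<phi> x * \<phi> (x - of_int m)) \<le> norm (C * \<phi> x)"
    proof (rule AE_I2)
      fix x
      have "\<bar>\<phi> (x - of_int m)\<bar> \<le> \<bar>C\<bar>" using C[of "x - of_int m"] by simp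
      then show "norm (\<phi> x * \<phi> (x - of_int m)) \<le> norm (C * \<phi> x)"
        by (simp add: abs_mult mult.commute[of "\<bar>C\<bar>"] mult_left_mono)
    qed
  qed
  let ?J = "{-2 * int K..2 * int K}"
  \<comment> \<open>The constant is identified by integrating it against \<open>\<phi>\<close>: by
    orthonormality only the translate m = 0 contributes.\<close>
  have "S 0 = (LBINT x. S 0 * \<phi> x)" using int1 by simp
  also have "\<dots> = (LBINT x. (\<Sum>m\<in>?J. \<phi> x * \<phi> (x - of_int m)))"
  proof (rule Bochner_Integration.integral_cong)
    fix x
    show "S 0 * \<phi> x = (\<Sum>m\<in>?J. \<phi> x * \<phi> (x - of_int m))"
    proof (cases "\<phi> x = 0")
      case False
      then have x: "x \<in> {1 - real K..real K}" using supp by blast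
      have "(\<Sum>m\<in>?J. \<phi> (x - of_int m)) = S x"
      proof (rule S)
        fix m assume "\<phi> (x - of_int m) \<noteq> 0"
        then have "x - of_int m \<in> {1 - real K..real K}" using supp by blast
        with x have "\<bar>of_int m\<bar> \<le> (of_int (2 * int K) :: real)" by auto
        then have "\<bar>m\<bar> \<le> 2 * int K" by (metis of_int_abs of_int_le_iff)
        then show "m \<in> ?J" by auto
      qed simp
      then show ?thesis using const[of x] by (simp add: sum_distrib_left[symmetric])
    qed simp
  qed simp
  also have "\<dots> = (\<Sum>m\<in>?J. (LBINT x. \<phi> x * \<phi> (x - of_int m)))"
    using pint by simp
  also have "\<dots> = 1" unfolding on by (simp add: sum.delta)
  finally have "S 0 = 1" .
  then show ?thesis
    using S const by (intro exI[of _ 1]) auto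
qed

text \<open>\<open>half_line_onb_of_span\<close> determines the edge functions only at nonnegative
  arguments, and \<open>cdv_level\<close> evaluates them only there; regularity is therefore
  recorded on the half line alone.\<close>

definition bdd_cont_half_line :: "(real \<Rightarrow> real) \<Rightarrow> bool" where
  "bdd_cont_half_line f \<longleftrightarrow> continuous_on {0..} f \<and> (\<exists>C. \<forall>x\<ge>0. \<bar>f x\<bar> \<le> C)"

lemma bdd_cont_half_line_add:
  assumes "bdd_cont_half_line f" "bdd_cont_half_line g"
  shows "bdd_cont_half_line (\<lambda>x. f x + g x)"
proof -
  obtain C D where "\<forall>x\<ge>0. \<bar>f x\<bar> \<le> C" "\<forall>x\<ge>0. \<bar>g x\<bar> \<le> D"
    using assms unfolding bdd_cont_half_line_def by auto
  then have "\<forall>x\<ge>0. \<bar>f x + g x\<bar> \<le> C + D"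
    by (auto intro!: order_trans[OF abs_triangle_ineq] add_mono)
  then show ?thesis
    using assms unfolding bdd_cont_half_line_def by (auto intro!: continuous_intros)
qed

lemma bdd_cont_half_line_cmult:
  assumes "bdd_cont_half_line f"
  shows "bdd_cont_half_line (\<lambda>x. c * f x)"
proof -
  obtain C where "\<forall>x\<ge>0. \<bar>f x\<bar> \<le> C"
    using assms unfolding bdd_cont_half_line_def by auto
  then have "\<forall>x\<ge>0. \<bar>c * f x\<bar> \<le> \<bar>c\<bar> * C"
    by (auto simp: abs_mult intro: mult_left_mono)
  then show ?thesis
    using assms unfolding bdd_cont_half_line_def by (auto intro!: continuous_intros)
qed

lemma bdd_cont_half_line_sum:
  assumes "finite I" "\<And>i. i \<in> I \<Longrightarrow> bdd_cont_half_line (f i)"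
  shows "bdd_cont_half_line (\<lambda>x. \<Sum>i\<in>I. f i x)"
  using assms
proof (induction I rule: finite_induct)
  case empty
  then show ?case unfolding bdd_cont_half_line_def by auto
next
  case (insert i I)
  then show ?case by (simp add: bdd_cont_half_line_add)
qed

lemma bdd_cont_half_line_cong:
  assumes "bdd_cont_half_line f" "\<And>x. 0 \<le> x \<Longrightarrow> g x = f x"
  shows "bdd_cont_half_line g"
proof -
  have "continuous_on {0..} g"
    using assms by (simp add: bdd_cont_half_line_def cong: continuous_on_cong_simp)
  then show ?thesis
    using assms unfolding bdd_cont_half_line_def by metis
qed

lemma bdd_cont_half_line_scale:
  assumes "bdd_cont_half_line f" "0 \<le> c"
  shows "bdd_cont_half_line (\<lambda>x. f (c * x))"
proof -
  obtain C where "\<forall>x\<ge>0. \<bar>f x\<bar> \<le> C"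
    using assms(1) unfolding bdd_cont_half_line_def by auto
  then have "\<forall>x\<ge>0. \<bar>f (c * x)\<bar> \<le> C" using assms(2) by simp
  moreover have "continuous_on {0..} (\<lambda>x. f (c * x))"
  proof (rule continuous_on_compose2[where f = "\<lambda>x. c * x" and g = f])
    show "continuous_on {0..} f" using assms(1) by (simp add: bdd_cont_half_line_def)
    show "continuous_on {0..} (\<lambda>x. c * x)" by (intro continuous_intros)
    show "(\<lambda>x. c * x) ` {0..} \<subseteq> {0..}" using assms(2) by (simp add: image_subset_iff)
  qed
  ultimately show ?thesis unfolding bdd_cont_half_line_def by blast
qed

lemma half_line_onb_bounded_continuous:
  assumes "half_line_onb_of_span K e g" "\<And>j. j < K \<Longrightarrow> bdd_cont_half_line (g j)" "i < K"
  shows "bdd_cont_half_line (e i)"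
proof -
  obtain c where c: "\<forall>x\<ge>0. e i x = (\<Sum>j<K. c j * g j x)"
    using assms(1,3) unfolding half_line_onb_of_span_def by blast
  have "bdd_cont_half_line (\<lambda>x. \<Sum>j<K. c j * g j x)"
    using assms(2) by (intro bdd_cont_half_line_sum bdd_cont_half_line_cmult) auto
  then show ?thesis by (rule bdd_cont_half_line_cong) (simp add: c)
qed

lemma edge_scal_raw_bounded_continuous:
  assumes "continuous_on UNIV \<phi>" "\<And>x. \<bar>\<phi> x\<bar> \<le> C"
  shows "bdd_cont_half_line (edge_scal_raw K \<phi> k)"
proof -
  have "bdd_cont_half_line (\<lambda>x. \<phi> (x + real n - real K + 1))" for n
    unfolding bdd_cont_half_line_def
    using assms by (auto intro!: continuous_on_compose2[OF assms(1)] continuous_intros)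
  then have "bdd_cont_half_line
      (\<lambda>x. \<Sum>n=k..2 * K - 2. real (n choose k) * \<phi> (x + real n - real K + 1))"
    by (intro bdd_cont_half_line_sum bdd_cont_half_line_cmult) auto
  then show ?thesis
    by (rule bdd_cont_half_line_cong) (simp add: edge_scal_raw_def)
qed

text \<open>Edge scaling functions are finite combinations of translates of \<open>\<phi>\<close>,
  and edge wavelets are finite combinations of edge scaling functions and their dilates, so both
  inherit continuity and boundedness.\<close>

lemma cdv_edge_bounded_continuous:
  assumes edge: "cdv_edge K \<phi> e w" and \<phi>: "continuous_on UNIV \<phi>" "\<And>x. \<bar>\<phi> x\<bar> \<le> C" and i: "i < K"
  shows "bdd_cont_half_line (e i)" "bdd_cont_half_line (w i)"
proof -
  have e: "bdd_cont_half_line (e j)" if "j < K" for j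
  proof (rule half_line_onb_bounded_continuous[OF _ _ that])
    show "half_line_onb_of_span K e (edge_scal_raw K \<phi>)" using edge by (simp add: cdv_edge_def)
  qed (rule edge_scal_raw_bounded_continuous[OF \<phi>])
  then show "bdd_cont_half_line (e i)" using i .
  have "bdd_cont_half_line (edge_wav_raw K e j)" if "j < K" for j
  proof -
    have "bdd_cont_half_line (\<lambda>x. sqrt 2 * e j (2 * x) +
        (\<Sum>l<K. - (LBINT y:{0..}. sqrt 2 * e j (2 * y) * e l y) * e l x))"
      using that by (intro bdd_cont_half_line_add bdd_cont_half_line_cmult
          bdd_cont_half_line_sum bdd_cont_half_line_scale e) auto
    then show ?thesis
      by (rule bdd_cont_half_line_cong) (simp add: edge_wav_raw_def sum_negf)
  qed
  then show "bdd_cont_half_line (w i)"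
    using edge half_line_onb_bounded_continuous[OF _ _ i] unfolding cdv_edge_def by blast
qed

lemma bdd_cont_half_line_family_bound:
  fixes K :: nat
  assumes "\<And>i. i < K \<Longrightarrow> bdd_cont_half_line (e i)"
  obtains C where "0 \<le> C" "\<And>i x. i < K \<Longrightarrow> 0 \<le> x \<Longrightarrow> \<bar>e i x\<bar> \<le> C"
proof -
  have "\<forall>i. \<exists>C. i < K \<longrightarrow> (\<forall>x\<ge>0. \<bar>e i x\<bar> \<le> C)"
    using assms unfolding bdd_cont_half_line_def by blast
  then obtain C where C: "\<And>i x. i < K \<Longrightarrow> 0 \<le> x \<Longrightarrow> \<bar>e i x\<bar> \<le> C i" by metis
  have "\<bar>e i x\<bar> \<le> (\<Sum>i<K. \<bar>C i\<bar>)" if "i < K" "0 \<le> x" for i x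
  proof -
    have "\<bar>e i x\<bar> \<le> \<bar>C i\<bar>" using C[OF that] by simp
    also have "\<dots> \<le> (\<Sum>i<K. \<bar>C i\<bar>)" using that by (intro member_le_sum) auto
    finally show ?thesis .
  qed
  then show ?thesis using that[of "\<Sum>i<K. \<bar>C i\<bar>"] by (simp add: sum_nonneg)
qed

lemma cdv_level_continuous:
  assumes "\<And>i. i < K \<Longrightarrow> bdd_cont_half_line (eL i)"
    "\<And>i. i < K \<Longrightarrow> bdd_cont_half_line (eR i)" "continuous_on UNIV f" "k < 2 ^ j"
  shows "continuous_on {0..1} (cdv_level K eL f eR j k)"
proof -
  have *: "continuous_on {0..} (eL i)" "continuous_on {0..} (eR i)" if "i < K" for i
    using assms(1,2) that unfolding bdd_cont_half_line_def by auto
  have l: "continuous_on {0..1} (\<lambda>x. eL k (2 ^ j * x))" if "k < K"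
    using that by (intro continuous_on_compose2[OF *(1)] continuous_intros) auto
  have m: "continuous_on {0..1} (\<lambda>x. f (2 ^ j * x - real k))"
    by (intro continuous_on_compose2[OF assms(3)] continuous_intros) auto
  have r: "continuous_on {0..1} (\<lambda>x. eR (2 ^ j - 1 - k) (2 ^ j * (1 - x)))" if "\<not> k < 2 ^ j - K"
    using that assms(4) by (intro continuous_on_compose2[OF *(2)] continuous_intros) auto
  show ?thesis
    unfolding cdv_level_def using l m r
    by (cases "k < K"; cases "k < 2 ^ j - K") (auto intro!: continuous_intros)
qed

text \<open>Locality: apart from the \<open>2 * K\<close> edge functions, at most
  \<open>2 * K + 1\<close> dilated translates are nonzero at a given point, and each function has
  size at most \<open>C * 2 powr (j / 2)\<close>. Summing absolute values over a level thus costs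
  only a constant, although the level has 2^j functions.\<close>

lemma cdv_level_sum_bound:
  assumes eL: "\<And>i x. i < K \<Longrightarrow> 0 \<le> x \<Longrightarrow> \<bar>eL i x\<bar> \<le> C"
    and eR: "\<And>i x. i < K \<Longrightarrow> 0 \<le> x \<Longrightarrow> \<bar>eR i x\<bar> \<le> C"
    and f: "\<And>x. \<bar>f x\<bar> \<le> C" "\<And>x. x \<notin> {1 - real K..real K} \<Longrightarrow> f x = 0"
    and x: "x \<in> {0..1}"
  shows "(\<Sum>k<2 ^ j. \<bar>cdv_level K eL f eR j k x\<bar>) \<le> (4 * real K + 1) * C * 2 powr (real j / 2)"
proof -
  have C: "0 \<le> C" using f(1)[of 0] by simp
  define y where "y = 2 ^ j * x"
  have y: "0 \<le> y" using x by (simp add: y_def)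
  define Z where "Z = {..<K} \<union> {2 ^ j - K..<2 ^ j} \<union> {nat \<lfloor>y\<rfloor> - K..nat \<lfloor>y\<rfloor> + K}"
  have "card Z \<le> card {..<K} + card {2 ^ j - K..<(2::nat) ^ j} + card {nat \<lfloor>y\<rfloor> - K..nat \<lfloor>y\<rfloor> + K}"
    unfolding Z_def by (meson add_mono card_Un_le le_refl order_trans)
  also have "\<dots> \<le> K + K + (2 * K + 1)" by (intro add_mono) auto
  finally have cZ: "card Z \<le> 4 * K + 1" by simp
  have zero: "cdv_level K eL f eR j k x = 0" if "k < 2 ^ j" "k \<notin> Z" for k
  proof -
    have "f (y - real k) = 0"
    proof (rule f(2), rule notI)
      assume "y - real k \<in> {1 - real K..real K}"
      then have "real k \<le> y + real K - 1" "y - real K \<le> real k" by auto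
      moreover have "real (nat \<lfloor>y\<rfloor>) \<le> y" "y < real (nat \<lfloor>y\<rfloor>) + 1"
        using y by linarith+
      ultimately have "real k < real (nat \<lfloor>y\<rfloor> + K)" "real (nat \<lfloor>y\<rfloor>) \<le> real (k + K)"
        unfolding of_nat_add by linarith+
      then have "k < nat \<lfloor>y\<rfloor> + K" "nat \<lfloor>y\<rfloor> \<le> k + K" unfolding of_nat_less_iff of_nat_le_iff .
      then show False using that by (auto simp: Z_def)
    qed
    then show ?thesis using that by (auto simp: cdv_level_def Z_def y_def)
  qed
  have bound: "\<bar>cdv_level K eL f eR j k x\<bar> \<le> C * 2 powr (real j / 2)" if "k < 2 ^ j" for k
  proof -
    have "\<bar>eR (2 ^ j - 1 - k) (2 ^ j * (1 - x))\<bar> \<le> C" if "\<not> k < 2 ^ j - K"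
      using that x \<open>k < 2 ^ j\<close> by (intro eR) auto
    moreover have "\<bar>eL k (2 ^ j * x)\<bar> \<le> C" if "k < K"
      using that x by (intro eL) auto
    ultimately show ?thesis
      using f(1) by (auto simp: cdv_level_def abs_mult mult.commute[of "2 powr (real j / 2)"]
          intro!: mult_right_mono)
  qed
  have "(\<Sum>k<2 ^ j. \<bar>cdv_level K eL f eR j k x\<bar>) = (\<Sum>k\<in>{..<2 ^ j} \<inter> Z. \<bar>cdv_level K eL f eR j k x\<bar>)"
    using zero by (intro sum.mono_neutral_right) auto
  also have "\<dots> \<le> real (card ({..<2 ^ j} \<inter> Z)) * (C * 2 powr (real j / 2))"
    using bound by (intro sum_bounded_above) auto
  also have "\<dots> \<le> (4 * real K + 1) * (C * 2 powr (real j / 2))"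
  proof (intro mult_right_mono)
    have "card ({..<2 ^ j} \<inter> Z) \<le> card Z" by (intro card_mono) (auto simp: Z_def)
    with cZ have "card ({..<2 ^ j} \<inter> Z) \<le> 4 * K + 1" by simp
    then have "real (card ({..<2 ^ j} \<inter> Z)) \<le> real (4 * K + 1)" unfolding of_nat_le_iff .
    then show "real (card ({..<2 ^ j} \<inter> Z)) \<le> 4 * real K + 1" by simp
  qed (use C in simp)
  finally show ?thesis by (simp add: mult_ac)
qed

text \<open>This is all that the statistical argument knows about the construction: orthonormality
  and completeness, continuity, locality in the form of pointwise l1 bounds over a level, and
  coefficients \<open>a\<close> reproducing the constant 1.\<close>

locale wavelet_basis =
  fixes J0 :: nat and \<Phi> :: "nat \<Rightarrow> real \<Rightarrow> real" and \<Psi> :: "nat \<Rightarrow> nat \<Rightarrow> real \<Rightarrow> real"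
    and A :: real and a :: "nat \<Rightarrow> real"
  assumes onb: "wavelet_onb_01 J0 \<Phi> \<Psi>"
    and cont_scal: "k < 2 ^ J0 \<Longrightarrow> continuous_on {0..1} (\<Phi> k)"
    and cont_wav: "J0 \<le> l \<Longrightarrow> k < 2 ^ l \<Longrightarrow> continuous_on {0..1} (\<Psi> l k)"
    and A_ge1: "1 \<le> A"
    and scal_bound: "x \<in> {0..1} \<Longrightarrow> (\<Sum>k<2 ^ J0. \<bar>\<Phi> k x\<bar>) \<le> A * 2 powr (real J0 / 2)"
    and wav_bound: "J0 \<le> l \<Longrightarrow> x \<in> {0..1} \<Longrightarrow> (\<Sum>k<2 ^ l. \<bar>\<Psi> l k x\<bar>) \<le> A * 2 powr (real l / 2)"
    and unit: "x \<in> {0..1} \<Longrightarrow> (\<Sum>k<2 ^ J0. a k * \<Phi> k x) = 1"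

text \<open>By continuity the function vanishes at the end points too. This matters for the count of
  translates: those touching [0, M] only at an end point of their support are not contained in the
  raw edge functions.\<close>

lemma zero_at_support_boundary:
  fixes f :: "real \<Rightarrow> real"
  assumes "continuous_on UNIV f" "\<And>x. x \<notin> {a..b} \<Longrightarrow> f x = 0"
  shows "f x \<noteq> 0 \<Longrightarrow> x \<in> {a<..<b}"
proof -
  assume nz: "f x \<noteq> 0"
  have cl: "closed {x. f x = 0}"
    using assms(1) by (intro closed_Collect_eq) auto
  have "{b<..} \<subseteq> {x. f x = 0}" "{..<a} \<subseteq> {x. f x = 0}" using assms(2) by auto
  then have "closure {b<..} \<subseteq> {x. f x = 0}" "closure {..<a} \<subseteq> {x. f x = 0}"
    using cl by (auto simp only: closure_minimal)
  then have "f a = 0" "f b = 0" by auto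
  with nz have "x \<noteq> a" "x \<noteq> b" by auto
  moreover have "x \<in> {a..b}" using nz assms(2) by blast
  ultimately show ?thesis by auto
qed

lemma half_line_onb_of_spanD:
  assumes "half_line_onb_of_span K e g" "i < K"
  shows "\<exists>c. \<forall>y\<ge>0. g i y = (\<Sum>j<K. c j * e j y)"
  using assms unfolding half_line_onb_of_span_def by simp

text \<open>The raw edge function with index 0 has all binomial weights equal to 1 and is the plain
  sum of the \<open>2 * K - 1\<close> translates around the end point. Together with the interior
  translates and the reflected right edge, every translate that is nonzero somewhere on [0, M] is
  counted once, and the partition of unity applies.\<close>

lemma cdv_level_reproduces_one:
  assumes pair: "daubechies_pair K \<phi> \<psi>" and cont: "continuous_on UNIV \<phi>"
    and J: "2 * K \<le> 2 ^ J"
    and L: "cdv_edge K \<phi> eL wL" and R: "cdv_edge K (\<lambda>x. \<phi> (1 - x)) eR wR"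
  shows "\<exists>a. \<forall>x\<in>{0..1}. (\<Sum>k<2 ^ J. a k * cdv_level K eL \<phi> eR J k x) = 1"
proof -
  have supp: "\<And>x. x \<notin> {1 - real K..real K} \<Longrightarrow> \<phi> x = 0"
    using pair unfolding daubechies_pair_def by auto
  have K: "0 < K" using pair unfolding daubechies_pair_def daubechies_filter_def by auto
  obtain c where c: "c > 0" and unity: "\<And>x F. finite F \<Longrightarrow> (\<And>m::int. \<phi> (x - of_int m) \<noteq> 0 \<Longrightarrow> m \<in> F) \<Longrightarrow>
    (\<Sum>m\<in>F. \<phi> (x - of_int m)) = c"
    using daubechies_partition_of_unity[OF pair cont] by blast
  obtain cL where cL: "\<And>y. 0 \<le> y \<Longrightarrow> edge_scal_raw K \<phi> 0 y = (\<Sum>j<K. cL j * eL j y)"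
    using half_line_onb_of_spanD[of K eL "edge_scal_raw K \<phi>" 0] L K by (auto simp: cdv_edge_def)
  obtain cR where cR: "\<And>y. 0 \<le> y \<Longrightarrow> edge_scal_raw K (\<lambda>x. \<phi> (1 - x)) 0 y = (\<Sum>j<K. cR j * eR j y)"
    using half_line_onb_of_spanD[of K eR "edge_scal_raw K (\<lambda>x. \<phi> (1 - x))" 0] R K by (auto simp: cdv_edge_def)
  define M where "M = (2::nat) ^ J"
  define d where "d = 1 / (c * 2 powr (real J / 2))"
  have d: "d * 2 powr (real J / 2) * c = 1" using c by (simp add: d_def)
  \<comment> \<open>The edge coefficients expand the raw functions of index 0 in the orthonormal
    edge functions; \<open>d\<close> removes the dilation factor and the constant of the partition
    of unity.\<close>
  define a where "a k = d * (if k < K then cL k else if k < M - K then 1 else cR (M - 1 - k))" for k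
  have "(\<Sum>k<2 ^ J. a k * cdv_level K eL \<phi> eR J k x) = 1" if x: "x \<in> {0..1}" for x
  proof -
    define y where "y = 2 ^ J * x"
    have y: "0 \<le> y" "y \<le> real M" using x by (auto simp: y_def M_def)
    let ?t = "\<lambda>k. a k * cdv_level K eL \<phi> eR J k x"
    let ?q = "2 powr (real J / 2)"
    have "(\<Sum>k<2 ^ J. ?t k) =
        (\<Sum>k\<in>{..<K}. ?t k) + (\<Sum>k\<in>{K..<M - K}. ?t k)
        + (\<Sum>k\<in>{M - K..<M}. ?t k)"
    proof -
      have "{..<2 ^ J} = {..<K} \<union> {K..<M - K} \<union> {M - K..<M}" using J by (auto simp: M_def)
      moreover have "({..<K} \<union> {K..<M - K}) \<inter> {M - K..<M} = {}" "{..<K} \<inter> {K..<M - K} = {}"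
        using J by (auto simp: M_def)
      ultimately show ?thesis by (simp add: sum.union_disjoint)
    qed
    also have "(\<Sum>k\<in>{..<K}. ?t k) = d * ?q * (\<Sum>k<K. cL k * eL k y)"
      unfolding sum_distrib_left by (intro sum.cong) (auto simp: a_def cdv_level_def y_def)
    also have "\<dots> = d * ?q * (\<Sum>m\<in>{1 - int K..int K - 1}. \<phi> (y - of_int m))"
    proof -
      have "(\<Sum>n=0..2 * K - 2. \<phi> (y + real n - real K + 1)) = (\<Sum>m\<in>{1 - int K..int K - 1}. \<phi> (y - of_int m))"
        using K by (intro sum.reindex_bij_witness[of _ "\<lambda>m. nat (int K - 1 - m)" "\<lambda>n. int K - 1 - int n"])
          (auto simp: algebra_simps)
      then show ?thesis using cL[OF y(1)] by (simp add: edge_scal_raw_def)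
    qed
    also have "(\<Sum>k\<in>{K..<M - K}. ?t k) = d * ?q * (\<Sum>k\<in>{K..<M - K}. \<phi> (y - real k))"
      unfolding sum_distrib_left by (intro sum.cong) (auto simp: a_def cdv_level_def y_def M_def)
    also have "(\<Sum>k\<in>{K..<M - K}. \<phi> (y - real k)) = (\<Sum>m\<in>{int K..<int M - int K}. \<phi> (y - of_int m))"
      by (intro sum.reindex_bij_witness[of _ nat int]) auto
    also have "(\<Sum>k\<in>{M - K..<M}. ?t k) = d * ?q * (\<Sum>k\<in>{M - K..<M}. cR (M - 1 - k) * eR (M - 1 - k) (real M - y))"
      unfolding sum_distrib_left using J K
      by (intro sum.cong) (auto simp: a_def cdv_level_def y_def M_def algebra_simps)
    also have "(\<Sum>k\<in>{M - K..<M}. cR (M - 1 - k) * eR (M - 1 - k) (real M - y)) = (\<Sum>k<K. cR k * eR k (real M - y))"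
      using J K by (intro sum.reindex_bij_witness[of _ "\<lambda>k. M - 1 - k" "\<lambda>k. M - 1 - k"]) (auto simp: M_def)
    also have "\<dots> = (\<Sum>m\<in>{int M - int K..int M + int K - 2}. \<phi> (y - of_int m))"
    proof -
      have "(\<Sum>n=0..2 * K - 2. \<phi> (1 - (real M - y + real n - real K + 1))) =
          (\<Sum>m\<in>{int M - int K..int M + int K - 2}. \<phi> (y - of_int m))"
        using K by (intro sum.reindex_bij_witness[of _ "\<lambda>m. nat (m - int M + int K)" "\<lambda>n. int M + int n - int K"])
          (auto simp: algebra_simps)
      then show ?thesis using cR[of "real M - y"] y(2) by (simp add: edge_scal_raw_def)
    qed
    also have "d * ?q * (\<Sum>m\<in>{1 - int K..int K - 1}. \<phi> (y - of_int m)) +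
        d * ?q * (\<Sum>m\<in>{int K..<int M - int K}. \<phi> (y - of_int m)) +
        d * ?q * (\<Sum>m\<in>{int M - int K..int M + int K - 2}. \<phi> (y - of_int m)) =
        d * ?q * (\<Sum>m\<in>{1 - int K..int M + int K - 2}. \<phi> (y - of_int m))"
    proof -
      have "2 * int K \<le> int M" using J unfolding M_def by (metis of_nat_le_iff of_nat_mult of_nat_numeral)
      then have "{1 - int K..int M + int K - 2} = {1 - int K..int K - 1} \<union> {int K..<int M - int K} \<union> {int M - int K..int M + int K - 2}"
        using K by auto
      moreover have "({1 - int K..int K - 1} \<union> {int K..<int M - int K}) \<inter> {int M - int K..int M + int K - 2} = {}"
        "{1 - int K..int K - 1} \<inter> {int K..<int M - int K} = {}"
        using \<open>2 * int K \<le> int M\<close> by auto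
      ultimately show ?thesis by (simp add: sum.union_disjoint distrib_left)
    qed
    also have "(\<Sum>m\<in>{1 - int K..int M + int K - 2}. \<phi> (y - of_int m)) = c"
    proof (rule unity)
      fix m assume "\<phi> (y - of_int m) \<noteq> 0"
      then have "y - of_int m \<in> {1 - real K<..<real K}" using zero_at_support_boundary[OF cont supp] by blast
      then have "- of_int (int K) < (of_int m :: real)" "(of_int m :: real) < of_int (int M + int K - 1)"
        using y by auto
      then have "- int K < m" "m < int M + int K - 1" by (simp_all only: of_int_minus[symmetric] of_int_less_iff)
      then show "m \<in> {1 - int K..int M + int K - 2}" by auto
    qed simp
    finally show ?thesis using d by simp
  qed
  then show ?thesis by blast
qed

lemma cdv_basis_wavelet_basis:
  assumes cdv: "cdv_basis N J0 \<Phi> \<Psi>" and N: "0 < N"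
  shows "\<exists>A a. wavelet_basis J0 \<Phi> \<Psi> A a"
proof -
  obtain K \<phi> \<psi> \<phi>L \<psi>L \<phi>R \<psi>R where pair: "daubechies_pair K \<phi> \<psi>"
    and reg: "k_times_cont_diff N \<phi>" "k_times_cont_diff N \<psi>" and J0: "2 * K \<le> 2 ^ J0"
    and L: "cdv_edge K \<phi> \<phi>L \<psi>L" and R: "cdv_edge K (\<lambda>x. \<phi> (1 - x)) \<phi>R \<psi>R"
    and \<Phi>: "\<And>k x. k < 2 ^ J0 \<Longrightarrow> x \<in> {0..1} \<Longrightarrow> \<Phi> k x = cdv_level K \<phi>L \<phi> \<phi>R J0 k x"
    and \<Psi>: "\<And>l k x. J0 \<le> l \<Longrightarrow> k < 2 ^ l \<Longrightarrow> x \<in> {0..1} \<Longrightarrow> \<Psi> l k x = cdv_level K \<psi>L \<psi> \<psi>R l k x"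
    using cdv unfolding cdv_basis_def by blast
  note cont = k_times_cont_diff_continuous[OF reg(1) N] k_times_cont_diff_continuous[OF reg(2) N]
  have cont': "continuous_on UNIV (\<lambda>x. \<phi> (1 - x))"
    by (intro continuous_on_compose2[OF cont(1)] continuous_intros) auto
  have supp: "\<And>x. x \<notin> {1 - real K..real K} \<Longrightarrow> \<phi> x = 0"
    using pair unfolding daubechies_pair_def by auto
  \<comment> \<open>The support of \<open>\<psi>\<close> follows from that of \<open>\<phi>\<close>:
    if \<open>x\<close> lies outside [1 - K, K] and \<open>n\<close> inside, then
    \<open>2 * x - n\<close> lies outside.\<close>
  have supp': "\<psi> x = 0" if "x \<notin> {1 - real K..real K}" for x
  proof -
    obtain h where h: "\<psi> x = sqrt 2 * (\<Sum>n=1 - int K..int K. (-1) powi n * h (1 - n) * \<phi> (2 * x - of_int n))"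
      using pair unfolding daubechies_pair_def by blast
    have "\<phi> (2 * x - of_int n) = 0" if "n \<in> {1 - int K..int K}" for n
    proof (rule supp)
      have "of_int (1 - int K) \<le> (of_int n :: real)" "of_int n \<le> (of_int (int K) :: real)"
        using that unfolding of_int_le_iff by auto
      then show "2 * x - of_int n \<notin> {1 - real K..real K}"
        using \<open>x \<notin> {1 - real K..real K}\<close> by auto
    qed
    then show ?thesis unfolding h by simp
  qed
  obtain C1 where C1: "0 \<le> C1" "\<And>x. \<bar>\<phi> x\<bar> \<le> C1"
    using continuous_compact_support_bounded[OF cont(1) supp] by metis
  obtain C2 where C2: "0 \<le> C2" "\<And>x. \<bar>\<psi> x\<bar> \<le> C2"
    using continuous_compact_support_bounded[OF cont(2) supp'] by metis
  have C1': "\<And>x. \<bar>\<phi> (1 - x)\<bar> \<le> C1" using C1 by blast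
  note bL = cdv_edge_bounded_continuous[OF L cont(1) C1(2)]
  note bR = cdv_edge_bounded_continuous[OF R cont' C1']
  obtain C3 where C3: "0 \<le> C3" "\<And>i x. i < K \<Longrightarrow> 0 \<le> x \<Longrightarrow> \<bar>\<phi>L i x\<bar> \<le> C3"
    using bdd_cont_half_line_family_bound[of K \<phi>L, OF bL(1)] by blast
  obtain C4 where C4: "0 \<le> C4" "\<And>i x. i < K \<Longrightarrow> 0 \<le> x \<Longrightarrow> \<bar>\<psi>L i x\<bar> \<le> C4"
    using bdd_cont_half_line_family_bound[of K \<psi>L, OF bL(2)] by blast
  obtain C5 where C5: "0 \<le> C5" "\<And>i x. i < K \<Longrightarrow> 0 \<le> x \<Longrightarrow> \<bar>\<phi>R i x\<bar> \<le> C5"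
    using bdd_cont_half_line_family_bound[of K \<phi>R, OF bR(1)] by blast
  obtain C6 where C6: "0 \<le> C6" "\<And>i x. i < K \<Longrightarrow> 0 \<le> x \<Longrightarrow> \<bar>\<psi>R i x\<bar> \<le> C6"
    using bdd_cont_half_line_family_bound[of K \<psi>R, OF bR(2)] by blast
  define C where "C = 1 + C1 + C2 + C3 + C4 + C5 + C6"
  have C: "1 \<le> C" "C1 \<le> C" "C2 \<le> C" "C3 \<le> C" "C4 \<le> C" "C5 \<le> C" "C6 \<le> C"
    using C1(1) C2(1) C3(1) C4(1) C5(1) C6(1) by (auto simp: C_def)
  define A where "A = (4 * real K + 1) * C"
  have scal: "(\<Sum>k<2 ^ j. \<bar>cdv_level K \<phi>L \<phi> \<phi>R j k x\<bar>) \<le> A * 2 powr (real j / 2)" if "x \<in> {0..1}" for j x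
    unfolding A_def using C
    by (intro cdv_level_sum_bound that supp)
       (auto intro: order_trans[OF C3(2)] order_trans[OF C5(2)] order_trans[OF C1(2)])
  have wav: "(\<Sum>k<2 ^ j. \<bar>cdv_level K \<psi>L \<psi> \<psi>R j k x\<bar>) \<le> A * 2 powr (real j / 2)" if "x \<in> {0..1}" for j x
    unfolding A_def using C
    by (intro cdv_level_sum_bound that supp')
       (auto intro: order_trans[OF C4(2)] order_trans[OF C6(2)] order_trans[OF C2(2)])
  obtain a where a: "\<forall>x\<in>{0..1}. (\<Sum>k<2 ^ J0. a k * cdv_level K \<phi>L \<phi> \<phi>R J0 k x) = 1"
    using cdv_level_reproduces_one[OF pair cont(1) J0 L R] by blast
  have "wavelet_basis J0 \<Phi> \<Psi> A a"
  proof
    show "wavelet_onb_01 J0 \<Phi> \<Psi>" using cdv unfolding cdv_basis_def by blast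
    show "continuous_on {0..1} (\<Phi> k)" if "k < 2 ^ J0" for k
      using cdv_level_continuous[OF bL(1) bR(1) cont(1) that]
      by (rule continuous_on_eq) (simp_all add: \<Phi> that)
    show "continuous_on {0..1} (\<Psi> l k)" if "J0 \<le> l" "k < 2 ^ l" for l k
      using cdv_level_continuous[OF bL(2) bR(2) cont(2) that(2)]
      by (rule continuous_on_eq) (simp_all add: \<Psi> that)
    show "1 \<le> A" using C(1) mult_mono[of 1 "4 * real K + 1" 1 C] by (simp add: A_def)
    show "(\<Sum>k<2 ^ J0. \<bar>\<Phi> k x\<bar>) \<le> A * 2 powr (real J0 / 2)" if "x \<in> {0..1}" for x
      using scal[OF that, of J0] by (simp add: \<Phi> that del: atLeastAtMost_iff)
    show "(\<Sum>k<2 ^ l. \<bar>\<Psi> l k x\<bar>) \<le> A * 2 powr (real l / 2)" if "J0 \<le> l" "x \<in> {0..1}" for l x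
      using wav[OF that(2), of l] by (simp add: \<Psi> that del: atLeastAtMost_iff)
    show "(\<Sum>k<2 ^ J0. a k * \<Phi> k x) = 1" if "x \<in> {0..1}" for x
      using a that by (simp add: \<Phi> that del: atLeastAtMost_iff)
  qed
  then show ?thesis by blast
qed

section \<open>Wavelet series\<close>

abbreviation unif :: "real measure" where
  "unif \<equiv> restrict_space lborel {0..1}"

lemma prob_space_unif: "prob_space unif"
  by (rule prob_spaceI) (simp add: emeasure_restrict_space space_restrict_space)

interpretation unif: prob_space unif
  by (rule prob_space_unif)

lemma space_unif [simp]: "space unif = {0..1}"
  by (simp add: space_restrict_space)

lemma LBINT_eq_unif: "(LBINT x:{0..1}. f x) = integral\<^sup>L unif (f :: real \<Rightarrow> real)"
  by (simp add: set_lebesgue_integral_def integral_restrict_space)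

lemma set_integrable_eq_unif:
  "set_integrable lborel {0..1} f \<longleftrightarrow> integrable unif (f :: real \<Rightarrow> real)"
  by (simp add: set_integrable_def integrable_restrict_space)

lemma continuous_on_measurable_unif:
  "continuous_on {0..1} f \<Longrightarrow> f \<in> borel_measurable unif" for f :: "real \<Rightarrow> real"
  by (drule borel_measurable_continuous_on_restrict)
    (simp add: measurable_def space_restrict_space sets_restrict_space)

lemma bounded_integrable_unif:
  fixes f :: "real \<Rightarrow> real"
  assumes "f \<in> borel_measurable unif" "\<And>x. x \<in> {0..1} \<Longrightarrow> \<bar>f x\<bar> \<le> C"
  shows "integrable unif f"
  using assms by (intro unif.integrable_const_bound[of _ C]) (auto intro!: AE_I2)

lemma continuous_integrable_unif:
  fixes f :: "real \<Rightarrow> real"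
  assumes "continuous_on {0..1} f"
  shows "integrable unif f"
proof -
  have "compact (f ` {0..1})" using assms by (intro compact_continuous_image) auto
  then obtain C where "\<And>y. y \<in> f ` {0..1} \<Longrightarrow> norm y \<le> C"
    using compact_imp_bounded bounded_iff by metis
  then show ?thesis
    using assms by (intro bounded_integrable_unif[of _ C] continuous_on_measurable_unif) auto
qed

lemma continuous_integral_zero_unif:
  fixes f :: "real \<Rightarrow> real"
  assumes f: "continuous_on {0..1} f" "\<And>x. x \<in> {0..1} \<Longrightarrow> 0 \<le> f x"
    and 0: "integral\<^sup>L unif f = 0" and x: "x \<in> {0..1}"
  shows "f x = 0"
proof -
  have "set_integrable lborel {0..1} f"
    using continuous_integrable_unif[OF f(1)] by (simp add: set_integrable_eq_unif)
  then have "(f has_integral (LBINT x:{0..1}. f x)) {0..1}"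
    using set_borel_integral_eq_integral[of "{0..1}" f] by (auto simp: has_integral_integral)
  then have "(f has_integral 0) (cbox 0 1)" using 0 by (simp add: LBINT_eq_unif)
  then show ?thesis
    using has_integral_0_cbox_imp_0[of 0 1 f x] f x by auto
qed

locale wavelet_series_space = wavelet_basis +
  fixes \<alpha> :: real
  assumes \<alpha>: "0 < \<alpha>"
begin

text \<open>\<open>q ^ L\<close> is the e of the overview. Written as a power of a number below 1,
  it turns sums over levels into geometric series.\<close>

definition q :: real where "q = 2 powr (- \<alpha>)"

definition I :: "(nat + nat \<times> nat) set" where
  "I = {..<2 ^ J0} <+> (SIGMA l:{J0..}. {..<2 ^ l})"

definition head_index :: "nat \<Rightarrow> (nat + nat \<times> nat) set" where
  "head_index L = {..<2 ^ J0} <+> (SIGMA l:{J0..<L}. {..<2 ^ l})"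

definition lev :: "nat \<Rightarrow> (nat + nat \<times> nat \<Rightarrow> real) \<Rightarrow> real \<Rightarrow> real" where
  "lev l u x = (\<Sum>k<2 ^ l. 2 powr (- real l * (\<alpha> + 1/2)) * u (Inr (l, k)) * \<Psi> l k x)"

definition head :: "nat \<Rightarrow> (nat + nat \<times> nat \<Rightarrow> real) \<Rightarrow> real \<Rightarrow> real" where
  "head L u x = (\<Sum>k<2 ^ J0. u (Inl k) * \<Phi> k x) + (\<Sum>l=J0..<L. lev l u x)"

abbreviation series :: "(nat + nat \<times> nat \<Rightarrow> real) \<Rightarrow> real \<Rightarrow> real" where
  "series \<equiv> wavelet_series J0 \<Phi> \<Psi> \<alpha>"

text \<open>The coarsest space contributes \<open>A * 2 powr (J0 / 2)\<close> and level l
  contributes \<open>A * q ^ l\<close>; the sum bounds a series with coefficients in [-1, 1], and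
  the same constant serves for heads and tails.\<close>

definition C0 :: real where "C0 = A * (2 powr (real J0 / 2) + 1 / (1 - q))"

lemma q: "0 < q" "q < 1"
  using \<alpha> by (auto simp: q_def powr_less_one)

lemma q_power: "q ^ l = 2 powr (- real l * \<alpha>)"
  by (simp add: q_def powr_realpow[symmetric] powr_powr mult.commute)

lemma C0_ge: "A / (1 - q) \<le> C0" "A * 2 powr (real J0 / 2) \<le> C0" "1 \<le> C0"
proof -
  show *: "A / (1 - q) \<le> C0" "A * 2 powr (real J0 / 2) \<le> C0"
    using A_ge1 q by (auto simp: C0_def distrib_left)
  have "1 * 1 \<le> A * 2 powr (real J0 / 2)"
    using A_ge1 by (intro mult_mono) (auto simp: ge_one_powr_ge_zero)
  then show "1 \<le> C0" using * by simp
qed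

lemma in_I [simp]: "Inl k \<in> I \<longleftrightarrow> k < 2 ^ J0" "Inr (l, k) \<in> I \<longleftrightarrow> J0 \<le> l \<and> k < 2 ^ l"
  by (auto simp: I_def)

lemma in_head_index [simp]: "Inl k \<in> head_index L \<longleftrightarrow> k < 2 ^ J0"
  "Inr (l, k) \<in> head_index L \<longleftrightarrow> J0 \<le> l \<and> l < L \<and> k < 2 ^ l"
  by (auto simp: head_index_def)

lemma head_index_subset: "head_index L \<subseteq> I"
  by (auto simp: head_index_def I_def)

lemma finite_head_index: "finite (head_index L)"
  by (auto simp: head_index_def)

lemma sum_head_index:
  "(\<Sum>i\<in>head_index L. g i) = (\<Sum>k<2 ^ J0. g (Inl k)) + (\<Sum>l=J0..<L. \<Sum>k<2 ^ l. g (Inr (l, k)))"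
  for g :: "_ \<Rightarrow> real"
  unfolding head_index_def by (simp add: sum.Plus sum.Sigma o_def)

lemma sum_powers_of_two: "J0 \<le> L \<Longrightarrow> 2 ^ J0 + (\<Sum>l=J0..<L. 2 ^ l) = (2::nat) ^ L"
  by (induction L rule: dec_induct) auto

lemma card_head_index: "J0 \<le> L \<Longrightarrow> card (head_index L) = 2 ^ L"
  using sum_powers_of_two[of L] unfolding head_index_def by (simp add: card_Plus)

text \<open>The factor \<open>2 powr (l / 2)\<close> of the locality bound cancels exactly the
  summand 1/2 in the exponent of the weights, which leaves \<open>q ^ l\<close> in supremum
  norm.\<close>

lemma lev_bound:
  assumes "J0 \<le> l" "x \<in> {0..1}" "\<And>k. k < 2 ^ l \<Longrightarrow> \<bar>u (Inr (l, k))\<bar> \<le> b"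
  shows "\<bar>lev l u x\<bar> \<le> A * b * q ^ l"
proof -
  have b: "0 \<le> b" using assms(3)[of 0] by simp
  let ?p = "2 powr (- real l * (\<alpha> + 1/2))"
  have "\<bar>lev l u x\<bar> \<le> (\<Sum>k<2 ^ l. \<bar>?p * u (Inr (l, k)) * \<Psi> l k x\<bar>)"
    unfolding lev_def by (rule sum_abs)
  also have "\<dots> \<le> (\<Sum>k<2 ^ l. ?p * b * \<bar>\<Psi> l k x\<bar>)"
    using assms(3) by (intro sum_mono) (auto simp: abs_mult intro!: mult_right_mono mult_left_mono)
  also have "\<dots> = ?p * b * (\<Sum>k<2 ^ l. \<bar>\<Psi> l k x\<bar>)" by (simp add: sum_distrib_left)
  also have "\<dots> \<le> ?p * b * (A * 2 powr (real l / 2))"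
    using b wav_bound[OF assms(1,2)] by (intro mult_left_mono) auto
  also have "\<dots> = A * b * (?p * 2 powr (real l / 2))" by simp
  also have "?p * 2 powr (real l / 2) = q ^ l"
    unfolding q_power powr_add[symmetric] by (simp add: algebra_simps)
  finally show ?thesis .
qed

lemma scal_part_bound:
  assumes "x \<in> {0..1}" "\<And>k. k < 2 ^ J0 \<Longrightarrow> \<bar>u (Inl k)\<bar> \<le> b"
  shows "\<bar>\<Sum>k<2 ^ J0. u (Inl k) * \<Phi> k x\<bar> \<le> A * 2 powr (real J0 / 2) * b"
proof -
  have b: "0 \<le> b" using assms(2)[of 0] by simp
  have "\<bar>\<Sum>k<2 ^ J0. u (Inl k) * \<Phi> k x\<bar> \<le> (\<Sum>k<2 ^ J0. \<bar>u (Inl k) * \<Phi> k x\<bar>)" by (rule sum_abs)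
  also have "\<dots> \<le> (\<Sum>k<2 ^ J0. b * \<bar>\<Phi> k x\<bar>)"
    using assms(2) by (intro sum_mono) (auto simp: abs_mult intro!: mult_right_mono)
  also have "\<dots> = b * (\<Sum>k<2 ^ J0. \<bar>\<Phi> k x\<bar>)" by (simp add: sum_distrib_left)
  also have "\<dots> \<le> b * (A * 2 powr (real J0 / 2))"
    using b scal_bound[OF assms(1)] by (intro mult_left_mono) auto
  finally show ?thesis by (simp add: mult_ac)
qed

lemma series_eq: "series u x = (\<Sum>k<2 ^ J0. u (Inl k) * \<Phi> k x) + (\<Sum>i. lev (J0 + i) u x)"
  unfolding wavelet_series_def lev_def Let_def ..

lemma lev_summable:
  assumes "x \<in> {0..1}" "\<And>i. i \<in> I \<Longrightarrow> \<bar>u i\<bar> \<le> b"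
  shows "summable (\<lambda>i. lev (J0 + i) u x)"
proof (rule summable_comparison_test)
  show "\<exists>N. \<forall>n\<ge>N. norm (lev (J0 + n) u x) \<le> A * b * q ^ J0 * q ^ n"
    using lev_bound[of "J0 + _" x u b] assms by (intro exI[of _ 0]) (auto simp: power_add mult_ac)
  show "summable (\<lambda>n. A * b * q ^ J0 * q ^ n)"
    using q by (intro summable_mult summable_geometric) auto
qed

lemma series_tail_bound:
  assumes x: "x \<in> {0..1}" and u: "\<And>i. i \<in> I \<Longrightarrow> \<bar>u i\<bar> \<le> b" and L: "J0 \<le> L"
  shows "\<bar>series u x - head L u x\<bar> \<le> C0 * b * q ^ L"
proof -
  have b: "0 \<le> b" using u[of "Inl 0"] by simp
  have sm: "summable (\<lambda>i. lev (J0 + i) u x)" by (rule lev_summable[OF x u])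
  have "(\<Sum>l=J0..<L. lev l u x) = (\<Sum>i<L - J0. lev (J0 + i) u x)"
    using L by (intro sum.reindex_bij_witness[of _ "\<lambda>i. J0 + i" "\<lambda>l. l - J0"]) auto
  moreover have "(\<Sum>i. lev (J0 + i) u x) = (\<Sum>i. lev (J0 + (i + (L - J0))) u x) + (\<Sum>i<L - J0. lev (J0 + i) u x)"
    by (rule suminf_split_initial_segment[OF sm])
  ultimately have "series u x - head L u x = (\<Sum>i. lev (J0 + (i + (L - J0))) u x)"
    unfolding series_eq head_def by simp
  also have "\<dots> = (\<Sum>i. lev (L + i) u x)" using L by (simp add: add.commute add.left_commute)
  finally have eq: "series u x - head L u x = (\<Sum>i. lev (L + i) u x)" .
  have le: "norm (lev (L + i) u x) \<le> A * b * q ^ L * q ^ i" for i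
    using lev_bound[of "L + i" x u b] x u L by (simp add: power_add mult_ac)
  have geo: "(\<lambda>i. A * b * q ^ L * q ^ i) sums (A * b * q ^ L * (1 / (1 - q)))"
    using q by (intro sums_mult geometric_sums) auto
  have "\<bar>\<Sum>i. lev (L + i) u x\<bar> \<le> (\<Sum>i. A * b * q ^ L * q ^ i)"
    using norm_suminf_le[OF le sums_summable[OF geo]] by simp
  also have "\<dots> = A / (1 - q) * (b * q ^ L)" using sums_unique[OF geo] by simp
  also have "\<dots> \<le> C0 * (b * q ^ L)" using C0_ge(1) b q by (intro mult_right_mono) auto
  finally show ?thesis using eq by (simp add: mult_ac)
qed

lemma head_bound:
  assumes x: "x \<in> {0..1}" and u: "\<And>i. i \<in> head_index L \<Longrightarrow> \<bar>u i\<bar> \<le> \<delta>"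
  shows "\<bar>head L u x\<bar> \<le> C0 * \<delta>"
proof -
  have \<delta>: "0 \<le> \<delta>" using u[of "Inl 0"] by simp
  have "\<bar>\<Sum>l=J0..<L. lev l u x\<bar> \<le> (\<Sum>l=J0..<L. A * \<delta> * q ^ l)"
    using lev_bound[of _ x u \<delta>] x u by (intro order_trans[OF sum_abs] sum_mono) auto
  also have "\<dots> = A * \<delta> * (\<Sum>l=J0..<L. q ^ l)" by (simp add: sum_distrib_left)
  also have "(\<Sum>l=J0..<L. q ^ l) \<le> (\<Sum>l. q ^ l)"
    using q by (intro sum_le_suminf summable_geometric) auto
  also have "(\<Sum>l. q ^ l) = 1 / (1 - q)" using q by (intro suminf_geometric) auto
  finally have "\<bar>\<Sum>l=J0..<L. lev l u x\<bar> \<le> A * \<delta> * (1 / (1 - q))"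
    using A_ge1 \<delta> by (auto simp: mult_left_mono)
  moreover have "\<bar>\<Sum>k<2 ^ J0. u (Inl k) * \<Phi> k x\<bar> \<le> A * 2 powr (real J0 / 2) * \<delta>"
    using u by (intro scal_part_bound x) auto
  ultimately have "\<bar>head L u x\<bar> \<le> A * 2 powr (real J0 / 2) * \<delta> + A * \<delta> * (1 / (1 - q))"
    unfolding head_def by linarith
  then show ?thesis by (simp add: C0_def algebra_simps)
qed

text \<open>Head coefficients enter with their own size \<delta>, the infinitely many others only
  through \<open>b\<close>. This two-scale form allows statements about finitely many coordinates to
  control the whole density.\<close>

lemma series_bound:
  assumes x: "x \<in> {0..1}" and u: "\<And>i. i \<in> I \<Longrightarrow> \<bar>u i\<bar> \<le> b"
    and h: "\<And>i. i \<in> head_index L \<Longrightarrow> \<bar>u i\<bar> \<le> \<delta>" and L: "J0 \<le> L"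
  shows "\<bar>series u x\<bar> \<le> C0 * (\<delta> + b * q ^ L)"
proof -
  have "\<bar>series u x - head L u x\<bar> \<le> C0 * b * q ^ L" by (rule series_tail_bound[OF x u L])
  moreover have "\<bar>head L u x\<bar> \<le> C0 * \<delta>" by (rule head_bound[OF x h])
  ultimately show ?thesis by (simp add: distrib_left mult.assoc)
qed

lemma series_bound_uniform:
  assumes x: "x \<in> {0..1}" and u: "\<And>i. i \<in> I \<Longrightarrow> \<bar>u i\<bar> \<le> b"
  shows "\<bar>series u x\<bar> \<le> 2 * C0 * b"
proof -
  have b: "0 \<le> b" using u[of "Inl 0"] by simp
  have "\<bar>series u x\<bar> \<le> C0 * (b + b * q ^ J0)"
    using u head_index_subset by (intro series_bound x) auto
  also have "\<dots> \<le> C0 * (b + b * 1)"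
    using q b C0_ge(3) by (intro mult_left_mono add_left_mono) (auto intro: power_le_one)
  finally show ?thesis by simp
qed

lemma lev_diff: "lev l (\<lambda>i. u i - v i) x = lev l u x - lev l v x"
  by (simp add: lev_def sum_subtractf left_diff_distrib right_diff_distrib)

lemma series_diff:
  assumes x: "x \<in> {0..1}" and u: "\<And>i. i \<in> I \<Longrightarrow> \<bar>u i\<bar> \<le> b" and v: "\<And>i. i \<in> I \<Longrightarrow> \<bar>v i\<bar> \<le> b'"
  shows "series (\<lambda>i. u i - v i) x = series u x - series v x"
proof -
  have "(\<Sum>i. lev (J0 + i) (\<lambda>i. u i - v i) x) = (\<Sum>i. lev (J0 + i) u x) - (\<Sum>i. lev (J0 + i) v x)"
    unfolding lev_diff by (rule suminf_diff[OF lev_summable[OF x u] lev_summable[OF x v], symmetric])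
  then show ?thesis
    unfolding series_eq by (simp add: sum_subtractf left_diff_distrib)
qed

text \<open>These are the coefficients of the constant function c; they absorb the logarithm of a
  normalising constant into a wavelet series.\<close>

definition const_coeff :: "real \<Rightarrow> nat + nat \<times> nat \<Rightarrow> real" where
  "const_coeff c = case_sum (\<lambda>k. c * a k) (\<lambda>_. 0)"

lemma series_const_coeff: "x \<in> {0..1} \<Longrightarrow> series (const_coeff c) x = c"
  using unit[of x]
  by (simp add: series_eq const_coeff_def lev_def mult.assoc sum_distrib_left[symmetric] del: atLeastAtMost_iff)

lemma const_coeff_bound: "i \<in> I \<Longrightarrow> \<bar>const_coeff c i\<bar> \<le> \<bar>c\<bar> * (\<Sum>k<2 ^ J0. \<bar>a k\<bar>)"
  by (cases i) (auto simp: const_coeff_def I_def abs_mult intro!: mult_left_mono member_le_sum sum_nonneg mult_nonneg_nonneg)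

lemma head_continuous: "continuous_on {0..1} (head L u)"
  unfolding head_def lev_def using cont_scal cont_wav by (intro continuous_intros) auto

lemma series_continuous:
  assumes u: "\<And>i. i \<in> I \<Longrightarrow> \<bar>u i\<bar> \<le> b"
  shows "continuous_on {0..1} (series u)"
proof (rule uniform_limit_theorem)
  show "\<forall>\<^sub>F n in sequentially. continuous_on {0..1} (head n u)"
    by (simp add: head_continuous)
  have "(\<lambda>L. C0 * b * q ^ L) \<longlonglongrightarrow> C0 * b * 0"
    using q by (intro tendsto_mult tendsto_const LIMSEQ_power_zero) auto
  then have lim: "(\<lambda>L. C0 * b * q ^ L) \<longlonglongrightarrow> 0" by simp
  show "uniform_limit {0..1} (\<lambda>L. head L u) (series u) sequentially"
  proof (rule uniform_limitI)
    fix e :: real assume "0 < e"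
    then have "\<forall>\<^sub>F L in sequentially. C0 * b * q ^ L < e"
      using lim order_tendstoD(2) by blast
    moreover have "\<forall>\<^sub>F L in sequentially. J0 \<le> L" by (rule eventually_ge_at_top)
    ultimately show "\<forall>\<^sub>F L in sequentially. \<forall>x\<in>{0..1}. dist (head L u x) (series u x) < e"
    proof eventually_elim
      case (elim L)
      then show ?case
        using le_less_trans[OF series_tail_bound[OF _ u elim(2)] elim(1)]
        by (simp add: dist_real_def abs_minus_commute)
    qed
  qed
qed simp

end

section \<open>Orthonormal expansion of the series: L2 norm, supremum norm and the Besov
  ball\<close>

lemma measure_unif [simp]: "measure unif {0..1} = 1"
  by (rule unif.prob_space[unfolded space_unif])

lemma sum_squares_le_square_sum_abs:
  fixes f :: "'a \<Rightarrow> real"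
  assumes "finite I"
  shows "(\<Sum>i\<in>I. (f i)\<^sup>2) \<le> (\<Sum>i\<in>I. \<bar>f i\<bar>)\<^sup>2"
proof -
  have "(\<Sum>i\<in>I. (f i)\<^sup>2) \<le> (\<Sum>i\<in>I. \<bar>f i\<bar> * (\<Sum>i\<in>I. \<bar>f i\<bar>))"
  proof (intro sum_mono)
    fix i assume "i \<in> I"
    then have "\<bar>f i\<bar> \<le> (\<Sum>i\<in>I. \<bar>f i\<bar>)" using assms by (intro member_le_sum) auto
    then have "\<bar>f i\<bar> * \<bar>f i\<bar> \<le> \<bar>f i\<bar> * (\<Sum>i\<in>I. \<bar>f i\<bar>)" by (intro mult_left_mono) auto
    then show "(f i)\<^sup>2 \<le> \<bar>f i\<bar> * (\<Sum>i\<in>I. \<bar>f i\<bar>)" by (simp add: power2_eq_square)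
  qed
  then show ?thesis by (simp add: sum_distrib_right power2_eq_square)
qed

context wavelet_series_space
begin

definition \<theta> :: "nat + nat \<times> nat \<Rightarrow> real \<Rightarrow> real" where
  "\<theta> = case_sum \<Phi> (\<lambda>(l, k). \<Psi> l k)"

definition weight :: "nat + nat \<times> nat \<Rightarrow> real" where
  "weight = case_sum (\<lambda>_. 1) (\<lambda>(l, k). 2 powr (- real l * (\<alpha> + 1/2)))"

lemma head_eq: "head L u x = (\<Sum>i\<in>head_index L. weight i * u i * \<theta> i x)"
  unfolding sum_head_index head_def lev_def weight_def \<theta>_def by simp

lemma \<theta>_continuous: "i \<in> I \<Longrightarrow> continuous_on {0..1} (\<theta> i)"
  by (cases i) (auto simp: \<theta>_def intro: cont_scal cont_wav split: prod.split)

lemma \<theta>_orthonormal: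
  assumes "i \<in> I" "j \<in> I"
  shows "integral\<^sup>L unif (\<lambda>x. \<theta> i x * \<theta> j x) = (if i = j then 1 else 0)"
proof -
  have 1: "\<forall>k<2 ^ J0. \<forall>k'<2 ^ J0. ip01 (\<Phi> k) (\<Phi> k') = (if k = k' then 1 else 0)"
    and 2: "\<forall>k<2 ^ J0. \<forall>l\<ge>J0. \<forall>k'<2 ^ l. ip01 (\<Phi> k) (\<Psi> l k') = 0"
    and 3: "\<forall>l\<ge>J0. \<forall>k<2 ^ l. \<forall>l'\<ge>J0. \<forall>k'<2 ^ l'.
        ip01 (\<Psi> l k) (\<Psi> l' k') = (if l = l' \<and> k = k' then 1 else 0)"
    using onb unfolding wavelet_onb_01_def by blast+
  have "ip01 (\<theta> i) (\<theta> j) = (if i = j then 1 else 0)"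
  proof (cases i)
    case (Inl k)
    then show ?thesis
      using assms 1 2 by (cases j) (auto simp: \<theta>_def)
  next
    case (Inr lk)
    have comm: "ip01 f g = ip01 g f" for f g by (simp add: ip01_def mult.commute)
    show ?thesis
    proof (cases j)
      case (Inl k)
      then show ?thesis using assms 2 Inr by (cases lk) (auto simp: \<theta>_def comm[of "\<Psi> _ _" "\<Phi> _"])
    next
      case (Inr lk')
      obtain l k l' k' where "lk = (l, k)" "lk' = (l', k')" by (cases lk; cases lk') blast
      then show ?thesis
        using assms 3[rule_format, of l k l' k'] \<open>i = Inr lk\<close> Inr by (simp add: \<theta>_def)
    qed
  qed
  then show ?thesis by (simp add: ip01_def LBINT_eq_unif)
qed

lemma integral_head_square:
  "integral\<^sup>L unif (\<lambda>x. (head L u x)\<^sup>2) = (\<Sum>i\<in>head_index L. (weight i * u i)\<^sup>2)"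
proof -
  let ?c = "\<lambda>i. weight i * u i"
  have sub: "i \<in> head_index L \<Longrightarrow> i \<in> I" for i using head_index_subset by blast
  have int: "integrable unif (\<lambda>x. ?c i * \<theta> i x * (?c j * \<theta> j x))"
    if "i \<in> head_index L" "j \<in> head_index L" for i j
    by (intro continuous_integrable_unif continuous_intros \<theta>_continuous sub that)
  have "integral\<^sup>L unif (\<lambda>x. (head L u x)\<^sup>2) =
      integral\<^sup>L unif (\<lambda>x. \<Sum>i\<in>head_index L. \<Sum>j\<in>head_index L. ?c i * \<theta> i x * (?c j * \<theta> j x))"
    by (simp add: head_eq power2_eq_square sum_product)
  also have "\<dots> = (\<Sum>i\<in>head_index L. \<Sum>j\<in>head_index L. integral\<^sup>L unif (\<lambda>x. ?c i * \<theta> i x * (?c j * \<theta> j x)))"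
    using int by (simp add: Bochner_Integration.integral_sum)
  also have "\<dots> = (\<Sum>i\<in>head_index L. \<Sum>j\<in>head_index L. ?c i * ?c j * (if i = j then 1 else 0))"
  proof (intro sum.cong refl)
    fix i j assume ij: "i \<in> head_index L" "j \<in> head_index L"
    have "integral\<^sup>L unif (\<lambda>x. ?c i * \<theta> i x * (?c j * \<theta> j x)) =
        integral\<^sup>L unif (\<lambda>x. (?c i * ?c j) * (\<theta> i x * \<theta> j x))" by (simp add: mult_ac)
    also have "\<dots> = ?c i * ?c j * (if i = j then 1 else 0)"
      unfolding integral_mult_right_zero by (simp add: \<theta>_orthonormal sub ij)
    finally show "integral\<^sup>L unif (\<lambda>x. ?c i * \<theta> i x * (?c j * \<theta> j x)) = ?c i * ?c j * (if i = j then 1 else 0)" .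
  qed
  also have "\<dots> = (\<Sum>i\<in>head_index L. (?c i)\<^sup>2)"
    by (intro sum.cong refl) (simp add: finite_head_index power2_eq_square if_distrib[of "\<lambda>z. _ * z"] sum.delta cong: if_cong)
  finally show ?thesis .
qed

text \<open>This is the diagonal of the projection kernel. At a fixed point the l2 norm over a level
  is at most the l1 norm, which locality bounds by \<open>A * 2 powr (l / 2)\<close>; the squares
  add up to a multiple of 2^L.\<close>

lemma sum_\<theta>_square:
  assumes x: "x \<in> {0..1}" and L: "J0 \<le> L"
  shows "(\<Sum>i\<in>head_index L. (\<theta> i x)\<^sup>2) \<le> A\<^sup>2 * 2 ^ L"
proof -
  have p: "(A * 2 powr (real l / 2))\<^sup>2 = A\<^sup>2 * 2 ^ l" for l
    unfolding power_mult_distrib power2_eq_square[of "2 powr (real l / 2)"] powr_add[symmetric]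
    by (simp add: powr_realpow)
  have "(\<Sum>k<2 ^ J0. (\<Phi> k x)\<^sup>2) \<le> (\<Sum>k<2 ^ J0. \<bar>\<Phi> k x\<bar>)\<^sup>2"
    by (rule sum_squares_le_square_sum_abs) simp
  also have "\<dots> \<le> (A * 2 powr (real J0 / 2))\<^sup>2"
    using scal_bound[OF x] by (intro power_mono) (auto intro: sum_nonneg)
  finally have 1: "(\<Sum>k<2 ^ J0. (\<Phi> k x)\<^sup>2) \<le> A\<^sup>2 * 2 ^ J0" unfolding p .
  have 2: "(\<Sum>k<2 ^ l. (\<Psi> l k x)\<^sup>2) \<le> A\<^sup>2 * 2 ^ l" if "J0 \<le> l" for l
  proof -
    have "(\<Sum>k<2 ^ l. (\<Psi> l k x)\<^sup>2) \<le> (\<Sum>k<2 ^ l. \<bar>\<Psi> l k x\<bar>)\<^sup>2"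
      by (rule sum_squares_le_square_sum_abs) simp
    also have "\<dots> \<le> (A * 2 powr (real l / 2))\<^sup>2"
      using wav_bound[OF that x] by (intro power_mono) (auto intro: sum_nonneg)
    finally show ?thesis unfolding p .
  qed
  have "(\<Sum>i\<in>head_index L. (\<theta> i x)\<^sup>2) = (\<Sum>k<2 ^ J0. (\<Phi> k x)\<^sup>2) + (\<Sum>l=J0..<L. \<Sum>k<2 ^ l. (\<Psi> l k x)\<^sup>2)"
    by (simp add: sum_head_index \<theta>_def)
  also have "\<dots> \<le> A\<^sup>2 * 2 ^ J0 + (\<Sum>l=J0..<L. A\<^sup>2 * 2 ^ l)"
    using 1 2 by (intro add_mono sum_mono) auto
  also have "\<dots> = A\<^sup>2 * real (2 ^ J0 + (\<Sum>l=J0..<L. 2 ^ l))"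
    by (simp add: sum_distrib_left distrib_left)
  also have "\<dots> = A\<^sup>2 * 2 ^ L" unfolding sum_powers_of_two[OF L] by simp
  finally show ?thesis .
qed

text \<open>Here 6 = 4 + 2: twice the squared head, which is itself at most
  \<open>2 * (A\<^sup>2 * 2 ^ L)\<close> times the bracket, plus twice the squared tail, absorbed
  because \<open>A\<^sup>2 * 2 ^ L\<close> is at least 1. The factor \<open>C0\<^sup>2\<close> comes
  from the tail bound.\<close>

definition C1 :: real where "C1 = 6 * A\<^sup>2 * C0\<^sup>2"

text \<open>
  The projection onto the \<open>2 ^ L\<close> coarsest basis functions has supremum norm at most
  \<open>A * 2 powr (L / 2)\<close> times its \<open>L\<^sup>2\<close> norm, and the remainder of the series is uniformly small.
\<close>

lemma series_sup_bound:
  assumes x: "x \<in> {0..1}" and w: "\<And>i. i \<in> I \<Longrightarrow> \<bar>w i\<bar> \<le> b" and L: "J0 \<le> L"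
  shows "(series w x)\<^sup>2 \<le> C1 * 2 ^ L * (integral\<^sup>L unif (\<lambda>x. (series w x)\<^sup>2) + (b * q ^ L)\<^sup>2)"
proof -
  define N where "N = integral\<^sup>L unif (\<lambda>x. (series w x)\<^sup>2)"
  define t where "t = C0 * b * q ^ L"
  have b: "0 \<le> b" using w[of "Inl 0"] by simp
  have t: "0 \<le> t" using b q C0_ge(3) by (simp add: t_def)
  have N: "0 \<le> N" by (simp add: N_def)
  have tail: "(series w y - head L w y)\<^sup>2 \<le> t\<^sup>2" if "y \<in> {0..1}" for y
    using series_tail_bound[OF that w L] unfolding t_def[symmetric] by (simp add: abs_le_square_iff[symmetric] t)
  have sq: "(a + b)\<^sup>2 \<le> 2 * a\<^sup>2 + 2 * b\<^sup>2" for a b :: real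
    using sum_squares_ge_zero[of "a - b" 0] by (simp add: power2_eq_square algebra_simps)
  have ci: "integrable unif (\<lambda>x. (head L w x)\<^sup>2)" "integrable unif (\<lambda>x. (series w x)\<^sup>2)"
    using series_continuous[OF w] by (auto intro!: continuous_integrable_unif continuous_intros head_continuous)
  have "integral\<^sup>L unif (\<lambda>x. (head L w x)\<^sup>2) \<le> integral\<^sup>L unif (\<lambda>x. 2 * (series w x)\<^sup>2 + 2 * t\<^sup>2)"
  proof (rule integral_mono)
    fix y assume "y \<in> space unif"
    then have y: "y \<in> {0..1}" by simp
    have "(head L w y)\<^sup>2 \<le> 2 * (series w y)\<^sup>2 + 2 * (series w y - head L w y)\<^sup>2"
      using sq[of "series w y" "head L w y - series w y"] by (simp add: power2_commute)
    then show "(head L w y)\<^sup>2 \<le> 2 * (series w y)\<^sup>2 + 2 * t\<^sup>2" using tail[OF y] by simp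
  qed (use ci in auto)
  also have "\<dots> = 2 * N + 2 * t\<^sup>2" using ci by (simp add: N_def unif.prob_space)
  finally have hN: "(\<Sum>i\<in>head_index L. (weight i * w i)\<^sup>2) \<le> 2 * N + 2 * t\<^sup>2"
    by (simp add: integral_head_square)
  have "(head L w x)\<^sup>2 \<le> (\<Sum>i\<in>head_index L. (weight i * w i)\<^sup>2) * (\<Sum>i\<in>head_index L. (\<theta> i x)\<^sup>2)"
    unfolding head_eq by (rule Cauchy_Schwarz_ineq_sum)
  also have "\<dots> \<le> (2 * N + 2 * t\<^sup>2) * (A\<^sup>2 * 2 ^ L)"
    using hN sum_\<theta>_square[OF x L] N by (intro mult_mono) (auto intro: sum_nonneg)
  finally have hx: "(head L w x)\<^sup>2 \<le> 2 * (A\<^sup>2 * 2 ^ L) * (N + t\<^sup>2)" by (simp add: algebra_simps)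
  have AL: "1 \<le> A\<^sup>2 * 2 ^ L"
    using A_ge1 mult_mono[of 1 "A\<^sup>2" 1 "2 ^ L"] by simp
  have "(series w x)\<^sup>2 \<le> 2 * (head L w x)\<^sup>2 + 2 * (series w x - head L w x)\<^sup>2"
    using sq[of "head L w x" "series w x - head L w x"] by simp
  also have "\<dots> \<le> 4 * (A\<^sup>2 * 2 ^ L) * (N + t\<^sup>2) + 2 * t\<^sup>2"
    using hx tail[OF x] by simp
  also have "2 * t\<^sup>2 \<le> 2 * ((A\<^sup>2 * 2 ^ L) * (N + t\<^sup>2))"
    using mult_mono[OF AL, of "t\<^sup>2" "N + t\<^sup>2"] N by simp
  finally have "(series w x)\<^sup>2 \<le> 6 * A\<^sup>2 * 2 ^ L * (N + t\<^sup>2)" by (simp add: algebra_simps)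
  also have "\<dots> \<le> 6 * A\<^sup>2 * 2 ^ L * (C0\<^sup>2 * (N + (b * q ^ L)\<^sup>2))"
  proof (intro mult_left_mono)
    have "1 * N \<le> C0\<^sup>2 * N" using C0_ge(3) N by (intro mult_right_mono) auto
    then show "N + t\<^sup>2 \<le> C0\<^sup>2 * (N + (b * q ^ L)\<^sup>2)"
      by (simp add: t_def power_mult_distrib algebra_simps)
  qed simp
  finally show ?thesis by (simp add: C1_def N_def mult_ac)
qed

text \<open>The witness consists of the wavelet coefficients of \<open>f\<close> divided by the
  weights. Completeness gives convergence of the heads to \<open>f\<close> only in L2, while they
  converge uniformly to the continuous function \<open>series v\<close>; the two limits agree in L2,
  hence everywhere by continuity.\<close>

lemma besov_ball_series:
  assumes f: "continuous_on {0..1} f" and nrm: "besov_norm J0 \<Phi> \<Psi> \<alpha> f \<le> ennreal B" and B: "0 < B"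
  shows "\<exists>v. (\<forall>i\<in>I. \<bar>v i\<bar> \<le> B) \<and> (\<forall>x\<in>{0..1}. series v x = f x)"
proof -
  define v where "v i = ip01 (\<theta> i) f / weight i" for i
  have wpos: "0 < weight i" for i by (auto simp: weight_def split: sum.split)
  have v: "\<bar>v i\<bar> \<le> B" if i: "i \<in> I" for i
  proof (cases i)
    case (Inl k)
    then have k: "k < 2 ^ J0" using i by simp
    have "ennreal \<bar>ip01 (\<Phi> k) f\<bar> \<le> (SUP k\<in>{..<2 ^ J0}. ennreal \<bar>ip01 (\<Phi> k) f\<bar>)"
      using k by (intro SUP_upper) auto
    also have "\<dots> \<le> besov_norm J0 \<Phi> \<Psi> \<alpha> f" unfolding besov_norm_def by simp
    also have "\<dots> \<le> ennreal B" by (rule nrm)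
    finally show ?thesis using B by (simp add: v_def Inl \<theta>_def weight_def)
  next
    case (Inr lk)
    obtain l k where lk: "lk = (l, k)" by force
    then have k: "J0 \<le> l" "k < 2 ^ l" using i Inr by auto
    have "ennreal (2 powr (real l * (\<alpha> + 1/2)) * \<bar>ip01 (\<Psi> l k) f\<bar>) =
        ennreal (2 powr (real l * (\<alpha> + 1/2))) * ennreal \<bar>ip01 (\<Psi> l k) f\<bar>" by (simp add: ennreal_mult)
    also have "\<dots> \<le> ennreal (2 powr (real l * (\<alpha> + 1/2))) * (SUP k\<in>{..<2 ^ l}. ennreal \<bar>ip01 (\<Psi> l k) f\<bar>)"
      using k by (intro mult_left_mono SUP_upper) auto
    also have "\<dots> \<le> (SUP l\<in>{J0..}. ennreal (2 powr (real l * (\<alpha> + 1/2))) * (SUP k\<in>{..<2 ^ l}. ennreal \<bar>ip01 (\<Psi> l k) f\<bar>))"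
      using k by (intro SUP_upper2[of l]) auto
    also have "\<dots> \<le> besov_norm J0 \<Phi> \<Psi> \<alpha> f" unfolding besov_norm_def by simp
    also have "\<dots> \<le> ennreal B" by (rule nrm)
    finally have "2 powr (real l * (\<alpha> + 1/2)) * \<bar>ip01 (\<Psi> l k) f\<bar> \<le> B" using B by simp
    moreover have "v i = 2 powr (real l * (\<alpha> + 1/2)) * ip01 (\<Psi> l k) f"
      by (simp add: v_def Inr lk \<theta>_def weight_def powr_minus divide_simps)
    ultimately show ?thesis by (simp add: abs_mult)
  qed
  have L2: "L2_01 f"
    using continuous_integrable_unif[of "\<lambda>x. (f x)\<^sup>2"] f
      continuous_integrable_unif[OF f]
    unfolding L2_01_def set_integrable_eq_unif set_borel_measurable_def
    by (auto intro!: continuous_intros simp: integrable_restrict_space dest!: borel_measurable_integrable)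
  have hd: "head L v x = (\<Sum>k<2 ^ J0. ip01 (\<Phi> k) f * \<Phi> k x) + (\<Sum>l=J0..<L. \<Sum>k<2 ^ l. ip01 (\<Psi> l k) f * \<Psi> l k x)" for L x
  proof -
    have "head L v x = (\<Sum>i\<in>head_index L. ip01 (\<theta> i) f * \<theta> i x)"
      unfolding head_eq v_def using wpos by (intro sum.cong) (auto simp: less_imp_neq[symmetric])
    then show ?thesis by (simp add: sum_head_index \<theta>_def)
  qed
  have "(\<lambda>L. LBINT x:{0..1}. (f x - head L v x)\<^sup>2) \<longlonglongrightarrow> 0"
    using onb L2 unfolding wavelet_onb_01_def hd by blast
  then have lim1: "(\<lambda>L. integral\<^sup>L unif (\<lambda>x. (f x - head L v x)\<^sup>2)) \<longlonglongrightarrow> 0"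
    by (simp add: LBINT_eq_unif)
  have "(\<lambda>L. (C0 * B * q ^ L)\<^sup>2) \<longlonglongrightarrow> (C0 * B * 0)\<^sup>2"
    using q by (intro tendsto_intros LIMSEQ_power_zero) auto
  then have lim2: "(\<lambda>L. 2 * integral\<^sup>L unif (\<lambda>x. (f x - head L v x)\<^sup>2) + 2 * (C0 * B * q ^ L)\<^sup>2) \<longlonglongrightarrow> 2 * 0 + 2 * 0"
    by (intro tendsto_intros lim1) simp
  have cs: "continuous_on {0..1} (series v)" by (rule series_continuous[OF v])
  let ?d = "\<lambda>x. (f x - series v x)\<^sup>2"
  have "integral\<^sup>L unif ?d \<le> 2 * integral\<^sup>L unif (\<lambda>x. (f x - head L v x)\<^sup>2) + 2 * (C0 * B * q ^ L)\<^sup>2"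
    if L: "J0 \<le> L" for L
  proof -
    have ci: "integrable unif (\<lambda>x. (f x - head L v x)\<^sup>2)" "integrable unif ?d"
      by (intro continuous_integrable_unif continuous_intros head_continuous cs f)+
    have "integral\<^sup>L unif ?d \<le> integral\<^sup>L unif (\<lambda>x. 2 * (f x - head L v x)\<^sup>2 + 2 * (C0 * B * q ^ L)\<^sup>2)"
    proof (rule integral_mono)
      fix y assume "y \<in> space unif"
      then have y: "y \<in> {0..1}" by simp
      have "\<bar>series v y - head L v y\<bar> \<le> \<bar>C0 * B * q ^ L\<bar>"
        by (rule order_trans[OF series_tail_bound[OF y v L] abs_ge_self])
      then have "(series v y - head L v y)\<^sup>2 \<le> (C0 * B * q ^ L)\<^sup>2" by (simp only: abs_le_square_iff)
      moreover have "(f y - series v y)\<^sup>2 \<le> 2 * (f y - head L v y)\<^sup>2 + 2 * (series v y - head L v y)\<^sup>2"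
        using sum_squares_ge_zero[of "f y - head L v y + (series v y - head L v y)" 0]
        by (simp add: power2_eq_square algebra_simps)
      ultimately show "?d y \<le> 2 * (f y - head L v y)\<^sup>2 + 2 * (C0 * B * q ^ L)\<^sup>2" by linarith
    qed (use ci in auto)
    then show ?thesis using ci by (simp add: unif.prob_space)
  qed
  then have "integral\<^sup>L unif ?d \<le> 2 * 0 + 2 * 0"
    by (intro tendsto_lowerbound[OF lim2] eventually_sequentiallyI[of J0]) auto
  moreover have "0 \<le> integral\<^sup>L unif ?d" by simp
  ultimately have "integral\<^sup>L unif ?d = 0" by linarith
  then have "?d x = 0" if "x \<in> {0..1}" for x
    using \<open>integral\<^sup>L unif ?d = 0\<close> that
    by (intro continuous_integral_zero_unif[of ?d]) (auto intro!: continuous_intros f cs simp del: power2_diff)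
  then show ?thesis using v by (intro exI[of _ v]) auto
qed

end

section \<open>Posterior mass in a model of bounded densities\<close>

lemma (in prob_space) bounded_integrable:
  fixes f :: "'a \<Rightarrow> real"
  assumes "f \<in> borel_measurable M" "\<And>x. x \<in> space M \<Longrightarrow> \<bar>f x\<bar> \<le> C"
  shows "integrable M f"
  using assms by (intro integrable_const_bound[of _ C]) (auto intro!: AE_I2)

text \<open>The integrand sees finitely many coordinates, so the infinite product can be replaced by
  its finite marginal, where the integral factorises.\<close>

lemma (in prob_space) integral_iid_prod:
  fixes g :: "'a \<Rightarrow> real"
  assumes "integrable M g"
  shows "(\<integral>x. (\<Prod>i<n. g (x i)) \<partial>PiM UNIV (\<lambda>_::nat. M)) = (\<integral>x. g x \<partial>M) ^ n"
proof -
  interpret P: product_prob_space "\<lambda>_::nat. M" UNIV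
    by unfold_locales
  have [measurable]: "g \<in> borel_measurable M" using assms by simp
  have "(\<integral>x. (\<Prod>i<n. g (x i)) \<partial>PiM {..<n} (\<lambda>_. M)) =
      (\<integral>x. (\<Prod>i<n. g (restrict x {..<n} i)) \<partial>PiM UNIV (\<lambda>_::nat. M))"
    by (subst P.distr_PiM_restrict_finite[of "{..<n}", symmetric], simp, simp,
        subst integral_distr) (auto intro!: measurable_restrict_subset)
  also have "\<dots> = (\<integral>x. (\<Prod>i<n. g (x i)) \<partial>PiM UNIV (\<lambda>_::nat. M))"
    by (intro Bochner_Integration.integral_cong prod.cong) auto
  finally show ?thesis
    using P.product_integral_prod[of "{..<n}" "\<lambda>_. g"] assms by simp
qed

text \<open>For y = -z < 0 the claim is 1 \<le> e^z (1 - z + z^2), and replacing e^z by 1 + z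
  already gives 1 + z^3.\<close>

lemma exp_le_quadratic:
  fixes y :: real
  assumes "\<bar>y\<bar> \<le> 1"
  shows "exp y \<le> 1 + y + y\<^sup>2"
proof (cases "0 \<le> y")
  case True
  then show ?thesis using exp_bound[of y] assms by simp
next
  case False
  define z where "z = - y"
  have z: "0 \<le> z" using False by (simp add: z_def)
  have "1 \<le> (1 + z) * (1 - z + z\<^sup>2)"
  proof -
    have "(1 + z) * (1 - z + z\<^sup>2) = 1 + z ^ 3" by (simp add: power2_eq_square power3_eq_cube algebra_simps)
    then show ?thesis using z by simp
  qed
  also have "\<dots> \<le> exp z * (1 - z + z\<^sup>2)"
  proof (rule mult_right_mono)
    show "1 + z \<le> exp z" by (rule exp_ge_add_one_self)
    show "0 \<le> 1 - z + z\<^sup>2" using sum_squares_ge_zero[of "z - 1/2" 0] by (simp add: power2_eq_square algebra_simps)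
  qed
  finally have "1 \<le> exp z * (1 - z + z\<^sup>2)" .
  then have "exp y * 1 \<le> exp y * (exp z * (1 - z + z\<^sup>2))" by (intro mult_left_mono) auto
  also have "\<dots> = exp y * exp z * (1 - z + z\<^sup>2)" by simp
  also have "exp y * exp z = 1" by (simp add: z_def exp_add[symmetric])
  finally show ?thesis by (simp add: z_def)
qed

text \<open>The two-sided bound by \<open>b\<close>, uniform in the parameter, is what makes
  likelihood ratios bounded and distances comparable; nothing about wavelets enters here.\<close>

locale density_model =
  Lam: prob_space \<Lambda> + Mu: prob_space \<mu> for \<Lambda> :: "'x measure" and \<mu> :: "'u measure" +
  fixes p :: "'u \<Rightarrow> 'x \<Rightarrow> real" and p0 :: "'x \<Rightarrow> real" and b :: real
  assumes p_measurable [measurable]: "(\<lambda>(u, x). p u x) \<in> borel_measurable (\<mu> \<Otimes>\<^sub>M \<Lambda>)"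
    and p0_measurable [measurable]: "p0 \<in> borel_measurable \<Lambda>"
    and b: "1 \<le> b"
    and p_bounds: "u \<in> space \<mu> \<Longrightarrow> x \<in> space \<Lambda> \<Longrightarrow> 1 / b \<le> p u x \<and> p u x \<le> b"
    and p0_bounds: "x \<in> space \<Lambda> \<Longrightarrow> 1 / b \<le> p0 x \<and> p0 x \<le> b"
    and p_integral: "u \<in> space \<mu> \<Longrightarrow> (\<integral>x. p u x \<partial>\<Lambda>) = 1"
    and p0_integral: "(\<integral>x. p0 x \<partial>\<Lambda>) = 1"
begin

definition P0 :: "'x measure" where "P0 = density \<Lambda> (\<lambda>x. ennreal (p0 x))"

definition sample :: "(nat \<Rightarrow> 'x) measure" where "sample = PiM UNIV (\<lambda>_. P0)"

lemma pos: "0 < b" "u \<in> space \<mu> \<Longrightarrow> x \<in> space \<Lambda> \<Longrightarrow> 0 < p u x" "x \<in> space \<Lambda> \<Longrightarrow> 0 < p0 x"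
proof -
  show "0 < b" using b by simp
  then have "0 < 1 / b" by simp
  then show "u \<in> space \<mu> \<Longrightarrow> x \<in> space \<Lambda> \<Longrightarrow> 0 < p u x" "x \<in> space \<Lambda> \<Longrightarrow> 0 < p0 x"
    using p_bounds p0_bounds by (meson less_le_trans)+
qed

lemma p_measurable' [measurable]: "u \<in> space \<mu> \<Longrightarrow> p u \<in> borel_measurable \<Lambda>"
  using measurable_compose[OF measurable_Pair1' p_measurable] by simp

lemma space_P0 [simp]: "space P0 = space \<Lambda>" and sets_P0 [measurable_cong, simp]: "sets P0 = sets \<Lambda>"
  by (auto simp: P0_def)

lemma integral_P0:
  "h \<in> borel_measurable \<Lambda> \<Longrightarrow> (\<integral>x. h x \<partial>P0) = (\<integral>x. p0 x * h x \<partial>\<Lambda>)" for h :: "'x \<Rightarrow> real"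
  unfolding P0_def by (subst integral_density) (auto intro!: AE_I2 simp: less_imp_le pos(3))

lemma prob_space_P0: "prob_space P0"
proof (rule prob_spaceI)
  have i: "integrable \<Lambda> p0" using p0_bounds pos by (intro Lam.bounded_integrable[of _ b]) (auto simp: abs_of_pos)
  have "emeasure P0 (space P0) = (\<integral>\<^sup>+x. ennreal (p0 x) \<partial>\<Lambda>)"
    by (simp add: P0_def emeasure_density cong: nn_integral_cong)
  also have "\<dots> = 1"
    using i p0_integral by (subst nn_integral_eq_integral) (auto intro!: AE_I2 simp: less_imp_le pos(3))
  finally show "emeasure P0 (space P0) = 1" .
qed

sublocale P: prob_space P0 by (rule prob_space_P0)

sublocale PP: product_prob_space "\<lambda>_::nat. P0" UNIV by unfold_locales

sublocale Sample: prob_space sample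
  unfolding sample_def by (rule prob_space_PiM) (rule prob_space_P0)

sublocale pair_sigma_finite sample \<mu>
  by unfold_locales

lemma space_sample: "x \<in> space sample \<Longrightarrow> x i \<in> space \<Lambda>"
  by (auto simp: sample_def space_PiM)

lemma sample_component [measurable]: "(\<lambda>x. x i) \<in> measurable sample \<Lambda>"
  using measurable_component_singleton[of i UNIV "\<lambda>_. P0"]
  by (simp add: sample_def measurable_cong_sets[OF refl sets_P0])

text \<open>Fubini for the product likelihood, combined with Markov's inequality.\<close>

lemma prob_integrated_product_ge:
  fixes h :: "'u \<Rightarrow> 'x \<Rightarrow> real"
  assumes S [measurable]: "S \<in> sets \<mu>"
    and h [measurable]: "(\<lambda>(u, x). h u x) \<in> borel_measurable (\<mu> \<Otimes>\<^sub>M \<Lambda>)"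
    and H: "\<And>u x. u \<in> space \<mu> \<Longrightarrow> x \<in> space \<Lambda> \<Longrightarrow> 0 \<le> h u x \<and> h u x \<le> H"
    and K: "\<And>u. u \<in> S \<Longrightarrow> (\<integral>x. p0 x * h u x \<partial>\<Lambda>) ^ n \<le> K" and c: "0 < c"
  defines "N \<equiv> (\<lambda>x. \<integral>u. indicator S u * (\<Prod>i<n. h u (x i)) \<partial>\<mu>)"
  shows "{x \<in> space sample. c \<le> N x} \<in> sets sample"
    and "measure sample {x \<in> space sample. c \<le> N x} \<le> measure \<mu> S * K / c"
proof -
  have H0: "0 \<le> H"
  proof -
    obtain u x where "u \<in> space \<mu>" "x \<in> space \<Lambda>" using Mu.not_empty Lam.not_empty by blast
    then show ?thesis using H[of u x] by linarith
  qed
  have m1: "(\<lambda>(x, u). indicator S u * (\<Prod>i<n. h u (x i))) \<in> borel_measurable (sample \<Otimes>\<^sub>M \<mu>)"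
    by measurable
  have h_fixed: "h u \<in> borel_measurable \<Lambda>" if "u \<in> space \<mu>" for u
    using measurable_compose[OF measurable_Pair1'[OF that] h] by simp
  have bnd: "\<bar>indicator S u * (\<Prod>i<n. h u (x i))\<bar> \<le> H ^ n" if "u \<in> space \<mu>" "x \<in> space sample" for u x
  proof -
    have "(\<Prod>i<n. h u (x i)) \<le> (\<Prod>i<n. H)" "0 \<le> (\<Prod>i<n. h u (x i))"
      using H[OF that(1) space_sample[OF that(2)]] by (intro prod_mono prod_nonneg; simp)+
    then show ?thesis using H0 by (auto simp: indicator_def)
  qed
  interpret SM: prob_space "sample \<Otimes>\<^sub>M \<mu>"
    by (rule prob_space_pair) unfold_locales
  have int: "integrable (sample \<Otimes>\<^sub>M \<mu>) (\<lambda>(x, u). indicator S u * (\<Prod>i<n. h u (x i)))"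
    using bnd by (intro SM.bounded_integrable[of _ "H ^ n"] m1) (auto simp: space_pair_measure)
  have intN: "integrable sample N"
    unfolding N_def using integrable_fst'[OF int] by simp
  have N0: "0 \<le> N x" if "x \<in> space sample" for x
    unfolding N_def using H space_sample[OF that]
    by (intro Bochner_Integration.integral_nonneg_AE AE_I2) (auto intro!: mult_nonneg_nonneg prod_nonneg)
  show [measurable]: "{x \<in> space sample. c \<le> N x} \<in> sets sample"
    using borel_measurable_integrable[OF intN] by measurable
  have "(\<integral>x. N x \<partial>sample) = (\<integral>u. (\<integral>x. indicator S u * (\<Prod>i<n. h u (x i)) \<partial>sample) \<partial>\<mu>)"
    unfolding N_def using Fubini_integral[OF int] by simp
  also have "\<dots> = (\<integral>u. indicator S u * (\<integral>x. p0 x * h u x \<partial>\<Lambda>) ^ n \<partial>\<mu>)"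
  proof (intro Bochner_Integration.integral_cong refl)
    fix u assume u: "u \<in> space \<mu>"
    have "integrable P0 (h u)"
      using H[OF u] h_fixed[OF u]
      by (intro P.bounded_integrable[of _ H]) (auto simp: measurable_cong_sets[OF sets_P0 refl])
    then have "(\<integral>x. (\<Prod>i<n. h u (x i)) \<partial>sample) = (\<integral>x. h u x \<partial>P0) ^ n"
      unfolding sample_def by (rule P.integral_iid_prod)
    then show "(\<integral>x. indicator S u * (\<Prod>i<n. h u (x i)) \<partial>sample) = indicator S u * (\<integral>x. p0 x * h u x \<partial>\<Lambda>) ^ n"
      by (simp add: integral_P0 h_fixed[OF u])
  qed
  also have "\<dots> \<le> (\<integral>u. indicator S u * K \<partial>\<mu>)"
  proof (rule integral_mono_AE')
    show "integrable \<mu> (\<lambda>u. indicator S u * K)"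
      by (intro integrable_mult_left Mu.bounded_integrable[of _ 1]) (auto simp: indicator_def)
    show "AE u in \<mu>. indicator S u * (\<integral>x. p0 x * h u x \<partial>\<Lambda>) ^ n \<le> indicator S u * K"
      using K by (intro AE_I2) (auto simp: indicator_def)
    \<comment> \<open>\<open>K\<close> has no sign assumption; on \<open>S\<close> it dominates a
      power of a nonnegative integral.\<close>
    have "0 \<le> K" if "u \<in> S" for u
    proof -
      have "0 \<le> (\<integral>x. p0 x * h u x \<partial>\<Lambda>)"
        using H sets.sets_into_space[OF S] that
        by (intro Bochner_Integration.integral_nonneg_AE AE_I2 mult_nonneg_nonneg) (auto simp: less_imp_le pos)
      then show ?thesis using K[OF that] zero_le_power order_trans by blast
    qed
    then show "AE u in \<mu>. 0 \<le> indicator S u * K"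
      by (intro AE_I2) (auto simp: indicator_def)
  qed
  also have "\<dots> = measure \<mu> S * K" by simp
  finally have le: "(\<integral>x. N x \<partial>sample) \<le> measure \<mu> S * K" .
  have "measure sample {x \<in> space sample. c \<le> N x} \<le> (\<integral>x. N x \<partial>sample) / c"
    using N0 c by (intro integral_Markov_inequality_measure[OF intN sets.empty_sets]) (auto intro!: AE_I2)
  also have "\<dots> \<le> measure \<mu> S * K / c" using le c by (intro divide_right_mono) auto
  finally show "measure sample {x \<in> space sample. c \<le> N x} \<le> measure \<mu> S * K / c" .
qed

end

context density_model
begin

section \<open>Bounded exponential tilts as tests with power against L2 neighbourhoods\<close>

definition sq_dist :: "'u \<Rightarrow> real" where
  "sq_dist u = (\<integral>x. (p u x - p0 x)\<^sup>2 \<partial>\<Lambda>)"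

text \<open>With f = p j - p0, the mean of f under \<open>p j\<close> exceeds its mean under
  \<open>p0\<close> by the integral of f^2, which is \<open>sq_dist j\<close>. Adding half of it
  gives the midpoint.\<close>

definition center :: "'u \<Rightarrow> real" where
  "center j = (\<integral>x. (p j x - p0 x) * p0 x \<partial>\<Lambda>) + sq_dist j / 2"

text \<open>
  The test statistic for \<open>p0\<close> against \<open>p j\<close>: the tilt by the bounded function \<open>p j - p0\<close>, centred
  halfway between its expectations under \<open>p0\<close> and \<open>p j\<close>. Unlike the likelihood ratio it keeps its
  power against all densities that are close to \<open>p j\<close> in \<open>L\<^sup>2\<close>.
\<close>

definition tilt :: "'u \<Rightarrow> 'x \<Rightarrow> real" where
  "tilt j x = 1 / (60 * b) * (p j x - p0 x - center j)"

lemma bounded_times_integrable: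
  assumes "f \<in> borel_measurable \<Lambda>" "\<And>x. x \<in> space \<Lambda> \<Longrightarrow> \<bar>f x\<bar> \<le> C"
    and "r \<in> borel_measurable \<Lambda>" "\<And>x. x \<in> space \<Lambda> \<Longrightarrow> 0 \<le> r x \<and> r x \<le> b"
  shows "integrable \<Lambda> (\<lambda>x. r x * f x :: real)"
proof (rule Lam.bounded_integrable[of _ "b * C"])
  show "(\<lambda>x. r x * f x) \<in> borel_measurable \<Lambda>" using assms(1,3) by measurable
  fix x assume x: "x \<in> space \<Lambda>"
  have "\<bar>r x\<bar> * \<bar>f x\<bar> \<le> b * C"
    using assms(2,4)[OF x] b by (intro mult_mono) auto
  then show "\<bar>r x * f x\<bar> \<le> b * C" by (simp add: abs_mult)
qed

lemma difference_bounds: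
  assumes "u \<in> space \<mu>" "x \<in> space \<Lambda>"
  shows "\<bar>p u x - p0 x\<bar> \<le> b" "\<bar>p u x - p0 x\<bar> \<le> p u x + p0 x" "(p u x - p0 x)\<^sup>2 \<le> b\<^sup>2"
proof -
  have 1: "0 < p u x" "p u x \<le> b" "0 < p0 x" "p0 x \<le> b"
    using pos assms p_bounds[OF assms] p0_bounds[OF assms(2)] by auto
  then show *: "\<bar>p u x - p0 x\<bar> \<le> b" "\<bar>p u x - p0 x\<bar> \<le> p u x + p0 x" by auto
  have "\<bar>p u x - p0 x\<bar>\<^sup>2 \<le> b\<^sup>2" using * by (intro power_mono) auto
  then show "(p u x - p0 x)\<^sup>2 \<le> b\<^sup>2" by simp
qed

lemma p_integrable: "u \<in> space \<mu> \<Longrightarrow> integrable \<Lambda> (p u)" and p0_integrable: "integrable \<Lambda> p0"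
  using p_bounds p0_bounds pos b
  by (auto intro!: Lam.bounded_integrable[of _ b] simp: abs_of_pos)

lemma sq_dist_bounds:
  assumes j: "j \<in> space \<mu>"
  shows "0 \<le> sq_dist j" "sq_dist j \<le> 2 * b"
proof -
  show "0 \<le> sq_dist j" by (simp add: sq_dist_def)
  have "sq_dist j \<le> (\<integral>x. b * (p j x + p0 x) \<partial>\<Lambda>)"
    unfolding sq_dist_def
  proof (rule integral_mono)
    show "integrable \<Lambda> (\<lambda>x. (p j x - p0 x)\<^sup>2)"
      using difference_bounds(3)[OF j] j by (intro Lam.bounded_integrable[of _ "b\<^sup>2"]) auto
    fix x assume x: "x \<in> space \<Lambda>"
    have "\<bar>p j x - p0 x\<bar> * \<bar>p j x - p0 x\<bar> \<le> b * (p j x + p0 x)"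
      using difference_bounds[OF j x] b by (intro mult_mono) auto
    then show "(p j x - p0 x)\<^sup>2 \<le> b * (p j x + p0 x)" by (simp add: power2_eq_square)
  qed (use p_integrable[OF j] p0_integrable in auto)
  also have "\<dots> = 2 * b"
    using p_integrable[OF j] p0_integrable p_integral[OF j] p0_integral by simp
  finally show "sq_dist j \<le> 2 * b" .
qed

lemma weighted_sq_dist:
  assumes j: "j \<in> space \<mu>"
    and r [measurable]: "r \<in> borel_measurable \<Lambda>" and rb: "\<And>x. x \<in> space \<Lambda> \<Longrightarrow> 0 \<le> r x \<and> r x \<le> b"
  shows "(\<integral>x. r x * (p j x - p0 x)\<^sup>2 \<partial>\<Lambda>) \<le> b * sq_dist j"
proof -
  note [measurable] = p_measurable'[OF j]
  have "(\<integral>x. r x * (p j x - p0 x)\<^sup>2 \<partial>\<Lambda>) \<le> (\<integral>x. b * (p j x - p0 x)\<^sup>2 \<partial>\<Lambda>)"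
  proof (rule integral_mono)
    show "integrable \<Lambda> (\<lambda>x. r x * (p j x - p0 x)\<^sup>2)"
      using difference_bounds(3)[OF j] rb by (intro bounded_times_integrable[of _ "b\<^sup>2"]) auto
    show "integrable \<Lambda> (\<lambda>x. b * (p j x - p0 x)\<^sup>2)"
      using difference_bounds(3)[OF j] b by (intro bounded_times_integrable[of _ "b\<^sup>2"]) auto
  qed (use rb in \<open>auto intro!: mult_right_mono\<close>)
  then show ?thesis by (simp add: sq_dist_def)
qed

text \<open>The variance of \<open>p j - p0\<close> under \<open>p0\<close> is nonnegative, and its
  second moment is at most \<open>b * sq_dist j\<close>.\<close>

lemma mean_square_le:
  assumes j: "j \<in> space \<mu>"
  shows "(\<integral>x. (p j x - p0 x) * p0 x \<partial>\<Lambda>)\<^sup>2 \<le> b * sq_dist j"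
proof -
  note [measurable] = p_measurable'[OF j]
  define m where "m = (\<integral>x. p0 x * (p j x - p0 x) \<partial>\<Lambda>)"
  have b0: "0 \<le> p0 x \<and> p0 x \<le> b" if "x \<in> space \<Lambda>" for x
    using p0_bounds[OF that] pos(3)[OF that] by auto
  have i1: "integrable \<Lambda> (\<lambda>x. p0 x * (p j x - p0 x)\<^sup>2)"
    using difference_bounds(3)[OF j] b0 by (intro bounded_times_integrable[of _ "b\<^sup>2"]) auto
  have i2: "integrable \<Lambda> (\<lambda>x. p0 x * (p j x - p0 x))"
    using difference_bounds(1)[OF j] b0 by (intro bounded_times_integrable[of _ b]) auto
  have "0 \<le> (\<integral>x. p0 x * (p j x - p0 x - m)\<^sup>2 \<partial>\<Lambda>)"
    using b0 by (intro Bochner_Integration.integral_nonneg_AE AE_I2) auto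
  also have "\<dots> = (\<integral>x. p0 x * (p j x - p0 x)\<^sup>2 - 2 * m * (p0 x * (p j x - p0 x)) + m\<^sup>2 * p0 x \<partial>\<Lambda>)"
    by (intro Bochner_Integration.integral_cong) (auto simp: power2_eq_square algebra_simps)
  also have "\<dots> = (\<integral>x. p0 x * (p j x - p0 x)\<^sup>2 \<partial>\<Lambda>) - 2 * m * m + m\<^sup>2 * 1"
    using i1 i2 p0_integrable p0_integral by (simp add: m_def)
  also have "\<dots> \<le> b * sq_dist j - m\<^sup>2"
    using weighted_sq_dist[OF j p0_measurable b0] by (simp add: power2_eq_square)
  finally show ?thesis by (simp add: m_def mult.commute)
qed

lemma abs_center_le: "j \<in> space \<mu> \<Longrightarrow> \<bar>center j\<bar> \<le> 2 * b"
proof -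
  assume j: "j \<in> space \<mu>"
  note [measurable] = p_measurable'[OF j]
  have b0: "0 \<le> p0 x \<and> p0 x \<le> b" if "x \<in> space \<Lambda>" for x
    using p0_bounds[OF that] pos(3)[OF that] by auto
  have "\<bar>\<integral>x. (p j x - p0 x) * p0 x \<partial>\<Lambda>\<bar> \<le> (\<integral>x. \<bar>(p j x - p0 x) * p0 x\<bar> \<partial>\<Lambda>)"
    by (rule integral_abs_bound)
  also have "\<dots> \<le> (\<integral>x. b * p0 x \<partial>\<Lambda>)"
  proof (rule integral_mono)
    show "integrable \<Lambda> (\<lambda>x. \<bar>(p j x - p0 x) * p0 x\<bar>)"
      using bounded_times_integrable[of "\<lambda>x. p j x - p0 x" b p0] difference_bounds(1)[OF j] b0
      by (intro integrable_abs) (auto simp: mult.commute)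
  qed (use p0_integrable difference_bounds(1)[OF j] b0 in \<open>auto simp: abs_mult intro!: mult_right_mono\<close>)
  also have "\<dots> = b" using p0_integral by simp
  finally show "\<bar>center j\<bar> \<le> 2 * b"
    using sq_dist_bounds[OF j] unfolding center_def by linarith
qed

lemma tilt_measurable [measurable]: "j \<in> space \<mu> \<Longrightarrow> tilt j \<in> borel_measurable \<Lambda>"
  unfolding tilt_def[abs_def] using p_measurable'[of j] by measurable

lemma abs_tilt_le_1:
  assumes j: "j \<in> space \<mu>" and x: "x \<in> space \<Lambda>"
  shows "\<bar>tilt j x\<bar> \<le> 1"
proof -
  have "\<bar>p j x - p0 x - center j\<bar> \<le> 60 * b"
    using difference_bounds(1)[OF assms] abs_center_le[OF j] by linarith
  then show ?thesis using b by (simp add: tilt_def abs_mult abs_of_pos)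
qed

text \<open>The density \<open>r\<close> is \<open>p0\<close> for the error of the first kind and
  \<open>p u\<close> for that of the second. The second-order term must be a small fraction of scale
  times \<open>sq_dist j\<close>, since the linear terms gain only a half and a quarter of that
  product.\<close>

lemma tilt_second_moment:
  assumes j: "j \<in> space \<mu>"
    and r [measurable]: "r \<in> borel_measurable \<Lambda>" and rb: "\<And>x. x \<in> space \<Lambda> \<Longrightarrow> 0 \<le> r x \<and> r x \<le> b"
    and r1: "(\<integral>x. r x \<partial>\<Lambda>) = 1"
  shows "(\<integral>x. r x * (tilt j x)\<^sup>2 \<partial>\<Lambda>) \<le> 1 / (60 * b) * sq_dist j / 8"
proof -
  note [measurable] = p_measurable'[OF j]
  define m where "m = (\<integral>x. (p j x - p0 x) * p0 x \<partial>\<Lambda>)"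
  define D where "D = sq_dist j"
  define c where "c = 1 / (60 * b)"
  have m: "m\<^sup>2 \<le> b * D" unfolding m_def D_def by (rule mean_square_le[OF j])
  have D: "0 \<le> D" "D \<le> 2 * b" using sq_dist_bounds[OF j] by (auto simp: D_def)
  have DD: "D\<^sup>2 \<le> 2 * b * D" unfolding power2_eq_square using D by (intro mult_right_mono) auto
  have ri: "integrable \<Lambda> r"
    using rb b by (intro Lam.bounded_integrable[of _ b]) auto
  have i1: "integrable \<Lambda> (\<lambda>x. r x * (p j x - p0 x)\<^sup>2)"
    using difference_bounds(3)[OF j] rb by (intro bounded_times_integrable[of _ "b\<^sup>2"]) auto
  have "(\<integral>x. r x * (tilt j x)\<^sup>2 \<partial>\<Lambda>) \<le> (\<integral>x. c\<^sup>2 * (3 * (r x * (p j x - p0 x)\<^sup>2) + (3 * m\<^sup>2 + 3/4 * D\<^sup>2) * r x) \<partial>\<Lambda>)"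
  proof (rule integral_mono)
    show "integrable \<Lambda> (\<lambda>x. r x * (tilt j x)\<^sup>2)"
      using abs_tilt_le_1[OF j] rb j
      by (intro bounded_times_integrable[of _ 1]) (auto simp: abs_square_le_1)
    fix x assume x: "x \<in> space \<Lambda>"
    define f where "f = p j x - p0 x"
    have "(f - (m + D / 2))\<^sup>2 \<le> 3 * f\<^sup>2 + 3 * m\<^sup>2 + 3/4 * D\<^sup>2"
      using sum_squares_ge_zero[of "f + m" "f + D / 2"] zero_le_power2[of "m - D / 2"]
      by (simp add: power2_eq_square algebra_simps)
    then have "c\<^sup>2 * (r x * (f - (m + D / 2))\<^sup>2) \<le> c\<^sup>2 * (r x * (3 * f\<^sup>2 + 3 * m\<^sup>2 + 3/4 * D\<^sup>2))"
      using rb[OF x] by (intro mult_left_mono) auto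
    moreover have "r x * (tilt j x)\<^sup>2 = c\<^sup>2 * (r x * (f - (m + D / 2))\<^sup>2)"
      unfolding tilt_def center_def c_def[symmetric] m_def[symmetric] D_def[symmetric] f_def[symmetric]
      by (simp only: power_mult_distrib mult.left_commute)
    ultimately show "r x * (tilt j x)\<^sup>2 \<le> c\<^sup>2 * (3 * (r x * (p j x - p0 x)\<^sup>2) + (3 * m\<^sup>2 + 3/4 * D\<^sup>2) * r x)"
      unfolding f_def[symmetric] by (simp only: distrib_left mult_ac) (simp add: mult_ac)?
  qed (use ri i1 in auto)
  also have "\<dots> = c\<^sup>2 * (3 * (\<integral>x. r x * (p j x - p0 x)\<^sup>2 \<partial>\<Lambda>) + (3 * m\<^sup>2 + 3/4 * D\<^sup>2))"
    using ri i1 r1 by simp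
  \<comment> \<open>Origin of both constants: the squares of f, m and D/2 contribute 3, 3 and 3/2
    times \<open>b * D\<close>, in total 15/2, and the scale \<open>1 / (60 * b)\<close> is chosen
    so that the product becomes exactly \<open>c * D / 8\<close>.\<close>
  also have "\<dots> \<le> c\<^sup>2 * (15/2 * b * D)"
    using weighted_sq_dist[OF j r rb] m DD unfolding D_def[symmetric] by (intro mult_left_mono) auto
  also have "\<dots> = c * D / 8" using b by (simp add: c_def power2_eq_square)
  finally show ?thesis by (simp add: c_def D_def)
qed

lemma integral_exp_le:
  assumes r [measurable]: "r \<in> borel_measurable \<Lambda>" and rb: "\<And>x. x \<in> space \<Lambda> \<Longrightarrow> 0 \<le> r x \<and> r x \<le> b"
    and r1: "(\<integral>x. r x \<partial>\<Lambda>) = 1"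
    and y [measurable]: "y \<in> borel_measurable \<Lambda>" and yb: "\<And>x. x \<in> space \<Lambda> \<Longrightarrow> \<bar>y x\<bar> \<le> 1"
  shows "(\<integral>x. r x * exp (y x) \<partial>\<Lambda>) \<le> 1 + (\<integral>x. r x * y x \<partial>\<Lambda>) + (\<integral>x. r x * (y x)\<^sup>2 \<partial>\<Lambda>)"
proof -
  have i: "integrable \<Lambda> r" "integrable \<Lambda> (\<lambda>x. r x * y x)" "integrable \<Lambda> (\<lambda>x. r x * (y x)\<^sup>2)"
    using bounded_times_integrable[of "\<lambda>_. 1" 1 r] bounded_times_integrable[of y 1 r]
      bounded_times_integrable[of "\<lambda>x. (y x)\<^sup>2" 1 r] rb yb by (auto simp: abs_square_le_1)
  have "(\<integral>x. r x * exp (y x) \<partial>\<Lambda>) \<le> (\<integral>x. r x + r x * y x + r x * (y x)\<^sup>2 \<partial>\<Lambda>)"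
  proof (rule integral_mono)
    show "integrable \<Lambda> (\<lambda>x. r x * exp (y x))"
      using rb yb by (intro bounded_times_integrable[of _ "exp 1"]) (auto simp: abs_le_iff)
    fix x assume x: "x \<in> space \<Lambda>"
    have "r x * exp (y x) \<le> r x * (1 + y x + (y x)\<^sup>2)"
      using exp_le_quadratic[OF yb[OF x]] rb[OF x] by (intro mult_left_mono) auto
    then show "r x * exp (y x) \<le> r x + r x * y x + r x * (y x)\<^sup>2" by (simp add: algebra_simps)
  qed (use i in auto)
  then show ?thesis using i r1 by simp
qed

text \<open>The linear term is -c D / 2 and the quadratic one at most c D / 8. The result is
  weakened to exponent c D / 8 = D / (480 b), the one available under the alternative.\<close>

lemma tilt_expectation_null:
  assumes j: "j \<in> space \<mu>"
  shows "(\<integral>x. p0 x * exp (tilt j x) \<partial>\<Lambda>) \<le> exp (- sq_dist j / (480 * b))"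
proof -
  note [measurable] = p_measurable'[OF j] tilt_measurable[OF j]
  define D where "D = sq_dist j"
  define c where "c = 1 / (60 * b)"
  have tc: "tilt j x = c * (p j x - p0 x - center j)" for x by (simp add: tilt_def c_def)
  have c: "0 < c" using b by (simp add: c_def)
  have D: "0 \<le> D" using sq_dist_bounds[OF j] by (auto simp: D_def)
  have b0: "0 \<le> p0 x \<and> p0 x \<le> b" if "x \<in> space \<Lambda>" for x
    using p0_bounds[OF that] pos(3)[OF that] by auto
  have i2: "integrable \<Lambda> (\<lambda>x. p0 x * (p j x - p0 x))"
    using difference_bounds(1)[OF j] b0 by (intro bounded_times_integrable[of _ b]) auto
  have "(\<integral>x. p0 x * tilt j x \<partial>\<Lambda>) = (\<integral>x. c * (p0 x * (p j x - p0 x)) - c * center j * p0 x \<partial>\<Lambda>)"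
    by (intro Bochner_Integration.integral_cong) (auto simp: tc algebra_simps)
  also have "\<dots> = c * (\<integral>x. p0 x * (p j x - p0 x) \<partial>\<Lambda>) - c * center j"
    using i2 p0_integrable p0_integral by simp
  also have "\<dots> = - (c * D / 2)"
    by (simp add: center_def D_def mult.commute algebra_simps)
  finally have "(\<integral>x. p0 x * exp (tilt j x) \<partial>\<Lambda>) \<le> 1 + (- (c * D / 2)) + c * D / 8"
    using integral_exp_le[OF p0_measurable b0 p0_integral tilt_measurable[OF j] abs_tilt_le_1[OF j]]
      tilt_second_moment[OF j p0_measurable b0 p0_integral] by (simp add: c_def D_def)
  also have "\<dots> \<le> 1 + (- (c * D / 8))" using c D by simp
  also have "\<dots> \<le> exp (- (c * D / 8))" by (rule exp_ge_add_one_self)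
  finally show ?thesis by (simp add: c_def D_def mult.commute)
qed

text \<open>The mean of p j - p0 under \<open>p u\<close> differs from that under \<open>p j\<close>
  by a cross term, which closeness bounds by D / 4. It still exceeds the centre by D / 4, and after
  the quadratic term c D / 8 remains.\<close>

lemma tilt_expectation_alternative:
  assumes j: "j \<in> space \<mu>" and u: "u \<in> space \<mu>"
    and close: "16 * (\<integral>x. (p u x - p j x)\<^sup>2 \<partial>\<Lambda>) \<le> sq_dist j"
  shows "(\<integral>x. p u x * exp (- tilt j x) \<partial>\<Lambda>) \<le> exp (- sq_dist j / (480 * b))"
proof -
  note [measurable] = p_measurable'[OF j] p_measurable'[OF u] tilt_measurable[OF j]
  define D where "D = sq_dist j"
  define E where "E = (\<integral>x. (p u x - p j x)\<^sup>2 \<partial>\<Lambda>)"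
  define m where "m = (\<integral>x. (p j x - p0 x) * p0 x \<partial>\<Lambda>)"
  define c where "c = 1 / (60 * b)"
  have tc: "tilt j x = c * (p j x - p0 x - center j)" for x by (simp add: tilt_def c_def)
  have c: "0 < c" using b by (simp add: c_def)
  have D: "0 \<le> D" using sq_dist_bounds[OF j] by (auto simp: D_def)
  have bu: "0 \<le> p u x \<and> p u x \<le> b" if "x \<in> space \<Lambda>" for x
    using p_bounds[OF u that] pos(2)[OF u that] by auto
  have b0: "0 \<le> p0 x \<and> p0 x \<le> b" if "x \<in> space \<Lambda>" for x
    using p0_bounds[OF that] pos(3)[OF that] by auto
  have i2: "integrable \<Lambda> (\<lambda>x. p u x * (p j x - p0 x))"
    using difference_bounds(1)[OF j] bu by (intro bounded_times_integrable[of _ b]) auto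
  have i3: "integrable \<Lambda> (\<lambda>x. (p j x - p0 x) * p0 x)"
    using bounded_times_integrable[of "\<lambda>x. p j x - p0 x" b p0] difference_bounds(1)[OF j] b0
    by (simp add: mult.commute)
  have i4: "integrable \<Lambda> (\<lambda>x. (p j x - p0 x)\<^sup>2)"
    using difference_bounds(3)[OF j] by (intro Lam.bounded_integrable[of _ "b\<^sup>2"]) auto
  have i5: "integrable \<Lambda> (\<lambda>x. (p u x - p j x)\<^sup>2)"
  proof (rule Lam.bounded_integrable[of _ "b\<^sup>2"])
    fix x assume x: "x \<in> space \<Lambda>"
    have "\<bar>p u x - p j x\<bar> \<le> b" using bu[OF x] p_bounds[OF j x] pos(2)[OF j x] by auto
    then have "\<bar>p u x - p j x\<bar>\<^sup>2 \<le> b\<^sup>2" by (intro power_mono) auto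
    then show "\<bar>(p u x - p j x)\<^sup>2\<bar> \<le> b\<^sup>2" by simp
  qed simp
  have "m + 7/8 * D = (\<integral>x. (p j x - p0 x) * p0 x + (p j x - p0 x)\<^sup>2 - 1/8 * (p j x - p0 x)\<^sup>2 \<partial>\<Lambda>)"
    using i3 i4 by (simp add: m_def D_def sq_dist_def)
  also have "\<dots> \<le> (\<integral>x. p u x * (p j x - p0 x) + 2 * (p u x - p j x)\<^sup>2 \<partial>\<Lambda>)"
  proof (rule integral_mono)
    fix x
    \<comment> \<open>Weighted form of 2ab \<le> a^2 + b^2: with f = p j - p0 and g = p u - p j it
      gives f g \<ge> - f^2 / 8 - 2 g^2. After integration both losses are at most D / 8, the second
      one by \<open>close\<close>.\<close>
    have "0 \<le> 2 * ((p j x - p0 x) / 4 + (p u x - p j x))\<^sup>2" by simp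
    then show "(p j x - p0 x) * p0 x + (p j x - p0 x)\<^sup>2 - 1/8 * (p j x - p0 x)\<^sup>2 \<le> p u x * (p j x - p0 x) + 2 * (p u x - p j x)\<^sup>2"
      by (simp add: power2_eq_square field_simps)
  qed (use i2 i3 i4 i5 in auto)
  also have "\<dots> = (\<integral>x. p u x * (p j x - p0 x) \<partial>\<Lambda>) + 2 * E"
    using i2 i5 by (simp add: E_def)
  finally have mean: "m + 3/4 * D \<le> (\<integral>x. p u x * (p j x - p0 x) \<partial>\<Lambda>)"
    using close by (simp add: E_def D_def)
  have "(\<integral>x. p u x * - tilt j x \<partial>\<Lambda>) = (\<integral>x. c * center j * p u x - c * (p u x * (p j x - p0 x)) \<partial>\<Lambda>)"
    by (intro Bochner_Integration.integral_cong) (auto simp: tc algebra_simps)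
  also have "\<dots> = (\<integral>x. c * center j * p u x \<partial>\<Lambda>) - (\<integral>x. c * (p u x * (p j x - p0 x)) \<partial>\<Lambda>)"
    using i2 p_integrable[OF u] by (intro Bochner_Integration.integral_diff) auto
  also have "\<dots> = c * (center j - (\<integral>x. p u x * (p j x - p0 x) \<partial>\<Lambda>))"
    using p_integral[OF u] unfolding integral_mult_right_zero by (simp only: right_diff_distrib mult_1_right)
  also have "\<dots> \<le> c * (- (1/4 * D))"
    using mean c by (intro mult_left_mono) (auto simp: center_def D_def[symmetric] m_def[symmetric])
  finally have "(\<integral>x. p u x * exp (- tilt j x) \<partial>\<Lambda>) \<le> 1 + c * (- (1/4 * D)) + c * D / 8"
    using integral_exp_le[OF p_measurable'[OF u] bu p_integral[OF u], of "\<lambda>x. - tilt j x"] abs_tilt_le_1[OF j]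
      tilt_second_moment[OF j p_measurable'[OF u] bu p_integral[OF u]] by (simp add: c_def D_def)
  also have "\<dots> = 1 + (- (c * D / 8))" by simp
  also have "\<dots> \<le> exp (- (c * D / 8))" by (rule exp_ge_add_one_self)
  finally show ?thesis by (simp add: c_def D_def mult.commute)
qed

end

context density_model
begin

text \<open>The left side is 1 plus the chi-square divergence of \<open>p0\<close> from
  \<open>p u\<close>, by the pointwise identity p0^2 / p = (p - p0)^2 / p + 2 p0 - p. Being an
  expectation of a ratio and not of its logarithm, it tensorises and suits Markov's
  inequality.\<close>

lemma expected_inverse_likelihood_ratio:
  assumes u: "u \<in> space \<mu>"
  shows "(\<integral>x. p0 x * (p0 x / p u x) \<partial>\<Lambda>) \<le> exp (b * sq_dist u)"
proof -
  note [measurable] = p_measurable'[OF u]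
  have i: "integrable \<Lambda> (\<lambda>x. (p u x - p0 x)\<^sup>2)"
    using difference_bounds(3)[OF u] by (intro Lam.bounded_integrable[of _ "b\<^sup>2"]) auto
  have ratio: "(p u x - p0 x)\<^sup>2 / p u x \<le> b * (p u x - p0 x)\<^sup>2" if x: "x \<in> space \<Lambda>" for x
  proof -
    have "1 / p u x \<le> b" using p_bounds[OF u x] pos(1) pos(2)[OF u x] by (simp add: field_simps)
    then have "(p u x - p0 x)\<^sup>2 * (1 / p u x) \<le> (p u x - p0 x)\<^sup>2 * b" by (intro mult_left_mono) auto
    then show ?thesis by (simp add: mult.commute)
  qed
  have "(\<integral>x. p0 x * (p0 x / p u x) \<partial>\<Lambda>) \<le> (\<integral>x. b * (p u x - p0 x)\<^sup>2 + 2 * p0 x - p u x \<partial>\<Lambda>)"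
  proof (rule integral_mono_AE')
    show "integrable \<Lambda> (\<lambda>x. b * (p u x - p0 x)\<^sup>2 + 2 * p0 x - p u x)"
      using i p_integrable[OF u] p0_integrable by auto
    have *: "p0 x * (p0 x / p u x) \<le> b * (p u x - p0 x)\<^sup>2 + 2 * p0 x - p u x \<and> 0 \<le> p0 x * (p0 x / p u x)"
      if x: "x \<in> space \<Lambda>" for x
    proof -
      have "p0 x * (p0 x / p u x) = (p u x - p0 x)\<^sup>2 / p u x + 2 * p0 x - p u x"
        using pos(2)[OF u x] by (simp add: field_simps power2_eq_square)
      moreover have "0 \<le> p0 x * (p0 x / p u x)" using pos(2)[OF u x] pos(3)[OF x] by simp
      ultimately show ?thesis using ratio[OF x] by linarith
    qed
    show "AE x in \<Lambda>. p0 x * (p0 x / p u x) \<le> b * (p u x - p0 x)\<^sup>2 + 2 * p0 x - p u x"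
      using * by (intro AE_I2) blast
    show "AE x in \<Lambda>. 0 \<le> b * (p u x - p0 x)\<^sup>2 + 2 * p0 x - p u x"
      using * by (intro AE_I2) (meson order_trans)
  qed
  also have "\<dots> = 1 + b * sq_dist u"
    using i p_integrable[OF u] p0_integrable p_integral[OF u] p0_integral by (simp add: sq_dist_def)
  also have "\<dots> \<le> exp (b * sq_dist u)" by (rule exp_ge_add_one_self)
  finally show ?thesis .
qed

text \<open>
  The exceptional set has three parts: the prior mass of the neighbourhood \<open>V\<close> is lost, a test against
  one of the centres \<open>j\<close> rejects \<open>p0\<close>, or the likelihood mass of the cells is large although all tests
  accept. Dividing the likelihood of a cell by the statistic of its own centre makes the last event
  improbable without a union bound over the cells.
\<close>

theorem likelihood_mass_concentration:
  fixes n :: nat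
  assumes V [measurable]: "V \<in> sets \<mu>" and V_pos: "0 < measure \<mu> V"
    and \<tau>: "\<And>u. u \<in> V \<Longrightarrow> sq_dist u \<le> \<tau>"
    and J: "finite J" "J \<subseteq> space \<mu>" and c [measurable]: "c \<in> measurable \<mu> (count_space J)"
    and close: "\<And>u. u \<in> space \<mu> \<Longrightarrow> 16 * (\<integral>x. (p u x - p (c u) x)\<^sup>2 \<partial>\<Lambda>) \<le> D"
    and w: "0 < w" and \<epsilon>: "0 < \<epsilon>"
  defines "S \<equiv> {u \<in> space \<mu>. D \<le> sq_dist (c u)}"
    and "\<rho> \<equiv> exp (- (real n * D / (480 * b)))"
  shows "\<exists>Z\<in>sets sample.
    measure sample Z \<le> 1 / w + real (card J) * \<rho> + w * exp (real n * b * \<tau>) * \<rho> / (\<epsilon> * measure \<mu> V) \<and>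
    (\<forall>x\<in>space sample - Z.
      (\<integral>u. indicator S u * (\<Prod>i<n. p u (x i)) \<partial>\<mu>) \<le> \<epsilon> * (\<integral>u. (\<Prod>i<n. p u (x i)) \<partial>\<mu>))"
proof -
  have cJ: "c u \<in> J" "c u \<in> space \<mu>" if "u \<in> space \<mu>" for u
    using measurable_space[OF c that] J by auto
  have S [measurable]: "S \<in> sets \<mu>"
  proof -
    have "S = c -` {j \<in> J. D \<le> sq_dist j} \<inter> space \<mu>" using cJ by (auto simp: S_def)
    then show ?thesis using measurable_sets[OF c, of "{j \<in> J. D \<le> sq_dist j}"] by auto
  qed
  \<comment> \<open>\<open>exp (n * b * \<tau>)\<close> bounds the mean of the inverse likelihood
    ratio on \<open>V\<close>; the extra factor \<open>w\<close> makes the Markov bound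
    \<open>1 / w\<close>. Outside \<open>Z1\<close> the likelihood relative to that of
    \<open>p0\<close> integrates to at least \<open>measure \<mu> V / T\<close>.\<close>
  define T where "T = exp (real n * b * \<tau>) * w"
  have T: "0 < T" using w by (simp add: T_def)
  have \<rho>: "(exp (- sq_dist j / (480 * b))) ^ n \<le> \<rho>" if "D \<le> sq_dist j" for j
  proof -
    have "(exp (- sq_dist j / (480 * b))) ^ n = exp (- (real n * sq_dist j / (480 * b)))"
      by (simp add: exp_of_nat_mult[symmetric])
    also have "\<dots> \<le> \<rho>"
      using that pos(1) by (simp add: \<rho>_def divide_right_mono mult_left_mono)
    finally show ?thesis .
  qed

  define N1 where "N1 x = (\<integral>u. indicator V u * (\<Prod>i<n. p0 (x i) / p u (x i)) \<partial>\<mu>)" for x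
  define Z1 where "Z1 = {x \<in> space sample. measure \<mu> V * T \<le> N1 x}"
  have m1: "(\<lambda>(u, x). p0 x / p u x) \<in> borel_measurable (\<mu> \<Otimes>\<^sub>M \<Lambda>)" by measurable
  have b1: "0 \<le> p0 x / p u x \<and> p0 x / p u x \<le> b * b" if "u \<in> space \<mu>" "x \<in> space \<Lambda>" for u x
  proof -
    have "1 / p u x \<le> b" using p_bounds[OF that] pos(1) pos(2)[OF that] by (simp add: field_simps)
    then have "p0 x * (1 / p u x) \<le> b * b"
      using p0_bounds[OF that(2)] pos that by (intro mult_mono) (auto simp: less_imp_le)
    then show ?thesis using pos that by (simp add: less_imp_le)
  qed
  have k1: "(\<integral>x. p0 x * (p0 x / p u x) \<partial>\<Lambda>) ^ n \<le> exp (real n * b * \<tau>)" if "u \<in> V" for u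
  proof -
    have u: "u \<in> space \<mu>" using that sets.sets_into_space[OF V] by auto
    have "(\<integral>x. p0 x * (p0 x / p u x) \<partial>\<Lambda>) ^ n \<le> exp (b * sq_dist u) ^ n"
      using expected_inverse_likelihood_ratio[OF u] pos u
      by (intro power_mono Bochner_Integration.integral_nonneg_AE AE_I2) (auto simp: less_imp_le)
    also have "\<dots> = exp (real n * (b * sq_dist u))" by (simp add: exp_of_nat_mult)
    also have "\<dots> \<le> exp (real n * b * \<tau>)"
      using \<tau>[OF that] pos(1) by (simp add: mult_left_mono mult.assoc)
    finally show ?thesis .
  qed
  have "0 < measure \<mu> V * T" using V_pos T by simp
  note Z1_aux = prob_integrated_product_ge[OF V m1 b1 k1 this, folded N1_def, folded Z1_def]
  have Z1 [measurable]: "Z1 \<in> sets sample" and mZ1: "measure sample Z1 \<le> 1 / w"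
    using Z1_aux V_pos by (auto simp: T_def)

  \<comment> \<open>The statistic of a fixed centre does not involve \<open>u\<close>; the formal
    average over \<mu> only brings it into the shape of
    \<open>prob_integrated_product_ge\<close>.\<close>
  define Z2 where "Z2 j = {x \<in> space sample. 1 \<le> (\<integral>u. indicator (space \<mu>) u * (\<Prod>i<n. exp (tilt j (x i))) \<partial>\<mu>)}" for j
  define J' where "J' = {j \<in> J. D \<le> sq_dist j}"
  have Z2_aux: "Z2 j \<in> sets sample" "measure sample (Z2 j) \<le> measure \<mu> (space \<mu>) * \<rho> / 1" if "j \<in> J'" for j
  proof -
    have j: "j \<in> space \<mu>" "D \<le> sq_dist j" using that J by (auto simp: J'_def)
    note [measurable] = tilt_measurable[OF j(1)]
    have m2: "(\<lambda>(u, x). exp (tilt j x)) \<in> borel_measurable (\<mu> \<Otimes>\<^sub>M \<Lambda>)" by measurable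
    have b2: "0 \<le> exp (tilt j x) \<and> exp (tilt j x) \<le> exp 1" if "u \<in> space \<mu>" "x \<in> space \<Lambda>" for u :: 'u and x
      using abs_tilt_le_1[OF j(1) that(2)] by simp
    have k2: "(\<integral>x. p0 x * exp (tilt j x) \<partial>\<Lambda>) ^ n \<le> \<rho>" if "u \<in> space \<mu>" for u :: 'u
      using tilt_expectation_null[OF j(1)] pos
      by (intro order_trans[OF power_mono \<rho>[OF j(2)]] Bochner_Integration.integral_nonneg_AE AE_I2)
        (auto simp: less_imp_le)
    note Z2' = prob_integrated_product_ge[OF sets.top m2 b2 k2 zero_less_one]
    show "Z2 j \<in> sets sample" "measure sample (Z2 j) \<le> measure \<mu> (space \<mu>) * \<rho> / 1"
      unfolding Z2_def using Z2' by auto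
  qed
  have Z2 [measurable]: "Z2 j \<in> sets sample" and mZ2: "measure sample (Z2 j) \<le> \<rho>" if "j \<in> J'" for j
    using Z2_aux[OF that] by (auto simp: Mu.prob_space)

  \<comment> \<open>Under \<open>p0\<close> the mean of each product is the n-th power of the
    integral of \<open>p u\<close> times \<open>exp (- tilt (c u))\<close>, the error of the second
    kind for the centre of the cell containing \<open>u\<close>.\<close>
  define N3 where "N3 x = (\<integral>u. indicator S u * (\<Prod>i<n. p u (x i) / p0 (x i) * exp (- tilt (c u) (x i))) \<partial>\<mu>)" for x
  define Z3 where "Z3 = {x \<in> space sample. \<epsilon> * measure \<mu> V / T \<le> N3 x}"
  \<comment> \<open>Joint measurability holds because \<open>c\<close> has finitely many values and
    the statistic of each of them is measurable.\<close>
  have cm: "(\<lambda>(u, x). tilt (c u) x) \<in> borel_measurable (\<mu> \<Otimes>\<^sub>M \<Lambda>)"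
  proof -
    have "(\<lambda>z. tilt (c (fst z)) (snd z)) \<in> borel_measurable (\<mu> \<Otimes>\<^sub>M \<Lambda>)"
    proof (rule measurable_compose_countable'[where I = J and f = "\<lambda>j z. tilt j (snd z)" and g = "\<lambda>z. c (fst z)"])
      show "(\<lambda>z. tilt j (snd z)) \<in> borel_measurable (\<mu> \<Otimes>\<^sub>M \<Lambda>)" if "j \<in> J" for j
        using tilt_measurable[of j] that J by (auto intro: measurable_compose[OF measurable_snd])
    qed (use J in \<open>auto intro: countable_finite\<close>)
    then show ?thesis by (simp add: case_prod_beta')
  qed
  have m3: "(\<lambda>(u, x). p u x / p0 x * exp (- tilt (c u) x)) \<in> borel_measurable (\<mu> \<Otimes>\<^sub>M \<Lambda>)"
    using cm p_measurable unfolding case_prod_beta' by measurable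
  have b3: "0 \<le> p u x / p0 x * exp (- tilt (c u) x) \<and> p u x / p0 x * exp (- tilt (c u) x) \<le> b * b * exp 1"
    if "u \<in> space \<mu>" "x \<in> space \<Lambda>" for u x
  proof -
    have "1 / p0 x \<le> b" using p0_bounds[OF that(2)] pos(1) pos(3)[OF that(2)] by (simp add: field_simps)
    then have "p u x * (1 / p0 x) \<le> b * b"
      using p_bounds[OF that] pos that by (intro mult_mono) (auto simp: less_imp_le)
    moreover have "exp (- tilt (c u) x) \<le> exp 1"
      using abs_tilt_le_1[OF cJ(2)[OF that(1)] that(2)] by simp
    ultimately have "p u x * (1 / p0 x) * exp (- tilt (c u) x) \<le> b * b * exp 1"
      by (rule mult_mono) (use pos that in \<open>auto simp: less_imp_le\<close>)
    then show ?thesis using pos that by (simp add: less_imp_le)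
  qed
  have k3: "(\<integral>x. p0 x * (p u x / p0 x * exp (- tilt (c u) x)) \<partial>\<Lambda>) ^ n \<le> \<rho>" if "u \<in> S" for u
  proof -
    have u: "u \<in> space \<mu>" "D \<le> sq_dist (c u)" using that by (auto simp: S_def)
    have eq: "(\<integral>x. p0 x * (p u x / p0 x * exp (- tilt (c u) x)) \<partial>\<Lambda>) = (\<integral>x. p u x * exp (- tilt (c u) x) \<partial>\<Lambda>)"
      using pos(3) by (intro Bochner_Integration.integral_cong) (auto simp: less_imp_neq[symmetric])
    have "(\<integral>x. p u x * exp (- tilt (c u) x) \<partial>\<Lambda>) \<le> exp (- sq_dist (c u) / (480 * b))"
      using close[OF u(1)] u(2) by (intro tilt_expectation_alternative cJ u) auto
    then show ?thesis
      unfolding eq using pos(2)[OF u(1)]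
      by (intro order_trans[OF power_mono \<rho>[OF u(2)]] Bochner_Integration.integral_nonneg_AE AE_I2)
        (auto simp: less_imp_le)
  qed
  have "0 < \<epsilon> * measure \<mu> V / T" using V_pos T \<epsilon> by simp
  note Z3_aux = prob_integrated_product_ge[OF S m3 b3 k3 this, folded N3_def, folded Z3_def]
  have Z3 [measurable]: "Z3 \<in> sets sample"
    and mZ3: "measure sample Z3 \<le> measure \<mu> S * \<rho> / (\<epsilon> * measure \<mu> V / T)"
    using Z3_aux by auto
  note mZ3
  also have "measure \<mu> S * \<rho> / (\<epsilon> * measure \<mu> V / T) \<le> 1 * \<rho> / (\<epsilon> * measure \<mu> V / T)"
    using V_pos \<epsilon> T by (intro divide_right_mono mult_right_mono) (auto simp: \<rho>_def)
  also have "\<dots> = w * exp (real n * b * \<tau>) * \<rho> / (\<epsilon> * measure \<mu> V)" by (simp add: T_def)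
  finally have mZ3: "measure sample Z3 \<le> w * exp (real n * b * \<tau>) * \<rho> / (\<epsilon> * measure \<mu> V)" .

  define Z where "Z = Z1 \<union> (\<Union>j\<in>J'. Z2 j) \<union> Z3"
  have fJ: "finite J'" using J by (simp add: J'_def)
  have UZ2: "(\<Union>j\<in>J'. Z2 j) \<in> sets sample" using fJ Z2 by auto
  then have Z: "Z \<in> sets sample" using Z1 Z3 by (auto simp: Z_def)
  have "measure sample (\<Union>j\<in>J'. Z2 j) \<le> (\<Sum>j\<in>J'. measure sample (Z2 j))"
    using Z2 fJ by (intro Sample.finite_measure_subadditive_finite) auto
  also have "\<dots> \<le> real (card J') * \<rho>" using mZ2 by (intro sum_bounded_above) auto
  also have "\<dots> \<le> real (card J) * \<rho>"
    using J by (intro mult_right_mono) (auto simp: J'_def \<rho>_def intro!: card_mono)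
  finally have mUZ2: "measure sample (\<Union>j\<in>J'. Z2 j) \<le> real (card J) * \<rho>" .
  have "measure sample Z \<le> measure sample Z1 + measure sample (\<Union>j\<in>J'. Z2 j) + measure sample Z3"
    unfolding Z_def using measure_Un_le[of "Z1 \<union> (\<Union>j\<in>J'. Z2 j)" sample Z3] measure_Un_le[OF Z1 UZ2] Z1 UZ2 Z3
    by auto
  then have mZ: "measure sample Z \<le> 1 / w + real (card J) * \<rho> + w * exp (real n * b * \<tau>) * \<rho> / (\<epsilon> * measure \<mu> V)"
    using mZ1 mUZ2 mZ3 by linarith

  have "(\<integral>u. indicator S u * (\<Prod>i<n. p u (x i)) \<partial>\<mu>) \<le> \<epsilon> * (\<integral>u. (\<Prod>i<n. p u (x i)) \<partial>\<mu>)"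
    if x: "x \<in> space sample - Z" for x
  proof -
    let ?pos = "\<lambda>u. \<Prod>i<n. exp (tilt (c u) (x i))" and ?neg = "\<lambda>u. \<Prod>i<n. exp (- tilt (c u) (x i))"
    let ?h = "\<lambda>u. indicator S u * (\<Prod>i<n. p u (x i) / p0 (x i) * exp (- tilt (c u) (x i)))"
    have xs: "x i \<in> space \<Lambda>" for i using x space_sample by auto
    have px [measurable]: "(\<lambda>u. p u (x i)) \<in> borel_measurable \<mu>" for i
      using measurable_compose[OF measurable_Pair2'[OF xs] p_measurable] by simp
    have tx [measurable]: "(\<lambda>u. tilt (c u) (x i)) \<in> borel_measurable \<mu>" for i
      using measurable_compose[OF measurable_Pair2'[OF xs] cm] by simp
    have q0: "0 < (\<Prod>i<n. p0 (x i))" using pos(3)[OF xs] by (intro prod_pos) auto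
    define lr where "lr u = (\<Prod>i<n. p u (x i) / p0 (x i))" for u
    have [measurable]: "lr \<in> borel_measurable \<mu>" unfolding lr_def by measurable
    have lr: "0 < lr u" "lr u \<le> (b * b) ^ n" "inverse (lr u) \<le> (b * b) ^ n" if u: "u \<in> space \<mu>" for u
    proof -
      show "0 < lr u" unfolding lr_def using pos(2)[OF u xs] pos(3)[OF xs] by (intro prod_pos) auto
      have 1: "1 / p0 (x i) \<le> b" "1 / p u (x i) \<le> b" for i
        using p_bounds[OF u xs, of i] p0_bounds[OF xs, of i] pos(2)[OF u xs, of i] pos(3)[OF xs, of i] pos(1)
        by (simp_all add: field_simps)
      have "p u (x i) * (1 / p0 (x i)) \<le> b * b" "p0 (x i) * (1 / p u (x i)) \<le> b * b" for i
        using p_bounds[OF u xs, of i] p0_bounds[OF xs, of i] pos(2)[OF u xs, of i] pos(3)[OF xs, of i] 1[of i]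
        by (intro mult_mono; simp add: less_imp_le)+
      then have 2: "p u (x i) / p0 (x i) \<le> b * b" "p0 (x i) / p u (x i) \<le> b * b" for i by simp_all
      have "lr u \<le> (\<Prod>i<n. b * b)" unfolding lr_def
        using 2 pos(2)[OF u xs] pos(3)[OF xs] by (intro prod_mono) (auto simp: less_imp_le)
      then show "lr u \<le> (b * b) ^ n" by simp
      have "inverse (lr u) = (\<Prod>i<n. p0 (x i) / p u (x i))"
        unfolding lr_def by (simp add: prod_dividef)
      also have "\<dots> \<le> (\<Prod>i<n. b * b)"
        using 2 pos(2)[OF u xs] pos(3)[OF xs] by (intro prod_mono) (auto simp: less_imp_le)
      finally show "inverse (lr u) \<le> (b * b) ^ n" by simp
    qed
    have bb: "0 \<le> (b * b) ^ n" using pos(1) by simp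
    have ilr: "integrable \<mu> lr" "integrable \<mu> (\<lambda>u. indicator V u * lr u)"
        "integrable \<mu> (\<lambda>u. indicator V u * inverse (lr u))" "integrable \<mu> (\<lambda>u. indicator S u * lr u)"
      using lr bb by (auto intro!: Mu.bounded_integrable[of _ "(b * b) ^ n"] simp: indicator_def abs_of_pos)
    have n1: "N1 x = (\<integral>u. indicator V u * inverse (lr u) \<partial>\<mu>)"
      unfolding N1_def lr_def by (simp add: prod_dividef)
    \<comment> \<open>The inequality z + 1 / z \<ge> 2 with z = \<open>T * lr u\<close>, averaged
      over \<open>V\<close>, converts the upper bound on the mean of the inverse ratio into a lower
      bound on the mean of the ratio.\<close>
    have "2 * measure \<mu> V = (\<integral>u. 2 * indicator V u \<partial>\<mu>)" by simp
    also have "\<dots> \<le> (\<integral>u. T * (indicator V u * lr u) + 1 / T * (indicator V u * inverse (lr u)) \<partial>\<mu>)"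
    proof (rule integral_mono)
      show "integrable \<mu> (\<lambda>u. 2 * indicator V u :: real)"
        by (intro Mu.bounded_integrable[of _ 2]) (auto simp: indicator_def)
      fix u assume u: "u \<in> space \<mu>"
      have "2 \<le> T * lr u + 1 / T * inverse (lr u)"
      proof -
        have "0 < T * lr u" using T lr(1)[OF u] by simp
        moreover have "2 \<le> z + 1 / z" if "0 < z" for z :: real
          using that sum_squares_ge_zero[of "z - 1" 0] by (simp add: field_simps)
        ultimately have "2 \<le> T * lr u + 1 / (T * lr u)" by blast
        then show ?thesis by (simp add: field_simps)
      qed
      then show "2 * indicator V u \<le> T * (indicator V u * lr u) + 1 / T * (indicator V u * inverse (lr u))"
        by (auto simp: indicator_def)
    qed (use ilr in auto)
    also have "\<dots> = T * (\<integral>u. indicator V u * lr u \<partial>\<mu>) + 1 / T * N1 x"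
      using ilr by (simp add: n1)
    also have "1 / T * N1 x \<le> 1 / T * (measure \<mu> V * T)"
      using x T by (intro mult_left_mono) (auto simp: Z_def Z1_def)
    finally have "measure \<mu> V \<le> T * (\<integral>u. indicator V u * lr u \<partial>\<mu>)" using T by simp
    then have "measure \<mu> V / T \<le> (\<integral>u. indicator V u * lr u \<partial>\<mu>)" using T by (simp add: field_simps)
    also have "\<dots> \<le> (\<integral>u. lr u \<partial>\<mu>)"
      using ilr lr by (intro integral_mono) (auto simp: indicator_def less_imp_le)
    finally have denom: "measure \<mu> V / T \<le> (\<integral>u. lr u \<partial>\<mu>)" .
    have "(\<integral>u. indicator S u * lr u \<partial>\<mu>) \<le> N3 x"
      unfolding N3_def
    proof (rule integral_mono)
      show "integrable \<mu> ?h"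
      proof (rule Mu.bounded_integrable[of _ "(b * b) ^ n * exp 1 ^ n"])
        fix u assume u: "u \<in> space \<mu>"
        have "?neg u \<le> (\<Prod>i<n. exp 1)"
        proof (intro prod_mono conjI)
          fix i show "exp (- tilt (c u) (x i)) \<le> exp 1"
            using abs_tilt_le_1[OF cJ(2)[OF u] xs, of i] by simp
        qed simp
        then have "lr u * ?neg u \<le> (b * b) ^ n * exp 1 ^ n"
          using lr[OF u] bb by (intro mult_mono) (auto intro!: prod_nonneg)
        moreover have "0 \<le> lr u * ?neg u"
          using lr(1)[OF u] by (intro mult_nonneg_nonneg prod_nonneg) auto
        ultimately show "\<bar>?h u\<bar> \<le> (b * b) ^ n * exp 1 ^ n"
          unfolding lr_def prod.distrib by (auto simp: indicator_def)
      qed measurable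
      fix u assume u: "u \<in> space \<mu>"
      \<comment> \<open>Outside the sets \<open>Z2 j\<close> every relevant statistic is below 1, so
        dividing by the one of the own centre can only increase the likelihood ratio.\<close>
      show "indicator S u * lr u \<le> ?h u"
      proof (cases "u \<in> S")
        case True
        then have "c u \<in> J'" using cJ[OF u] by (auto simp: S_def J'_def)
        then have "x \<notin> Z2 (c u)" using x by (auto simp: Z_def)
        then have "(\<integral>u'. indicator (space \<mu>) u' * ?pos u \<partial>\<mu>) < 1"
          using x by (auto simp: Z2_def)
        moreover have "(\<integral>u'. indicator (space \<mu>) u' * ?pos u \<partial>\<mu>) = ?pos u"
          by (simp add: Mu.prob_space)
        ultimately have "?pos u < 1" by simp
        moreover have "0 < ?pos u" by (intro prod_pos) auto
        ultimately have "1 \<le> inverse (?pos u)" by (simp add: one_le_inverse)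
        also have "\<dots> = ?neg u" by (simp add: exp_minus prod_inversef[symmetric] o_def)
        finally have "lr u * 1 \<le> lr u * ?neg u"
          using lr(1)[OF u] by (intro mult_left_mono) auto
        then show ?thesis using True unfolding lr_def prod.distrib by simp
      qed simp
    qed (use ilr in auto)
    also have "N3 x \<le> \<epsilon> * (measure \<mu> V / T)" using x by (auto simp: Z_def Z3_def)
    also have "\<dots> \<le> \<epsilon> * (\<integral>u. lr u \<partial>\<mu>)" using denom \<epsilon> by (intro mult_left_mono) auto
    finally have "(\<Prod>i<n. p0 (x i)) * (\<integral>u. indicator S u * lr u \<partial>\<mu>) \<le> (\<Prod>i<n. p0 (x i)) * (\<epsilon> * (\<integral>u. lr u \<partial>\<mu>))"
      using q0 by (intro mult_left_mono) auto
    moreover have prod_lr: "(\<Prod>i<n. p u (x i)) = (\<Prod>i<n. p0 (x i)) * lr u" for u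
      unfolding lr_def prod_dividef times_divide_eq_right
      using q0 by (intro nonzero_mult_div_cancel_left[symmetric]) (rule less_imp_neq[symmetric])
    ultimately show ?thesis
      unfolding prod_lr mult.left_commute[of "indicator S _"] integral_mult_right_zero
      by (simp only: mult.left_commute)
  qed
  then show ?thesis using Z mZ by blast
qed

end

section \<open>Exponential densities and the prior\<close>

lemma abs_exp_diff_le:
  fixes a b :: real
  assumes "a \<le> c" "b \<le> c"
  shows "\<bar>exp a - exp b\<bar> \<le> exp c * \<bar>a - b\<bar>"
proof -
  have *: "exp y - exp x \<le> exp c * (y - x)" if "x \<le> y" "y \<le> c" for x y :: real
  proof -
    have "exp y * (1 + (x - y)) \<le> exp y * exp (x - y)"
      by (intro mult_left_mono exp_ge_add_one_self) auto
    then have "exp y - exp x \<le> exp y * (y - x)" by (simp add: exp_add[symmetric] algebra_simps)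
    also have "\<dots> \<le> exp c * (y - x)" using that by (intro mult_right_mono) auto
    finally show ?thesis .
  qed
  show ?thesis
    using *[of a b] *[of b a] assms by (cases "a \<le> b") auto
qed

definition log_normalizer :: "(real \<Rightarrow> real) \<Rightarrow> real" where
  "log_normalizer V = ln (\<integral>x. exp (V x) \<partial>unif)"

context
  fixes V :: "real \<Rightarrow> real" and H :: real
  assumes V: "continuous_on {0..1} V" and H: "\<And>x. x \<in> {0..1} \<Longrightarrow> \<bar>V x\<bar> \<le> H"
begin

lemma exp_integrable: "integrable unif (\<lambda>x. exp (V x))"
  by (intro continuous_integrable_unif continuous_intros V)

lemma normalizer_bounds:
  "exp (- H) \<le> (\<integral>x. exp (V x) \<partial>unif)" "(\<integral>x. exp (V x) \<partial>unif) \<le> exp H"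
proof -
  have "(\<integral>x. exp (- H) \<partial>unif) \<le> (\<integral>x. exp (V x) \<partial>unif)"
    using H exp_integrable by (intro integral_mono) (auto simp: abs_le_iff minus_le_iff)
  then show "exp (- H) \<le> (\<integral>x. exp (V x) \<partial>unif)" by simp
  have "(\<integral>x. exp (V x) \<partial>unif) \<le> (\<integral>x. exp H \<partial>unif)"
    using H exp_integrable by (intro integral_mono) (auto simp: abs_le_iff)
  then show "(\<integral>x. exp (V x) \<partial>unif) \<le> exp H" by simp
qed

lemma normalizer_pos: "0 < (\<integral>x. exp (V x) \<partial>unif)"
  using normalizer_bounds(1) exp_gt_zero less_le_trans by blast

lemma log_normalizer_bound: "\<bar>log_normalizer V\<bar> \<le> H"
proof -
  have "ln (exp (- H)) \<le> log_normalizer V" "log_normalizer V \<le> ln (exp H)"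
    unfolding log_normalizer_def using normalizer_bounds normalizer_pos by (simp_all only: ln_mono exp_gt_zero)
  then show ?thesis by simp
qed

lemma exp_density_eq: "x \<in> {0..1} \<Longrightarrow> exp_density V x = exp (V x - log_normalizer V)"
  using normalizer_pos
  by (simp add: exp_density_def LBINT_eq_unif exp_diff log_normalizer_def)

lemma exp_density_bounds:
  assumes "x \<in> {0..1}"
  shows "exp (- (2 * H)) \<le> exp_density V x" "exp_density V x \<le> exp (2 * H)"
  using log_normalizer_bound H[OF assms] by (auto simp: exp_density_eq[OF assms])

lemma exp_density_continuous: "continuous_on {0..1} (exp_density V)"
proof (rule continuous_on_eq)
  show "continuous_on {0..1} (\<lambda>x. exp (V x - log_normalizer V))" by (intro continuous_intros V)
qed (simp add: exp_density_eq)

lemma exp_density_integral: "(\<integral>x. exp_density V x \<partial>unif) = 1"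
proof -
  have "(\<integral>x. exp_density V x \<partial>unif) = (\<integral>x. exp (V x) / (\<integral>y. exp (V y) \<partial>unif) \<partial>unif)"
    by (intro Bochner_Integration.integral_cong) (auto simp: exp_density_def LBINT_eq_unif)
  then show ?thesis using normalizer_pos by simp
qed

lemma exp_density_in_mspace: "exp_density V \<in> mspace C01"
proof -
  have "exp_density V \<in> extensional {0..1}" by (simp add: exp_density_def)
  moreover have "compactin (top_of_set {0..1}) {0..1::real}" by (simp add: compactin_subtopology)
  ultimately show ?thesis
    unfolding C01_def using exp_density_continuous by (subst compactin_mspace_cfunspace) auto
qed

end

text \<open>The logarithm of the normalising constant is 1-Lipschitz in supremum norm. The logarithm
  of the density therefore moves by at most \<open>2 * t\<close>, and it stays below
  \<open>2 * H\<close>, where the exponential has slope at most \<open>exp (2 * H)\<close>.\<close>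

lemma exp_density_lipschitz:
  assumes V: "continuous_on {0..1} V" "\<And>x. x \<in> {0..1} \<Longrightarrow> \<bar>V x\<bar> \<le> H"
    and W: "continuous_on {0..1} W" "\<And>x. x \<in> {0..1} \<Longrightarrow> \<bar>W x\<bar> \<le> H"
    and t: "\<And>x. x \<in> {0..1} \<Longrightarrow> \<bar>V x - W x\<bar> \<le> t" and x: "x \<in> {0..1}"
  shows "\<bar>exp_density V x - exp_density W x\<bar> \<le> exp (2 * H) * (2 * t)"
proof -
  have *: "log_normalizer V' \<le> t + log_normalizer W'"
    if V': "continuous_on {0..1} V'" "\<And>x. x \<in> {0..1} \<Longrightarrow> \<bar>V' x\<bar> \<le> H"
    and W': "continuous_on {0..1} W'" "\<And>x. x \<in> {0..1} \<Longrightarrow> \<bar>W' x\<bar> \<le> H"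
    and t: "\<And>x. x \<in> {0..1} \<Longrightarrow> \<bar>V' x - W' x\<bar> \<le> t" for V' W'
  proof -
    note pV = normalizer_pos[OF V'] and pW = normalizer_pos[OF W']
    have "(\<integral>x. exp (V' x) \<partial>unif) \<le> (\<integral>x. exp t * exp (W' x) \<partial>unif)"
    proof (rule integral_mono)
      fix x assume "x \<in> space unif"
      then have "V' x \<le> t + W' x" using t[of x] by simp
      then show "exp (V' x) \<le> exp t * exp (W' x)" by (simp add: exp_add[symmetric])
    qed (use exp_integrable[OF V'] exp_integrable[OF W'] in auto)
    then have "(\<integral>x. exp (V' x) \<partial>unif) \<le> exp t * (\<integral>x. exp (W' x) \<partial>unif)" by simp
    then have "ln (\<integral>x. exp (V' x) \<partial>unif) \<le> ln (exp t * (\<integral>x. exp (W' x) \<partial>unif))"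
      using pV pW by (intro ln_mono) auto
    then show ?thesis using pW by (simp add: log_normalizer_def ln_mult)
  qed
  have "\<bar>log_normalizer V - log_normalizer W\<bar> \<le> t"
    using *[OF V W t] *[OF W V] t by (fastforce simp: abs_minus_commute)
  then have "\<bar>(V x - log_normalizer V) - (W x - log_normalizer W)\<bar> \<le> 2 * t"
    using t[OF x] by linarith
  moreover have "V x - log_normalizer V \<le> 2 * H" "W x - log_normalizer W \<le> 2 * H"
    using log_normalizer_bound[OF V] log_normalizer_bound[OF W] V(2)[OF x] W(2)[OF x] by linarith+
  from abs_exp_diff_le[OF this] have "\<bar>exp_density V x - exp_density W x\<bar> \<le> exp (2 * H) * \<bar>(V x - log_normalizer V) - (W x - log_normalizer W)\<bar>"
    using exp_density_eq[OF V(1) V(2) x] exp_density_eq[OF W(1) W(2) x] by metis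
  ultimately show ?thesis
    by (meson exp_ge_zero mult_left_mono order_trans)
qed

section \<open>Borel sets of the space of continuous functions\<close>

lemma open_in_C01_ball:
  assumes "openin (mtopology_of C01) U" "f \<in> U"
  obtains r where "0 < r"
    "\<And>g. g \<in> mspace C01 \<Longrightarrow> (\<And>x. x \<in> {0..1} \<Longrightarrow> \<bar>g x - f x\<bar> < r) \<Longrightarrow> g \<in> U"
proof -
  interpret M: Metric_space "mspace C01" "mdist C01" by (rule Metric_space_mspace_mdist)
  have op: "openin M.mtopology U" using assms(1) by (simp add: mtopology_of_def)
  then have fM: "f \<in> mspace C01" using assms(2) openin_subset by fastforce
  obtain r where r: "0 < r" "M.mball f r \<subseteq> U"
    using op assms(2) unfolding M.openin_mtopology by blast
  show ?thesis
  \<comment> \<open>Pointwise bounds give only a non-strict bound on the supremum distance; halving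
    the radius restores strictness.\<close>
  proof (rule that[of "r / 2"])
    fix g assume g: "g \<in> mspace C01" "\<And>x. x \<in> {0..1} \<Longrightarrow> \<bar>g x - f x\<bar> < r / 2"
    have "mdist C01 f g \<le> r / 2"
      unfolding C01_def
    proof (rule mdist_cfunspace_le)
      show "0 \<le> r / 2" using r by simp
      fix x assume "x \<in> topspace (top_of_set {0..1::real})"
      then show "mdist euclidean_metric (f x) (g x) \<le> r / 2"
        using g(2)[of x] by (simp add: dist_real_def abs_minus_commute)
    qed
    then have "g \<in> M.mball f r" using fM g(1) r by (auto simp: M.mball_def)
    then show "g \<in> U" using r by auto
  qed (use r in simp)
qed

lemma open_C01_subset: "{A. openin (mtopology_of C01) A} \<subseteq> Pow (mspace C01)"
  using openin_subset topspace_mtopology_of by fastforce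

lemma space_borel_C01 [simp]: "space borel_C01 = mspace C01"
  using open_C01_subset by (simp add: borel_C01_def space_measure_of)

lemma openin_sets_borel_C01: "openin (mtopology_of C01) U \<Longrightarrow> U \<in> sets borel_C01"
  unfolding borel_C01_def using open_C01_subset by auto

text \<open>Evaluation at a point is 1-Lipschitz, so its strict sublevel sets are open. This makes
  the likelihood a measurable function of the density.\<close>

lemma evaluation_measurable:
  assumes x: "x \<in> {0..1}"
  shows "(\<lambda>p. p x) \<in> borel_measurable borel_C01"
proof (rule borel_measurableI_less)
  fix y :: real
  interpret M: Metric_space "mspace C01" "mdist C01" by (rule Metric_space_mspace_mdist)
  have "openin M.mtopology {p \<in> mspace C01. p x < y}"
    unfolding M.openin_mtopology
  proof (intro conjI allI impI)
    fix p assume p: "p \<in> {p \<in> mspace C01. p x < y}"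
    show "\<exists>r>0. M.mball p r \<subseteq> {p \<in> mspace C01. p x < y}"
    proof (intro exI[of _ "y - p x"] conjI subsetI)
      fix g assume "g \<in> M.mball p (y - p x)"
      then have g: "g \<in> mspace C01" "mdist C01 p g < y - p x" by (auto simp: M.mball_def)
      have "mdist euclidean_metric (p x) (g x) < y - p x"
        using p g x unfolding C01_def
        by (intro cfunspace_mdist_lt[where X = "top_of_set {0..1}" and f = p and g = g]) (auto simp: compactin_subtopology)
      then show "g \<in> {p \<in> mspace C01. p x < y}" using g by (simp add: dist_real_def)
    qed (use p in simp)
  qed auto
  then show "{p \<in> space borel_C01. p x < y} \<in> sets borel_C01"
    by (auto simp: mtopology_of_def intro!: openin_sets_borel_C01)
qed

section \<open>The law of the coefficients and the density it induces\<close>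

definition coeff_factor :: "real \<Rightarrow> real measure" where
  "coeff_factor B = restrict_space (uniform_measure lborel {-B<..<B}) {-B<..<B}"

lemma space_coeff_factor [simp]: "space (coeff_factor B) = {-B<..<B}"
  by (simp add: coeff_factor_def space_restrict_space)

lemma emeasure_coeff_factor:
  assumes "0 < B" "S \<in> sets borel" "S \<subseteq> {-B<..<B}"
  shows "emeasure (coeff_factor B) S = emeasure lborel S / ennreal (2 * B)"
proof -
  have "{-B<..<B} \<inter> S = S" using assms by auto
  then show ?thesis
    using assms by (simp add: coeff_factor_def emeasure_restrict_space emeasure_uniform_measure)
qed

lemma prob_space_coeff_factor: "0 < B \<Longrightarrow> prob_space (coeff_factor B)"
  by (rule prob_spaceI, subst emeasure_coeff_factor) (auto simp: divide_ennreal)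

lemma sets_coeff_factor: "S \<in> sets borel \<Longrightarrow> S \<subseteq> {-B<..<B} \<Longrightarrow> S \<in> sets (coeff_factor B)"
  by (auto simp: coeff_factor_def sets_restrict_space image_iff intro!: bexI[of _ S])

text \<open>The target may sit at an end point of [-B, B], where only one side of the window lies
  inside. That side has length \<open>B * e\<close> out of \<open>2 * B\<close>, hence the bound
  \<open>e / 2\<close>.\<close>

lemma coeff_factor_interval:
  assumes B: "0 < B" and v: "\<bar>v\<bar> \<le> B" and e: "0 < e" "e \<le> 1"
  shows "e / 2 \<le> measure (coeff_factor B) {x \<in> {-B<..<B}. \<bar>x - v\<bar> \<le> B * e}"
proof -
  interpret F: prob_space "coeff_factor B" by (rule prob_space_coeff_factor[OF B])
  define d where "d = B * e"
  \<comment> \<open>The half window is taken on the side towards 0, which keeps it within (-B, B)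
    because its length is at most \<open>B\<close>.\<close>
  define a where "a = (if 0 \<le> v then v - d else v)"
  have d: "0 < d" "d \<le> B" using B e by (auto simp: d_def mult_le_cancel_left1)
  have sub: "{a<..<a + d} \<subseteq> {x \<in> {-B<..<B}. \<bar>x - v\<bar> \<le> d}"
    using v d by (auto simp: a_def split: if_splits)
  have "emeasure (coeff_factor B) {a<..<a + d} = ennreal d / ennreal (2 * B)"
    using sub d B by (subst emeasure_coeff_factor) auto
  also have "\<dots> = ennreal (e / 2)" using B e by (simp add: d_def divide_ennreal)
  finally have "measure (coeff_factor B) {a<..<a + d} = e / 2"
    using e by (simp add: measure_def)
  moreover have "measure (coeff_factor B) {a<..<a + d} \<le> measure (coeff_factor B) {x \<in> {-B<..<B}. \<bar>x - v\<bar> \<le> d}"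
    using sub by (intro F.finite_measure_mono sets_coeff_factor) auto
  ultimately show ?thesis by (simp add: d_def)
qed

locale wavelet_prior_space = wavelet_series_space +
  fixes B :: real
  assumes B: "0 < B"
begin

definition \<mu> :: "(nat + nat \<times> nat \<Rightarrow> real) measure" where
  "\<mu> = coeff_law B J0"

lemma \<mu>_eq: "\<mu> = PiM I (\<lambda>_. coeff_factor B)"
  by (simp add: \<mu>_def coeff_law_def I_def coeff_factor_def)

lemma space_\<mu>: "space \<mu> = PiE I (\<lambda>_. {-B<..<B})"
  by (simp add: \<mu>_eq space_PiM)

lemma coeff_bound: "u \<in> space \<mu> \<Longrightarrow> i \<in> I \<Longrightarrow> \<bar>u i\<bar> \<le> B"
proof -
  assume "u \<in> space \<mu>" "i \<in> I"
  then have "u i \<in> {-B<..<B}" by (auto simp: space_\<mu> PiE_iff)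
  then show ?thesis by auto
qed

sublocale Mu: prob_space \<mu>
  unfolding \<mu>_eq by (intro prob_space_PiM prob_space_coeff_factor B)

lemma coeff_measurable [measurable]: "(\<lambda>u. u i) \<in> borel_measurable \<mu>"
proof (cases "i \<in> I")
  case True
  have "(\<lambda>x. x) \<in> borel_measurable (coeff_factor B)"
    unfolding coeff_factor_def by (intro measurable_restrict_space1) simp
  then show ?thesis
    unfolding \<mu>_eq
    by (rule measurable_compose[OF measurable_component_singleton[OF True, of "\<lambda>_. coeff_factor B"]])
next
  case False
  then have "u i = undefined" if "u \<in> space \<mu>" for u
    using that by (auto simp: space_\<mu> PiE_def extensional_def)
  then show ?thesis by (subst measurable_cong[where g = "\<lambda>_. undefined"]) auto
qed

definition neighbourhood :: "nat \<Rightarrow> (nat + nat \<times> nat \<Rightarrow> real) \<Rightarrow> real \<Rightarrow> (nat + nat \<times> nat \<Rightarrow> real) set" where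
  "neighbourhood L v e = {u \<in> space \<mu>. \<forall>i\<in>head_index L. \<bar>u i - v i\<bar> \<le> B * e}"

lemma neighbourhood_measurable: "neighbourhood L v e \<in> sets \<mu>"
  unfolding neighbourhood_def using finite_head_index by measurable

lemma neighbourhood_mass:
  assumes L: "J0 \<le> L" and v: "\<And>i. i \<in> I \<Longrightarrow> \<bar>v i\<bar> \<le> B" and e: "0 < e" "e \<le> 1"
  shows "(e / 2) ^ 2 ^ L \<le> measure \<mu> (neighbourhood L v e)"
proof -
  interpret F: prob_space "coeff_factor B" by (rule prob_space_coeff_factor[OF B])
  interpret P: product_prob_space "\<lambda>_. coeff_factor B" I by unfold_locales
  let ?X = "\<lambda>i. {x \<in> {-B<..<B}. \<bar>x - v i\<bar> \<le> B * e}"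
  have X: "?X i \<in> sets (coeff_factor B)" for i by (intro sets_coeff_factor) auto
  have "neighbourhood L v e = P.emb I (head_index L) (Pi\<^sub>E (head_index L) ?X)"
    using head_index_subset[of L]
    by (auto simp: neighbourhood_def space_\<mu> prod_emb_def PiE_def Pi_def extensional_def restrict_def subset_iff)
  then have "measure \<mu> (neighbourhood L v e) = (\<Prod>i\<in>head_index L. measure (coeff_factor B) (?X i))"
    unfolding \<mu>_eq using head_index_subset finite_head_index X
    by (simp add: P.measure_PiM_emb)
  also have "\<dots> \<ge> (\<Prod>i\<in>head_index L. e / 2)"
    using e head_index_subset[of L] by (intro prod_mono conjI coeff_factor_interval B v) auto
  finally show ?thesis using card_head_index[OF L] by simp
qed

lemma series_measurable: "(\<lambda>(u, x). series u x) \<in> borel_measurable (\<mu> \<Otimes>\<^sub>M unif)"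
proof -
  have 1: "(\<lambda>z. \<Phi> k (snd z)) \<in> borel_measurable (\<mu> \<Otimes>\<^sub>M unif)" if "k < 2 ^ J0" for k
    using measurable_compose[OF measurable_snd continuous_on_measurable_unif[OF cont_scal[OF that]]] .
  have 2: "(\<lambda>z. \<Psi> l k (snd z)) \<in> borel_measurable (\<mu> \<Otimes>\<^sub>M unif)" if "J0 \<le> l" "k < 2 ^ l" for l k
    using measurable_compose[OF measurable_snd continuous_on_measurable_unif[OF cont_wav[OF that]]] .
  have 3: "(\<lambda>z. fst z i) \<in> borel_measurable (\<mu> \<Otimes>\<^sub>M unif)" for i
    using measurable_compose[OF measurable_fst coeff_measurable] .
  have "(\<lambda>z. series (fst z) (snd z)) \<in> borel_measurable (\<mu> \<Otimes>\<^sub>M unif)"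
    unfolding series_eq lev_def
    by (intro borel_measurable_add borel_measurable_sum borel_measurable_times borel_measurable_suminf
        borel_measurable_const 1 2 3) auto
  then show ?thesis by (simp add: case_prod_beta')
qed

definition pd :: "(nat + nat \<times> nat \<Rightarrow> real) \<Rightarrow> real \<Rightarrow> real" where
  "pd u = exp_density (series u)"

lemma pd_measurable: "(\<lambda>(u, x). pd u x) \<in> borel_measurable (\<mu> \<Otimes>\<^sub>M unif)"
proof -
  note [measurable] = series_measurable
  have "(\<lambda>(u, x). exp (series u x) / (\<integral>y. exp (series u y) \<partial>unif)) \<in> borel_measurable (\<mu> \<Otimes>\<^sub>M unif)"
    by measurable
  then show ?thesis
    by (rule measurable_cong[THEN iffD1, rotated])
      (auto simp: pd_def exp_density_def LBINT_eq_unif space_pair_measure)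
qed

definition H :: real where "H = 2 * C0 * B"

lemma series_facts:
  assumes "u \<in> space \<mu>"
  shows "continuous_on {0..1} (series u)" "\<And>x. x \<in> {0..1} \<Longrightarrow> \<bar>series u x\<bar> \<le> H"
  unfolding H_def using coeff_bound[OF assms] by (auto intro!: series_continuous series_bound_uniform simp del: atLeastAtMost_iff)

text \<open>This one estimate gives the measurability of the prior, the radius of the neighbourhood
  of \<open>p0\<close> and the diameter of the cells.\<close>

lemma pd_lipschitz:
  assumes u: "\<And>i. i \<in> I \<Longrightarrow> \<bar>u i\<bar> \<le> B" and u': "\<And>i. i \<in> I \<Longrightarrow> \<bar>u' i\<bar> \<le> B"
    and d: "\<And>i. i \<in> head_index L \<Longrightarrow> \<bar>u i - u' i\<bar> \<le> \<delta>" and L: "J0 \<le> L" and x: "x \<in> {0..1}"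
  shows "\<bar>pd u x - pd u' x\<bar> \<le> exp (2 * H) * (2 * (C0 * (\<delta> + 2 * B * q ^ L)))"
  unfolding pd_def
proof (rule exp_density_lipschitz[OF _ _ _ _ _ x])
  show "continuous_on {0..1} (series u)" "continuous_on {0..1} (series u')"
    using u u' by (auto intro: series_continuous)
  show "\<bar>series u y\<bar> \<le> H" "\<bar>series u' y\<bar> \<le> H" if "y \<in> {0..1}" for y
    unfolding H_def using u u' that by (auto intro!: series_bound_uniform simp del: atLeastAtMost_iff)
  show "\<bar>series u y - series u' y\<bar> \<le> C0 * (\<delta> + 2 * B * q ^ L)" if y: "y \<in> {0..1}" for y
  proof -
    have "\<bar>series (\<lambda>i. u i - u' i) y\<bar> \<le> C0 * (\<delta> + 2 * B * q ^ L)"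
    proof (rule series_bound[OF y _ d L])
      fix i assume "i \<in> I"
      then show "\<bar>u i - u' i\<bar> \<le> 2 * B" using u[of i] u'[of i] by linarith
    qed
    then show ?thesis using series_diff[OF y u u'] by simp
  qed
qed

text \<open>
  The map from coefficients to densities is continuous for the product topology, because small
  perturbations of finitely many coefficients and arbitrary changes of the remaining ones move the
  density little.
\<close>

lemma pd_measurable_C01: "pd \<in> measurable \<mu> borel_C01"
  unfolding borel_C01_def
proof (rule measurable_measure_of)
  show "{A. openin (mtopology_of C01) A} \<subseteq> Pow (mspace C01)" by (rule open_C01_subset)
  have pdC: "pd u \<in> mspace C01" if "u \<in> space \<mu>" for u
    unfolding pd_def using series_facts[OF that] by (rule exp_density_in_mspace)
  then show "pd \<in> space \<mu> \<rightarrow> mspace C01" by auto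
  fix U assume "U \<in> {A. openin (mtopology_of C01) A}"
  then have U: "openin (mtopology_of C01) U" by simp
  let ?K = "exp (2 * H) * 2 * C0"
  have K: "0 < ?K" using C0_ge(3) by simp
  have "\<exists>T. open T \<and> u \<in> T \<and> T \<inter> space \<mu> \<subseteq> pd -` U" if u: "u \<in> space \<mu>" "pd u \<in> U" for u
  proof -
    obtain r where r: "0 < r" "\<And>g. g \<in> mspace C01 \<Longrightarrow> (\<And>x. x \<in> {0..1} \<Longrightarrow> \<bar>g x - pd u x\<bar> < r) \<Longrightarrow> g \<in> U"
      using open_in_C01_ball[OF U u(2)] by blast
    have lim: "(\<lambda>L. ?K * (2 * B * q ^ L)) \<longlonglongrightarrow> ?K * (2 * B * 0)"
      using q by (intro tendsto_intros LIMSEQ_power_zero) auto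
    have "\<forall>\<^sub>F L in sequentially. ?K * (2 * B * q ^ L) < r / 2"
      by (rule order_tendstoD(2)[OF lim]) (use r(1) in simp)
    then obtain L where L: "J0 \<le> L" "?K * (2 * B * q ^ L) < r / 2"
      by (auto simp: eventually_sequentially) (meson nat_le_linear)
    define \<delta> where "\<delta> = r / (2 * ?K)"
    have \<delta>: "0 < \<delta>" "?K * \<delta> = r / 2" using r K by (auto simp: \<delta>_def)
    define T where "T = {u'. \<forall>i\<in>head_index L. \<bar>u' i - u i\<bar> < \<delta>}"
    have "T = (\<Inter>i\<in>head_index L. {u'. \<bar>u' i - u i\<bar> < \<delta>})" by (auto simp: T_def)
    moreover have "open {u'. \<bar>u' i - u i\<bar> < \<delta>}" for i
      by (intro open_Collect_less continuous_intros continuous_on_product_coordinates)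
    ultimately have "open T" using finite_head_index by auto
    moreover have "u \<in> T" using \<delta> by (simp add: T_def)
    moreover have "pd u' \<in> U" if u': "u' \<in> T" "u' \<in> space \<mu>" for u'
    proof (rule r(2)[OF pdC[OF u'(2)]])
      fix x :: real assume x: "x \<in> {0..1}"
      have "\<bar>pd u' x - pd u x\<bar> \<le> exp (2 * H) * (2 * (C0 * (\<delta> + 2 * B * q ^ L)))"
        using u' by (intro pd_lipschitz coeff_bound u L x) (auto simp: T_def less_imp_le)
      also have "\<dots> = ?K * \<delta> + ?K * (2 * B * q ^ L)" by (simp add: algebra_simps)
      also have "\<dots> < r" using \<delta> L by simp
      finally show "\<bar>pd u' x - pd u x\<bar> < r" .
    qed
    ultimately show ?thesis by blast
  qed
  then obtain T where T: "\<And>u. u \<in> space \<mu> \<Longrightarrow> pd u \<in> U \<Longrightarrow> open (T u) \<and> u \<in> T u \<and> T u \<inter> space \<mu> \<subseteq> pd -` U"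
    by metis
  define W where "W = (\<Union>u\<in>{u \<in> space \<mu>. pd u \<in> U}. T u)"
  have "open W" unfolding W_def using T by (intro open_UN) auto
  \<comment> \<open>\<open>W\<close> may be an uncountable union. It is measurable because the index
    type is countable, so the Borel sets of the product topology are those of the product
    sigma-algebra.\<close>
  then have "W \<in> sets (PiM UNIV (\<lambda>_. borel))" unfolding sets_PiM_equal_borel by simp
  moreover have "(\<lambda>u. u) \<in> measurable \<mu> (PiM UNIV (\<lambda>_. borel))"
    by (rule measurable_PiM_single') auto
  ultimately have "(\<lambda>u. u) -` W \<inter> space \<mu> \<in> sets \<mu>" by (rule measurable_sets[rotated])
  moreover have "(\<lambda>u. u) -` W \<inter> space \<mu> = pd -` U \<inter> space \<mu>"
    using T unfolding W_def by blast
  ultimately show "pd -` U \<inter> space \<mu> \<in> sets \<mu>" by simp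
qed

lemma wavelet_prior_eq: "wavelet_prior J0 \<Phi> \<Psi> B \<alpha> = distr \<mu> borel_C01 pd"
  by (simp add: wavelet_prior_def \<mu>_def pd_def[abs_def])

end

section \<open>Posterior contraction\<close>

text \<open>The coefficients \<open>v\<close> of log p0 may attain the values B and -B, whereas the
  sample space of the prior is built from the open interval. \<open>v\<close> is therefore not
  assumed to be a sample point.\<close>

locale wavelet_posterior = wavelet_prior_space +
  fixes v :: "nat + nat \<times> nat \<Rightarrow> real" and p0 :: "real \<Rightarrow> real"
  assumes v: "i \<in> I \<Longrightarrow> \<bar>v i\<bar> \<le> B"
    and p0_eq: "x \<in> {0..1} \<Longrightarrow> p0 x = exp (series v x)"
    and p0_integral_one: "(\<integral>x. p0 x \<partial>unif) = 1"
begin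

lemma series_v: "continuous_on {0..1} (series v)" "\<And>x. x \<in> {0..1} \<Longrightarrow> \<bar>series v x\<bar> \<le> H"
  unfolding H_def using v by (auto intro!: series_continuous series_bound_uniform simp del: atLeastAtMost_iff)

lemma p0_pd: "x \<in> {0..1} \<Longrightarrow> p0 x = pd v x"
proof -
  assume x: "x \<in> {0..1}"
  have "(\<integral>x. exp (series v x) \<partial>unif) = (\<integral>x. p0 x \<partial>unif)"
    by (intro Bochner_Integration.integral_cong) (auto simp: p0_eq)
  then have "log_normalizer (series v) = 0" by (simp add: log_normalizer_def p0_integral_one)
  then have "exp_density (series v) x = exp (series v x - 0)"
    using exp_density_eq[OF series_v(1) series_v(2) x] by simp
  then show ?thesis using p0_eq[OF x] by (simp add: pd_def)
qed

lemma p0_continuous: "continuous_on {0..1} p0"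
  using continuous_on_exp[OF series_v(1)] by (rule continuous_on_eq) (simp add: p0_eq)

definition b :: real where "b = exp (2 * H)"

lemma H_nonneg: "0 \<le> H"
  using C0_ge(3) B by (simp add: H_def)

lemma b_ge_1: "1 \<le> b" and inverse_b: "exp (- (2 * H)) = 1 / b"
  using H_nonneg by (auto simp: b_def exp_minus inverse_eq_divide)

sublocale density_model unif \<mu> pd p0 b
proof
  show "(\<lambda>(u, x). pd u x) \<in> borel_measurable (\<mu> \<Otimes>\<^sub>M unif)" by (rule pd_measurable)
  show "p0 \<in> borel_measurable unif"
    by (rule continuous_on_measurable_unif[OF p0_continuous])
  show "1 \<le> b" by (rule b_ge_1)
  show "1 / b \<le> pd u x \<and> pd u x \<le> b" if "u \<in> space \<mu>" "x \<in> space unif" for u x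
    using exp_density_bounds[OF series_facts(1)[OF that(1)] series_facts(2)[OF that(1)], of x] that(2)
    by (simp add: pd_def inverse_b b_def[symmetric])
  show "1 / b \<le> p0 x \<and> p0 x \<le> b" if "x \<in> space unif" for x
    using exp_density_bounds[OF series_v(1) series_v(2), of x] that p0_pd[of x]
    by (simp add: pd_def inverse_b b_def[symmetric])
  show "(\<integral>x. pd u x \<partial>unif) = 1" if "u \<in> space \<mu>" for u
    unfolding pd_def using series_facts[OF that] by (rule exp_density_integral)
qed (rule p0_integral_one)

lemma sample_eq: "sample = iid_law (law_of_density p0)"
  by (simp add: sample_def iid_law_def P0_def law_of_density_def)

text \<open>Here 6 = 2 * (1 + 2): the normalisation doubles, the head moves by
  \<open>B * q ^ L\<close>, and free tail coefficients differ by at most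
  \<open>2 * B\<close>.\<close>

definition G :: real where "G = 6 * b * C0 * B"

lemma G: "0 < G"
  using C0_ge(3) B b_ge_1 by (simp add: G_def)

lemma pd_close:
  assumes u: "\<And>i. i \<in> I \<Longrightarrow> \<bar>u i\<bar> \<le> B" and u': "\<And>i. i \<in> I \<Longrightarrow> \<bar>u' i\<bar> \<le> B" and L: "J0 \<le> L"
    and d: "\<And>i. i \<in> head_index L \<Longrightarrow> \<bar>u i - u' i\<bar> \<le> B * q ^ L" and x: "x \<in> {0..1}"
  shows "\<bar>pd u x - pd u' x\<bar> \<le> G * q ^ L"
proof -
  have "\<bar>pd u x - pd u' x\<bar> \<le> exp (2 * H) * (2 * (C0 * (B * q ^ L + 2 * B * q ^ L)))"
    by (rule pd_lipschitz[OF u u' d L x])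
  then show ?thesis by (simp add: G_def b_def algebra_simps)
qed

lemma integral_square_le:
  fixes f :: "real \<Rightarrow> real"
  assumes "\<And>x. x \<in> {0..1} \<Longrightarrow> \<bar>f x\<bar> \<le> t"
  shows "(\<integral>x. (f x)\<^sup>2 \<partial>unif) \<le> t\<^sup>2"
proof -
  have "(\<integral>x. (f x)\<^sup>2 \<partial>unif) \<le> (\<integral>x. t\<^sup>2 \<partial>unif)"
  proof (rule integral_mono_AE')
    have "(f x)\<^sup>2 \<le> t\<^sup>2" if "x \<in> {0..1}" for x
      using power_mono[OF assms[OF that], of 2] by simp
    then show "AE x in unif. (f x)\<^sup>2 \<le> t\<^sup>2" by (intro AE_I2) simp
  qed auto
  then show ?thesis by simp
qed

section \<open>The grid of cells on the coefficients below the resolution level\<close>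

definition cells :: "nat \<Rightarrow> nat" where "cells L = nat \<lceil>1 / q ^ L\<rceil>"

definition cell :: "nat \<Rightarrow> (nat + nat \<times> nat \<Rightarrow> real) \<Rightarrow> nat + nat \<times> nat \<Rightarrow> nat" where
  "cell L u = (\<lambda>i\<in>head_index L. nat \<lfloor>(u i + B) * real (cells L) / (2 * B)\<rfloor>)"

text \<open>Coefficients beyond the head are set to 0, an interior point, so that a centre is itself
  a parameter of the model; the change in the tail costs O(\<open>q ^ L\<close>).\<close>

definition cell_center :: "nat \<Rightarrow> (nat + nat \<times> nat \<Rightarrow> nat) \<Rightarrow> nat + nat \<times> nat \<Rightarrow> real" where
  "cell_center L k = (\<lambda>i\<in>I. if i \<in> head_index L then 2 * B * (real (k i) + 1/2) / real (cells L) - B else 0)"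

definition cell_set :: "nat \<Rightarrow> (nat + nat \<times> nat \<Rightarrow> nat) set" where
  "cell_set L = PiE (head_index L) (\<lambda>_. {..<cells L})"

lemma cells_bounds: "1 / q ^ L \<le> real (cells L)" "real (cells L) \<le> 2 / q ^ L" "0 < cells L"
proof -
  have "0 < q ^ L" "q ^ L \<le> 1" using q by (auto intro: power_le_one)
  then have "1 \<le> 1 / q ^ L" by simp
  then show 1: "1 / q ^ L \<le> real (cells L)" unfolding cells_def by linarith
  have "real (cells L) \<le> 1 / q ^ L + 1" using \<open>1 \<le> 1 / q ^ L\<close> unfolding cells_def by linarith
  also have "\<dots> \<le> 2 / q ^ L" using \<open>1 \<le> 1 / q ^ L\<close> by simp
  finally show "real (cells L) \<le> 2 / q ^ L" .
  show "0 < cells L" using 1 \<open>1 \<le> 1 / q ^ L\<close> by linarith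
qed

lemma cell_index:
  assumes t: "t \<in> {-B<..<B}" and m: "0 < m"
  shows "nat \<lfloor>(t + B) * real m / (2 * B)\<rfloor> < m"
    "\<bar>t - (2 * B * (real (nat \<lfloor>(t + B) * real m / (2 * B)\<rfloor>) + 1/2) / real m - B)\<bar> \<le> B / real m"
proof -
  define y where "y = (t + B) * real m / (2 * B)"
  have "(t + B) * real m < 2 * B * real m" using t m by (intro mult_strict_right_mono) auto
  then have y: "0 \<le> y" "y < real m" using t m B by (auto simp: y_def divide_less_eq mult_ac)
  have fl: "real (nat \<lfloor>y\<rfloor>) \<le> y" "y < real (nat \<lfloor>y\<rfloor>) + 1" using y by linarith+
  then have "real (nat \<lfloor>y\<rfloor>) < real m" using y by linarith
  then show "nat \<lfloor>(t + B) * real m / (2 * B)\<rfloor> < m" by (simp add: y_def)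
  have "t - (2 * B * (real (nat \<lfloor>y\<rfloor>) + 1/2) / real m - B) = 2 * B / real m * (y - (real (nat \<lfloor>y\<rfloor>) + 1/2))"
    using B m by (simp add: y_def field_simps)
  also have "\<bar>\<dots>\<bar> = 2 * B / real m * \<bar>y - (real (nat \<lfloor>y\<rfloor>) + 1/2)\<bar>"
    using B m by (simp add: abs_mult)
  also have "\<dots> \<le> 2 * B / real m * (1/2)"
  proof (rule mult_left_mono)
    show "\<bar>y - (real (nat \<lfloor>y\<rfloor>) + 1/2)\<bar> \<le> 1/2" using fl by linarith
  qed (use B in simp)
  finally show "\<bar>t - (2 * B * (real (nat \<lfloor>(t + B) * real m / (2 * B)\<rfloor>) + 1/2) / real m - B)\<bar> \<le> B / real m"
    by (simp add: y_def)
qed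

lemma cell_in_cell_set: "u \<in> space \<mu> \<Longrightarrow> cell L u \<in> cell_set L"
  using cell_index(1)[OF _ cells_bounds(3)[of L]] head_index_subset[of L]
  unfolding cell_def cell_set_def space_\<mu> by (auto simp: PiE_iff)

lemma cell_center_in_space: "k \<in> cell_set L \<Longrightarrow> cell_center L k \<in> space \<mu>"
proof -
  assume k: "k \<in> cell_set L"
  have "2 * B * (real (k i) + 1/2) / real (cells L) - B \<in> {-B<..<B}" if "i \<in> head_index L" for i
  proof -
    have "k i < cells L" using k that by (auto simp: cell_set_def PiE_iff)
    then have "real (k i) + 1 \<le> real (cells L)" by linarith
    define z where "z = (real (k i) + 1/2) / real (cells L)"
    have "0 < z" "z < 1"
      using \<open>real (k i) + 1 \<le> real (cells L)\<close> cells_bounds(3)[of L] by (auto simp: z_def field_simps)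
    then have "0 < 2 * B * z" "2 * B * z < 2 * B" using B by auto
    moreover have "2 * B * (real (k i) + 1/2) / real (cells L) = 2 * B * z" by (simp add: z_def)
    ultimately show ?thesis unfolding greaterThanLessThan_iff by linarith
  qed
  then show ?thesis using B unfolding space_\<mu> cell_center_def by auto
qed

lemma cell_center_close:
  assumes u: "u \<in> space \<mu>" and i: "i \<in> head_index L"
  shows "\<bar>u i - cell_center L (cell L u) i\<bar> \<le> B * q ^ L"
proof -
  have iI: "i \<in> I" using i head_index_subset by auto
  have "u i \<in> {-B<..<B}" using u iI by (auto simp: space_\<mu> PiE_iff)
  from cell_index(2)[OF this cells_bounds(3)[of L]]
  have "\<bar>u i - cell_center L (cell L u) i\<bar> \<le> B / real (cells L)"
    using i iI by (simp add: cell_center_def cell_def)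
  also have "\<dots> = B * (1 / real (cells L))" by simp
  also have "\<dots> \<le> B * q ^ L"
    using cells_bounds[of L] q B by (intro mult_left_mono) (auto simp: field_simps)
  finally show ?thesis .
qed

lemma finite_cell_set: "finite (cell_set L)"
  unfolding cell_set_def by (intro finite_PiE finite_head_index) auto

lemma card_cell_set: "J0 \<le> L \<Longrightarrow> card (cell_set L) = cells L ^ 2 ^ L"
  by (simp add: cell_set_def card_PiE finite_head_index card_head_index)

lemma cell_center_measurable:
  "(\<lambda>u. cell_center L (cell L u)) \<in> measurable \<mu> (count_space (cell_center L ` cell_set L))"
proof -
  have "cell L \<in> measurable \<mu> (count_space (cell_set L))"
    unfolding measurable_count_space_eq2[OF finite_cell_set]
  proof (intro conjI ballI)
    show "cell L \<in> space \<mu> \<rightarrow> cell_set L" using cell_in_cell_set by auto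
    fix k assume k: "k \<in> cell_set L"
    have "cell L -` {k} \<inter> space \<mu> = {u \<in> space \<mu>. \<forall>i\<in>head_index L. nat \<lfloor>(u i + B) * real (cells L) / (2 * B)\<rfloor> = k i}"
      using k by (auto simp: cell_def cell_set_def PiE_iff extensional_def fun_eq_iff)
    also have "\<dots> \<in> sets \<mu>" using finite_head_index by measurable
    finally show "cell L -` {k} \<inter> space \<mu> \<in> sets \<mu>" .
  qed
  then show ?thesis
    by (rule measurable_compose) auto
qed

end

context wavelet_posterior
begin

section \<open>Posterior mass outside an L2 ball\<close>

lemma likelihood_integrable:
  assumes x: "x \<in> space sample" and S: "S \<in> sets \<mu>"
  shows "integrable \<mu> (\<lambda>u. indicator S u * (\<Prod>i<n. pd u (x i)))" "integrable \<mu> (\<lambda>u. \<Prod>i<n. pd u (x i))"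
    "0 < (\<integral>u. (\<Prod>i<n. pd u (x i)) \<partial>\<mu>)"
proof -
  have xs: "x i \<in> space unif" for i using space_sample[OF x] .
  have px [measurable]: "(\<lambda>u. pd u (x i)) \<in> borel_measurable \<mu>" for i
    using measurable_compose[OF measurable_Pair2'[OF xs] p_measurable] by simp
  have bnd: "(1 / b) ^ n \<le> (\<Prod>i<n. pd u (x i))" "(\<Prod>i<n. pd u (x i)) \<le> b ^ n" if u: "u \<in> space \<mu>" for u
  proof -
    have "(\<Prod>i<n. 1 / b) \<le> (\<Prod>i<n. pd u (x i))" "(\<Prod>i<n. pd u (x i)) \<le> (\<Prod>i<n. b)"
      using p_bounds[OF u xs] pos(1) pos(2)[OF u xs] by (intro prod_mono; simp add: less_imp_le)+
    then show "(1 / b) ^ n \<le> (\<Prod>i<n. pd u (x i))" "(\<Prod>i<n. pd u (x i)) \<le> b ^ n" by simp_all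
  qed
  have b0: "0 < (1 / b) ^ n" using pos(1) by simp
  have abs: "\<bar>\<Prod>i<n. pd u (x i)\<bar> \<le> b ^ n" if "u \<in> space \<mu>" for u
    using bnd[OF that] b0 by linarith
  show int: "integrable \<mu> (\<lambda>u. \<Prod>i<n. pd u (x i))"
    using abs by (intro Mu.bounded_integrable[of _ "b ^ n"]) auto
  show "integrable \<mu> (\<lambda>u. indicator S u * (\<Prod>i<n. pd u (x i)))"
    using integrable_real_mult_indicator[OF S int] by (simp add: mult.commute)
  have "(1 / b) ^ n = (\<integral>u. (1 / b) ^ n \<partial>\<mu>)" by (simp add: Mu.prob_space)
  also have "\<dots> \<le> (\<integral>u. (\<Prod>i<n. pd u (x i)) \<partial>\<mu>)"
    using bnd int by (intro integral_mono) auto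
  finally show "0 < (\<integral>u. (\<Prod>i<n. pd u (x i)) \<partial>\<mu>)" using b0 by linarith
qed

text \<open>
  The set \<open>U\<close> need not be measurable: if the numerator of the posterior is not integrable, it is \<open>0\<close>
  by the convention for the Bochner integral.
\<close>

lemma posterior_le:
  assumes x: "x \<in> space sample" and S: "S \<in> sets \<mu>"
    and A: "\<And>u. u \<in> space \<mu> \<Longrightarrow> pd u \<in> U \<Longrightarrow> u \<in> S"
    and le: "(\<integral>u. indicator S u * (\<Prod>i<n. pd u (x i)) \<partial>\<mu>) \<le> \<epsilon> * (\<integral>u. (\<Prod>i<n. pd u (x i)) \<partial>\<mu>)"
  shows "\<bar>posterior (wavelet_prior J0 \<Phi> \<Psi> B \<alpha>) n x U\<bar> \<le> \<epsilon>"
proof -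
  let ?Q = "distr \<mu> borel_C01 pd"
  have xs: "x i \<in> {0..1}" for i using space_sample[OF x, of i] by simp
  have m: "(\<lambda>p. \<Prod>i<n. p (x i)) \<in> borel_measurable borel_C01"
    using evaluation_measurable[OF xs] by (intro borel_measurable_prod) auto
  have lpos: "0 \<le> (\<Prod>i<n. pd u (x i))" if "u \<in> space \<mu>" for u
    using pos(2)[OF that] xs by (intro prod_nonneg) (auto simp: less_imp_le)
  have denom: "(LINT p|?Q. (\<Prod>i<n. p (x i))) = (\<integral>u. (\<Prod>i<n. pd u (x i)) \<partial>\<mu>)"
    by (rule integral_distr[OF pd_measurable_C01 m])
  define N where "N = (LINT p:U|?Q. (\<Prod>i<n. p (x i)))"
  have N: "0 \<le> N \<and> N \<le> (\<integral>u. indicator S u * (\<Prod>i<n. pd u (x i)) \<partial>\<mu>)"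
  proof (cases "integrable ?Q (\<lambda>p. indicator U p *\<^sub>R (\<Prod>i<n. p (x i)))")
    case True
    have "N = (\<integral>u. indicator U (pd u) *\<^sub>R (\<Prod>i<n. pd u (x i)) \<partial>\<mu>)"
      unfolding N_def set_lebesgue_integral_def
      using borel_measurable_integrable[OF True] by (intro integral_distr[OF pd_measurable_C01]) simp
    moreover have "0 \<le> (\<integral>u. indicator U (pd u) *\<^sub>R (\<Prod>i<n. pd u (x i)) \<partial>\<mu>)"
      using lpos by (intro Bochner_Integration.integral_nonneg_AE AE_I2) (auto simp: indicator_def)
    moreover have "(\<integral>u. indicator U (pd u) *\<^sub>R (\<Prod>i<n. pd u (x i)) \<partial>\<mu>) \<le> (\<integral>u. indicator S u * (\<Prod>i<n. pd u (x i)) \<partial>\<mu>)"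
    proof (rule integral_mono_AE'[OF likelihood_integrable(1)[OF x S]])
      show "AE u in \<mu>. indicator U (pd u) *\<^sub>R (\<Prod>i<n. pd u (x i)) \<le> indicator S u * (\<Prod>i<n. pd u (x i))"
        using A lpos by (intro AE_I2) (auto simp: indicator_def)
      show "AE u in \<mu>. 0 \<le> indicator S u * (\<Prod>i<n. pd u (x i))"
        using lpos by (intro AE_I2) (auto simp: indicator_def)
    qed
    ultimately show ?thesis by simp
  next
    case False
    then have "N = 0" by (simp add: N_def set_lebesgue_integral_def not_integrable_integral_eq)
    moreover have "0 \<le> (\<integral>u. indicator S u * (\<Prod>i<n. pd u (x i)) \<partial>\<mu>)"
      using lpos by (intro Bochner_Integration.integral_nonneg_AE AE_I2) (auto simp: indicator_def)
    ultimately show ?thesis by simp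
  qed
  have Z: "0 < (\<integral>u. (\<Prod>i<n. pd u (x i)) \<partial>\<mu>)" by (rule likelihood_integrable(3)[OF x S])
  have "posterior (wavelet_prior J0 \<Phi> \<Psi> B \<alpha>) n x U = N / (\<integral>u. (\<Prod>i<n. pd u (x i)) \<partial>\<mu>)"
    unfolding posterior_def wavelet_prior_eq denom N_def ..
  moreover have "0 \<le> N / (\<integral>u. (\<Prod>i<n. pd u (x i)) \<partial>\<mu>)" using N Z by simp
  moreover have "N / (\<integral>u. (\<Prod>i<n. pd u (x i)) \<partial>\<mu>) \<le> \<epsilon>"
    using N le Z by (simp add: pos_divide_le_eq)
  ultimately show ?thesis by simp
qed

text \<open>The factor \<open>480 * b\<close> undoes the test exponent. Of the summands,
  \<open>1 + \<alpha>\<close> pays for the number of cells in one error term and for the prior mass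
  in another, the next one pays for the inverse likelihood ratio on the neighbourhood, and 2 covers
  the factor \<open>w\<close> and leaves a decaying rest. The term \<open>16 * G\<^sup>2\<close>
  makes the cells small relative to the radius.\<close>

definition R :: real where
  "R = 480 * b * (1 + \<alpha> + b * G\<^sup>2 * 2 powr (2 * \<alpha> + 1) + 2) + 16 * G\<^sup>2"

text \<open>A squared L2 radius: e^2 enlarged by the factor L that entropy and prior mass
  require.\<close>

definition radius :: "nat \<Rightarrow> real" where "radius L = R * real L * (q ^ L)\<^sup>2"

lemma R_pos: "480 * b * (1 + \<alpha> + b * G\<^sup>2 * 2 powr (2 * \<alpha> + 1) + 2) \<le> R" "16 * G\<^sup>2 \<le> R" "0 < R" "1 \<le> R"
proof -
  have 1: "480 \<le> 480 * b * (1 + \<alpha> + b * G\<^sup>2 * 2 powr (2 * \<alpha> + 1) + 2)"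
    using b_ge_1 \<alpha> mult_mono[of 1 b 1 "1 + \<alpha> + b * G\<^sup>2 * 2 powr (2 * \<alpha> + 1) + 2"] by simp
  then show "480 * b * (1 + \<alpha> + b * G\<^sup>2 * 2 powr (2 * \<alpha> + 1) + 2) \<le> R" "16 * G\<^sup>2 \<le> R" "0 < R" "1 \<le> R"
    unfolding R_def using zero_le_power2[of G] by linarith+
qed

text \<open>The two bounds on \<open>n\<close> keep n e^2 within constants of 2^L, so all exponents
  are multiples of 2^L L. The exceptional set \<open>Z\<close> is chosen before \<open>U\<close>: it
  depends on the L2 geometry only, and any norm that the L2 ball controls can be inserted
  later.\<close>

lemma likelihood_outside_ball:
  assumes L: "J0 \<le> L" "1 \<le> L" and n: "2 powr (real L * (2 * \<alpha> + 1)) \<le> real n" "real n \<le> 2 powr ((real L + 1) * (2 * \<alpha> + 1))"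
    and \<epsilon>: "0 < \<epsilon>"
  shows "\<exists>Z\<in>sets sample. measure sample Z \<le> exp (- real L) * (2 + 1 / \<epsilon>) \<and>
    (\<forall>x\<in>space sample - Z. \<forall>U. (\<forall>u\<in>space \<mu>. pd u \<in> U \<longrightarrow> 3 * radius L < sq_dist u) \<longrightarrow>
      \<bar>posterior (wavelet_prior J0 \<Phi> \<Psi> B \<alpha>) n x U\<bar> \<le> \<epsilon>)"
proof -
  define e where "e = q ^ L"
  define Y where "Y = (2::real) ^ L"
  define D where "D = radius L"
  define c where "c u = cell_center L (cell L u)" for u
  define K where "K = b * G\<^sup>2 * 2 powr (2 * \<alpha> + 1)"
  let ?V = "neighbourhood L v e"
  let ?J = "cell_center L ` cell_set L"
  let ?\<rho> = "exp (- (real n * D / (480 * b)))"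
  let ?post = "posterior (wavelet_prior J0 \<Phi> \<Psi> B \<alpha>) n"
  let ?S = "{u \<in> space \<mu>. D \<le> sq_dist (c u)}"
  let ?lik = "\<lambda>u x. \<Prod>i<n. pd u (x i)"
  have e: "0 < e" "e \<le> 1" using q by (auto simp: e_def intro: power_le_one)
  have e_powr: "e = 2 powr (- real L * \<alpha>)" by (simp add: e_def q_power)
  have Y: "1 \<le> Y" "Y = 2 powr real L" by (auto simp: Y_def powr_realpow)
  have n_lower: "Y \<le> real n * e\<^sup>2"
  proof -
    have "Y = 2 powr (real L * (2 * \<alpha> + 1)) * e\<^sup>2"
      by (simp add: Y e_powr power2_eq_square powr_add[symmetric] algebra_simps)
    also have "\<dots> \<le> real n * e\<^sup>2" using n by (intro mult_right_mono) auto
    finally show ?thesis .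
  qed
  have n_upper: "real n * e\<^sup>2 \<le> 2 powr (2 * \<alpha> + 1) * Y"
  proof -
    have "real n * e\<^sup>2 \<le> 2 powr ((real L + 1) * (2 * \<alpha> + 1)) * e\<^sup>2" using n by (intro mult_right_mono) auto
    also have "\<dots> = 2 powr (2 * \<alpha> + 1) * Y"
      by (simp add: Y e_powr power2_eq_square powr_add[symmetric] algebra_simps)
    finally show ?thesis .
  qed
  have cs: "c u \<in> space \<mu>" if "u \<in> space \<mu>" for u
    unfolding c_def using that by (intro cell_center_in_space cell_in_cell_set)
  have pd_c: "(\<integral>x. (pd u x - pd (c u) x)\<^sup>2 \<partial>unif) \<le> (G * e)\<^sup>2" if u: "u \<in> space \<mu>" for u
    unfolding e_def using cell_center_close[OF u]
    by (intro integral_square_le pd_close[OF coeff_bound[OF u] coeff_bound[OF cs[OF u]] L(1)]) (auto simp: c_def)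
  have GD: "16 * (G * e)\<^sup>2 \<le> D"
  proof -
    have "16 * (G * e)\<^sup>2 = 16 * G\<^sup>2 * 1 * e\<^sup>2" by (simp add: power_mult_distrib)
    also have "\<dots> \<le> R * real L * e\<^sup>2" using R_pos L by (intro mult_right_mono mult_mono) auto
    finally show ?thesis by (simp add: D_def radius_def e_def)
  qed
  have near: "sq_dist u \<le> (G * e)\<^sup>2" if u: "u \<in> ?V" for u
  proof -
    have us: "u \<in> space \<mu>" and d: "\<And>i. i \<in> head_index L \<Longrightarrow> \<bar>u i - v i\<bar> \<le> B * e"
      using u by (auto simp: neighbourhood_def)
    show ?thesis unfolding sq_dist_def
    proof (rule integral_square_le)
      fix x :: real assume x: "x \<in> {0..1}"
      show "\<bar>pd u x - p0 x\<bar> \<le> G * e"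
        unfolding p0_pd[OF x] e_def using d by (intro pd_close coeff_bound us v L(1) x) (auto simp: e_def)
    qed
  qed
  have mass: "(e / 2) ^ 2 ^ L \<le> measure \<mu> ?V"
    by (rule neighbourhood_mass[OF L(1) v e])
  have mass_pos: "0 < measure \<mu> ?V" using mass e by (meson half_gt_zero less_le_trans zero_less_power)
  have "\<exists>Z\<in>sets sample.
    measure sample Z \<le> 1 / exp (real L) + real (card ?J) * ?\<rho> +
      exp (real L) * exp (real n * b * (G * e)\<^sup>2) * ?\<rho> / (\<epsilon> * measure \<mu> ?V) \<and>
    (\<forall>x\<in>space sample - Z.
      (\<integral>u. indicator ?S u * ?lik u x \<partial>\<mu>)
        \<le> \<epsilon> * (\<integral>u. ?lik u x \<partial>\<mu>))"
  proof (rule likelihood_mass_concentration[OF neighbourhood_measurable mass_pos near])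
    show "finite ?J" "?J \<subseteq> space \<mu>"
      using finite_cell_set cell_center_in_space by auto
    show "c \<in> measurable \<mu> (count_space ?J)"
      unfolding c_def[abs_def] by (rule cell_center_measurable)
    show "16 * (\<integral>x. (pd u x - pd (c u) x)\<^sup>2 \<partial>unif) \<le> D" if "u \<in> space \<mu>" for u
      using pd_c[OF that] GD by linarith
  qed (use \<epsilon> in auto)
  then obtain Z where Z: "Z \<in> sets sample" and mZ:
    "measure sample Z \<le> 1 / exp (real L) + real (card ?J) * ?\<rho> +
      exp (real L) * exp (real n * b * (G * e)\<^sup>2) * ?\<rho> / (\<epsilon> * measure \<mu> ?V)"
    and conc: "\<And>x. x \<in> space sample - Z \<Longrightarrow>
      (\<integral>u. indicator ?S u * ?lik u x \<partial>\<mu>)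
        \<le> \<epsilon> * (\<integral>u. ?lik u x \<partial>\<mu>)"
    by blast

  \<comment> \<open>\<open>E\<close> is the common unit of the log-entropy, the log prior mass and
    the test exponent. It also dominates \<open>L\<close>, which allows the choice w = exp
    L.\<close>
  define E where "E = Y * real L"
  have LE: "real L \<le> E" "Y \<le> E" "0 \<le> E"
    using Y(1) L mult_mono[of 1 Y "real L" "real L"] mult_mono[of Y Y 1 "real L"] by (auto simp: E_def)
  have entropy: "(2 / e) ^ 2 ^ L \<le> exp ((1 + \<alpha>) * E)"
  proof -
    have "2 / e = 2 powr (1 + real L * \<alpha>)"
      by (simp add: e_powr powr_add powr_minus divide_inverse)
    also have "\<dots> \<le> 2 powr ((1 + \<alpha>) * real L)"
      using L \<alpha> by (intro powr_mono) (auto simp: algebra_simps)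
    also have "\<dots> = exp ((1 + \<alpha>) * real L * ln 2)" by (simp add: powr_def)
    also have "\<dots> \<le> exp ((1 + \<alpha>) * real L)"
    proof -
      have "(1 + \<alpha>) * real L * ln 2 \<le> (1 + \<alpha>) * real L * 1"
        using \<alpha> ln_2_less_1 by (intro mult_left_mono) auto
      then show ?thesis by simp
    qed
    finally have "(2 / e) ^ 2 ^ L \<le> exp ((1 + \<alpha>) * real L) ^ 2 ^ L"
      using e by (intro power_mono) auto
    also have "\<dots> = exp ((1 + \<alpha>) * E)"
      by (simp add: exp_of_nat_mult[symmetric] E_def Y_def mult_ac)
    finally show ?thesis .
  qed
  have \<rho>: "?\<rho> \<le> exp (- ((1 + \<alpha> + K + 2) * E))"
  proof -
    have "(1 + \<alpha> + K + 2) * E * (480 * b) \<le> R * E"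
      using mult_right_mono[OF R_pos(1) LE(3)] unfolding K_def by (simp only: mult_ac)
    also have "\<dots> \<le> real n * D"
    proof -
      have "R * E = R * real L * Y" by (simp add: E_def)
      also have "\<dots> \<le> R * real L * (real n * e\<^sup>2)" using n_lower R_pos by (intro mult_left_mono) auto
      finally show ?thesis by (simp add: D_def radius_def e_def mult_ac)
    qed
    finally show ?thesis using b_ge_1 by (simp add: pos_le_divide_eq)
  qed
  have cardb: "real (card ?J) \<le> exp ((1 + \<alpha>) * E)"
  proof -
    have "real (card ?J) \<le> real (cells L ^ 2 ^ L)"
      unfolding card_cell_set[OF L(1), symmetric] of_nat_le_iff by (rule card_image_le[OF finite_cell_set])
    also have "\<dots> \<le> (2 / e) ^ 2 ^ L"
      using cells_bounds(2)[of L] by (simp add: e_def power_mono)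
    finally show ?thesis using entropy by linarith
  qed
  have kl: "exp (real n * b * (G * e)\<^sup>2) \<le> exp (K * E)"
  proof -
    have "real n * b * (G * e)\<^sup>2 = b * G\<^sup>2 * (real n * e\<^sup>2)" by (simp add: power_mult_distrib)
    also have "\<dots> \<le> b * G\<^sup>2 * (2 powr (2 * \<alpha> + 1) * Y)" using n_upper b_ge_1 by (intro mult_left_mono) auto
    also have "\<dots> = K * Y" by (simp add: K_def)
    also have "\<dots> \<le> K * E" using LE b_ge_1 by (intro mult_left_mono) (auto simp: K_def)
    finally show ?thesis by simp
  qed
  have "1 / measure \<mu> ?V \<le> 1 / (e / 2) ^ 2 ^ L"
    using mass e by (intro divide_left_mono) (auto simp: mass_pos)
  also have "\<dots> = (2 / e) ^ 2 ^ L" by (simp add: power_divide)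
  finally have invmass: "1 / measure \<mu> ?V \<le> exp ((1 + \<alpha>) * E)" using entropy by linarith
  have t1: "1 / exp (real L) = exp (- real L)" by (simp add: exp_minus inverse_eq_divide)
  have t2: "real (card ?J) * ?\<rho> \<le> exp (- real L)"
  proof -
    have "real (card ?J) * ?\<rho> \<le>
        exp ((1 + \<alpha>) * E) * exp (- ((1 + \<alpha> + K + 2) * E))"
      using cardb \<rho> by (intro mult_mono) auto
    also have "\<dots> = exp (- ((K + 2) * E))" by (simp add: exp_add[symmetric] algebra_simps)
    also have "\<dots> \<le> exp (- real L)"
      using LE b_ge_1 mult_mono[of 1 "K + 2" "real L" E] by (simp add: K_def)
    finally show ?thesis .
  qed
  have t3: "exp (real L) * exp (real n * b * (G * e)\<^sup>2) * ?\<rho> / (\<epsilon> * measure \<mu> ?V)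
      \<le> exp (- real L) / \<epsilon>"
  proof -
    \<comment> \<open>The four exponents are at most 1, K, -(1 + \<alpha> + K + 2) and 1 + \<alpha>
      times \<open>E\<close>; they add up to -E.\<close>
    have "exp (real L) * exp (real n * b * (G * e)\<^sup>2) * ?\<rho> * (1 / measure \<mu> ?V) \<le>
        exp E * exp (K * E) * exp (- ((1 + \<alpha> + K + 2) * E)) * exp ((1 + \<alpha>) * E)"
      using LE kl \<rho> invmass by (intro mult_mono) auto
    also have "\<dots> = exp (- E)" by (simp add: exp_add[symmetric] algebra_simps)
    also have "\<dots> \<le> exp (- real L)" using LE by simp
    finally have "exp (real L) * exp (real n * b * (G * e)\<^sup>2) * ?\<rho> * (1 / measure \<mu> ?V) / \<epsilon>
      \<le> exp (- real L) / \<epsilon>" using \<epsilon> by (intro divide_right_mono) auto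
    then show ?thesis by (simp add: field_simps)
  qed
  have "measure sample Z \<le> exp (- real L) + exp (- real L) + exp (- real L) / \<epsilon>"
    using mZ t1 t2 t3 by linarith
  then have mZ': "measure sample Z \<le> exp (- real L) * (2 + 1 / \<epsilon>)" by (simp add: algebra_simps)

  have S: "?S \<in> sets \<mu>"
  proof -
    have "?S = c -` {w \<in> ?J. D \<le> sq_dist w} \<inter> space \<mu>"
      using cell_in_cell_set by (auto simp: c_def)
    then show ?thesis
      using measurable_sets[OF cell_center_measurable[of L], of "{w \<in> ?J. D \<le> sq_dist w}"]
      by (auto simp: c_def[abs_def])
  qed
  \<comment> \<open>Squared triangle inequality: twice the squared cell diameter is at most D / 8,
    and twice the squared distance of the centre is at most 2 D.\<close>
  have tri: "sq_dist u \<le> 3 * D" if u: "u \<in> space \<mu>" and lt: "sq_dist (c u) < D" for u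
  proof -
    have cont: "continuous_on {0..1} (pd w)" if "w \<in> space \<mu>" for w
      unfolding pd_def using series_facts[OF that] by (rule exp_density_continuous)
    note ci = cont[OF u] cont[OF cs[OF u]]
    have "sq_dist u \<le> (\<integral>x. 2 * (pd u x - pd (c u) x)\<^sup>2 + 2 * (pd (c u) x - p0 x)\<^sup>2 \<partial>unif)"
      unfolding sq_dist_def
    proof (rule integral_mono)
      show "(pd u x - p0 x)\<^sup>2 \<le> 2 * (pd u x - pd (c u) x)\<^sup>2 + 2 * (pd (c u) x - p0 x)\<^sup>2" for x
        using sum_squares_ge_zero[of "(pd u x - pd (c u) x) - (pd (c u) x - p0 x)" 0]
        by (simp add: power2_eq_square algebra_simps)
    qed (intro continuous_integrable_unif continuous_intros ci p0_continuous)+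
    also have "\<dots> = 2 * (\<integral>x. (pd u x - pd (c u) x)\<^sup>2 \<partial>unif) + 2 * sq_dist (c u)"
      unfolding sq_dist_def
      by (subst Bochner_Integration.integral_add)
        (auto intro!: continuous_integrable_unif continuous_intros ci p0_continuous)
    also have "\<dots> \<le> 3 * D" using pd_c[OF u] GD lt zero_le_power2[of "G * e"] by linarith
    finally show ?thesis .
  qed
  have "\<bar>?post x U\<bar> \<le> \<epsilon>"
    if x: "x \<in> space sample - Z" and A: "\<forall>u\<in>space \<mu>. pd u \<in> U \<longrightarrow> 3 * radius L < sq_dist u" for x U
  proof (rule posterior_le[OF _ S _ conc[OF x]])
    show "x \<in> space sample" using x by simp
    fix u assume u: "u \<in> space \<mu>" "pd u \<in> U"
    then show "u \<in> ?S"
      using A tri[OF u(1)] by (force simp: D_def not_less[symmetric])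
  qed
  then show ?thesis using Z mZ' by blast
qed

end

text \<open>For finite r > 2 all powers beyond the second are estimated by the supremum norm; for r
  \<le> 2 the L2 bound suffices on a probability space. At r = \<infinity> the quotient
  \<open>1 / max 2 r\<close> is 0, which matches the supremum bound.\<close>

lemma Lr_norm_le:
  fixes f :: "real \<Rightarrow> real" and r :: ereal
  assumes f [measurable]: "f \<in> borel_measurable unif"
    and L2: "(\<integral>x. (f x)\<^sup>2 \<partial>unif) \<le> t\<^sup>2" and t: "0 < t"
    and sup: "\<And>x. x \<in> {0..1} \<Longrightarrow> \<bar>f x\<bar> \<le> t * 2 powr (real L / 2)" and r: "1 \<le> r"
  shows "Lr_norm r f \<le> 2 * t * 2 powr (real L * (1/2 - real_of_ereal (1 / max 2 r)))"
proof -
  define s where "s = t * 2 powr (real L / 2)"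
  have s: "0 < s" using t by (simp add: s_def)
  have sq_int: "integrable unif (\<lambda>x. (f x)\<^sup>2)"
  proof (rule bounded_integrable_unif)
    fix x :: real assume "x \<in> {0..1}"
    then have "\<bar>f x\<bar>\<^sup>2 \<le> s\<^sup>2" using sup by (intro power_mono) (auto simp: s_def)
    then show "\<bar>(f x)\<^sup>2\<bar> \<le> s\<^sup>2" by simp
  qed simp
  show ?thesis
  proof (cases r)
    case (real r')
    then have r': "1 \<le> r'" using r by simp
    have max: "real_of_ereal (1 / max 2 r) = 1 / max 2 r'"
    proof -
      define m where "m = max 2 r'"
      have "max 2 r = ereal m" using real by (simp add: m_def max_def)
      moreover have "m \<noteq> 0" by (simp add: m_def)
      then have "real_of_ereal (1 / ereal m) = 1 / m" by (simp add: one_ereal_def)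
      ultimately show ?thesis by (simp only: m_def)
    qed
    have norm: "Lr_norm r f = (\<integral>x. \<bar>f x\<bar> powr r' \<partial>unif) powr (1 / r')"
      using real by (simp add: Lr_norm_def LBINT_eq_unif)
    have nonneg: "0 \<le> (\<integral>x. \<bar>f x\<bar> powr r' \<partial>unif)" by simp
    show ?thesis
    proof (cases "r' \<le> 2")
      case True
      have "(\<integral>x. \<bar>f x\<bar> powr r' \<partial>unif) \<le> (\<integral>x. t powr r' * (1 + (f x)\<^sup>2 / t\<^sup>2) \<partial>unif)"
      proof (rule integral_mono_AE')
        show "integrable unif (\<lambda>x. t powr r' * (1 + (f x)\<^sup>2 / t\<^sup>2))" using sq_int by auto
        have "\<bar>f x\<bar> powr r' \<le> t powr r' * (1 + (f x)\<^sup>2 / t\<^sup>2)" for x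
        proof -
          define y where "y = \<bar>f x\<bar> / t"
          have y: "0 \<le> y" "\<bar>f x\<bar> = t * y" using t by (auto simp: y_def)
          \<comment> \<open>This elementary substitute for Hoelder's inequality costs the factor
            2^(1/r), one source of the constant 2 in the statement.\<close>
          have "y powr r' \<le> 1 + y\<^sup>2"
          proof (cases "y \<le> 1")
            case True
            then have "y powr r' \<le> 1" using y r' by (intro powr_le1) auto
            then show ?thesis using zero_le_power2[of y] by linarith
          next
            case False
            then have "y powr r' \<le> y powr 2" using \<open>r' \<le> 2\<close> by (intro powr_mono) auto
            also have "\<dots> = y\<^sup>2" using False by (simp add: powr_numeral)
            finally show ?thesis by simp
          qed
          then have "t powr r' * y powr r' \<le> t powr r' * (1 + y\<^sup>2)" by (intro mult_left_mono) auto
          moreover have "\<bar>f x\<bar> powr r' = t powr r' * y powr r'"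
            unfolding y(2) by (rule powr_mult)
          moreover have "y\<^sup>2 = (f x)\<^sup>2 / t\<^sup>2" by (simp add: y_def power_divide)
          ultimately show ?thesis by simp
        qed
        then show "AE x in unif. \<bar>f x\<bar> powr r' \<le> t powr r' * (1 + (f x)\<^sup>2 / t\<^sup>2)" by simp
      qed (simp add: mult_nonneg_nonneg)
      also have "\<dots> = t powr r' * (1 + (\<integral>x. (f x)\<^sup>2 \<partial>unif) / t\<^sup>2)" using sq_int by simp
      also have "\<dots> \<le> t powr r' * 2" using L2 t by (intro mult_left_mono) (auto simp: divide_le_eq)
      finally have "Lr_norm r f \<le> (t powr r' * 2) powr (1 / r')"
        unfolding norm using nonneg r' by (intro powr_mono2) auto
      also have "\<dots> = t * 2 powr (1 / r')" using t r' by (simp add: powr_mult powr_powr)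
      also have "\<dots> \<le> t * 2 powr 1" using t r' by (intro mult_left_mono powr_mono) auto
      finally show ?thesis unfolding max using True by (simp add: max_def mult.commute)
    next
      case False
      have "(\<integral>x. \<bar>f x\<bar> powr r' \<partial>unif) \<le> (\<integral>x. s powr (r' - 2) * (f x)\<^sup>2 \<partial>unif)"
      proof (rule integral_mono_AE')
        have "\<bar>f x\<bar> powr r' \<le> s powr (r' - 2) * (f x)\<^sup>2" if "x \<in> {0..1}" for x
        proof (cases "f x = 0")
          case fx: False
          have "\<bar>f x\<bar> powr r' = \<bar>f x\<bar> powr (r' - 2) * \<bar>f x\<bar> powr 2"
            using powr_add[of "\<bar>f x\<bar>" "r' - 2" 2] by (simp only: diff_add_cancel)
          also have "\<bar>f x\<bar> powr 2 = (f x)\<^sup>2" using fx by (simp add: powr_numeral)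
          also have "\<bar>f x\<bar> powr (r' - 2) * (f x)\<^sup>2 \<le> s powr (r' - 2) * (f x)\<^sup>2"
            using sup[OF that] False by (intro mult_right_mono powr_mono2) (auto simp: s_def)
          finally show ?thesis .
        qed simp
        then show "AE x in unif. \<bar>f x\<bar> powr r' \<le> s powr (r' - 2) * (f x)\<^sup>2"
          by (intro AE_I2) simp
      qed (use sq_int in auto)
      also have "\<dots> = s powr (r' - 2) * (\<integral>x. (f x)\<^sup>2 \<partial>unif)" by simp
      also have "\<dots> \<le> s powr (r' - 2) * t\<^sup>2" using L2 by (intro mult_left_mono) auto
      \<comment> \<open>Expressing the L2 bound through the supremum bound s leaves a pure power of
        s times 2^(-L), whose r-th root is explicit.\<close>
      also have "t\<^sup>2 = s\<^sup>2 * 2 powr (- real L)"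
        by (simp add: s_def power_mult_distrib power2_eq_square[of "2 powr (real L / 2)"] powr_add[symmetric])
      also have "s powr (r' - 2) * (s\<^sup>2 * 2 powr (- real L)) = s powr r' * 2 powr (- real L)"
        using s by (simp add: powr_numeral[symmetric] mult.assoc[symmetric] powr_add[symmetric] del: powr_numeral)
      finally have "Lr_norm r f \<le> (s powr r' * 2 powr (- real L)) powr (1 / r')"
        unfolding norm using nonneg r' by (intro powr_mono2) auto
      also have "\<dots> = s * 2 powr (- real L / r')" using s r' by (simp add: powr_mult powr_powr)
      also have "\<dots> = t * 2 powr (real L * (1/2 - 1 / r'))"
        by (simp add: s_def powr_add[symmetric] algebra_simps diff_divide_distrib)
      also have "\<dots> \<le> 2 * t * 2 powr (real L * (1/2 - 1 / r'))" using t by simp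
      finally show ?thesis unfolding max using False by (simp add: max_def)
    qed
  next
    case PInf
    have "Lr_norm r f \<le> t * 2 powr (real L / 2)"
      unfolding Lr_norm_def using PInf sup by (auto intro!: cSUP_least)
    also have "\<dots> \<le> 2 * t * 2 powr (real L / 2)" using t by simp
    finally show ?thesis using PInf by simp
  next
    case MInf
    then show ?thesis using r by simp
  qed
qed

section \<open>From the L2 ball to the supremum norm and to L^r\<close>

lemma abs_ln_diff_le:
  fixes x y :: real
  assumes "0 < c" "1 / c \<le> x" "1 / c \<le> y"
  shows "\<bar>ln x - ln y\<bar> \<le> c * \<bar>x - y\<bar>"
proof -
  have *: "ln x - ln y \<le> c * \<bar>x - y\<bar>" if "1 / c \<le> x" "1 / c \<le> y" for x y
  proof -
    have pos: "0 < x" "0 < y" using assms(1) that by (meson less_le_trans zero_less_divide_1_iff)+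
    have "1 / y \<le> c" using that(2) assms(1) pos by (simp add: field_simps)
    have "ln x - ln y \<le> (x - y) / y" using pos by (rule ln_diff_le)
    also have "\<dots> \<le> \<bar>x - y\<bar> * (1 / y)" using pos by (simp add: divide_right_mono)
    also have "\<dots> \<le> \<bar>x - y\<bar> * c" using \<open>1 / y \<le> c\<close> by (intro mult_left_mono) auto
    finally show ?thesis by (simp add: mult.commute)
  qed
  show ?thesis using *[OF assms(2,3)] *[OF assms(3,2)] by (simp add: abs_le_iff abs_minus_commute)
qed

context wavelet_posterior
begin

definition coeff_size :: real where
  "coeff_size = 2 * B + H * (\<Sum>k<2 ^ J0. \<bar>a k\<bar>)"

text \<open>The outer \<open>b\<^sup>2\<close> comes from exponentiating, the inner
  \<open>3 * b\<^sup>2\<close> from taking logarithms of the L2 bound,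
  \<open>coeff_size\<^sup>2\<close> from the tail. The leading 3 makes \<open>C3 * radius L\<close>
  a bound for the squared L2 distance as well, so that one scale t enters the interpolation.\<close>

definition C3 :: real where
  "C3 = 3 + b\<^sup>2 * C1 * (3 * b\<^sup>2 + coeff_size\<^sup>2)"

lemma C3_ge: "3 \<le> C3"
  by (simp add: C3_def C1_def)

text \<open>Closeness is known for the densities, but only their logarithms are wavelet series with
  bounded coefficients. Inside the band both passages, to logarithms and back, are Lipschitz with
  constant \<open>b\<close>.\<close>

lemma sup_norm_from_L2:
  assumes u: "u \<in> space \<mu>" and L: "J0 \<le> L" "1 \<le> L" and near: "sq_dist u \<le> 3 * radius L" and x: "x \<in> {0..1}"
  shows "\<bar>pd u x - p0 x\<bar> \<le> sqrt (C3 * radius L) * 2 powr (real L / 2)"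
proof -
  define c where "c = log_normalizer (series u)"
  \<comment> \<open>Coefficients of log p - log p0: the normaliser of \<open>pd u\<close> is
    subtracted as a constant function, while log p0 is already normalised.\<close>
  define w where "w i = u i - v i - const_coeff c i" for i
  have c: "\<bar>c\<bar> \<le> H" unfolding c_def by (rule log_normalizer_bound[OF series_facts[OF u]])
  have uv: "\<bar>u i - v i\<bar> \<le> 2 * B" if "i \<in> I" for i
    using coeff_bound[OF u that] v[OF that] by linarith
  have cc: "\<bar>const_coeff c i\<bar> \<le> H * (\<Sum>k<2 ^ J0. \<bar>a k\<bar>)" if "i \<in> I" for i
    using const_coeff_bound[OF that, of c] c mult_right_mono[OF c, of "\<Sum>k<2 ^ J0. \<bar>a k\<bar>"]
    by (meson order_trans sum_nonneg abs_ge_zero)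
  have wb: "\<bar>w i\<bar> \<le> coeff_size" if "i \<in> I" for i
    using uv[OF that] cc[OF that] unfolding w_def coeff_size_def by linarith
  have sw: "series w y = series u y - c - series v y" if y: "y \<in> {0..1}" for y
  proof -
    have "series w y = series (\<lambda>i. u i - v i) y - series (const_coeff c) y"
      unfolding w_def by (rule series_diff[OF y uv cc])
    also have "series (\<lambda>i. u i - v i) y = series u y - series v y"
      by (rule series_diff[OF y coeff_bound[OF u] v])
    finally show ?thesis using series_const_coeff[OF y, of c] by simp
  qed
  have pd_eq: "pd u y = exp (series u y - c)" if "y \<in> {0..1}" for y
    unfolding pd_def c_def using exp_density_eq[OF series_facts(1)[OF u] series_facts(2)[OF u] that] by blast
  have w_le: "\<bar>series w y\<bar> \<le> b * \<bar>pd u y - p0 y\<bar>" if y: "y \<in> {0..1}" for y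
  proof -
    have "series w y = ln (pd u y) - ln (p0 y)"
      using sw[OF y] pd_eq[OF y] p0_eq[OF y] by simp
    also have "\<bar>\<dots>\<bar> \<le> b * \<bar>pd u y - p0 y\<bar>"
      using p_bounds[OF u, of y] p0_bounds[of y] y pos(1) by (intro abs_ln_diff_le) auto
    finally show ?thesis .
  qed
  have cw: "continuous_on {0..1} (series w)" by (rule series_continuous[OF wb])
  have cp: "continuous_on {0..1} (pd u)"
    unfolding pd_def using series_facts[OF u] by (rule exp_density_continuous)
  have "(\<integral>y. (series w y)\<^sup>2 \<partial>unif) \<le> (\<integral>y. b\<^sup>2 * (pd u y - p0 y)\<^sup>2 \<partial>unif)"
  proof (rule integral_mono)
    fix y assume "y \<in> space unif"
    then have "\<bar>series w y\<bar>\<^sup>2 \<le> (b * \<bar>pd u y - p0 y\<bar>)\<^sup>2" using w_le by (intro power_mono) auto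
    then show "(series w y)\<^sup>2 \<le> b\<^sup>2 * (pd u y - p0 y)\<^sup>2" by (simp add: power_mult_distrib)
  qed (intro continuous_integrable_unif continuous_intros cw cp p0_continuous)+
  also have "\<dots> = b\<^sup>2 * sq_dist u" by (simp add: sq_dist_def)
  also have "\<dots> \<le> b\<^sup>2 * (3 * radius L)" using near by (intro mult_left_mono) auto
  finally have int_w: "(\<integral>y. (series w y)\<^sup>2 \<partial>unif) \<le> 3 * b\<^sup>2 * radius L" by simp
  have rad: "(q ^ L)\<^sup>2 \<le> radius L"
    using mult_mono[of 1 R 1 "real L"] R_pos L mult_right_mono[of 1 "R * real L" "(q ^ L)\<^sup>2"]
    by (simp add: radius_def)
  have "(series w x)\<^sup>2 \<le> C1 * 2 ^ L * ((\<integral>y. (series w y)\<^sup>2 \<partial>unif) + (coeff_size * q ^ L)\<^sup>2)"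
    by (rule series_sup_bound[OF x wb L(1)])
  also have "\<dots> \<le> C1 * 2 ^ L * (3 * b\<^sup>2 * radius L + coeff_size\<^sup>2 * radius L)"
    using int_w rad by (intro mult_left_mono add_mono) (auto simp: power_mult_distrib mult_left_mono C1_def)
  finally have "b\<^sup>2 * (series w x)\<^sup>2 \<le> b\<^sup>2 * (C1 * 2 ^ L * (3 * b\<^sup>2 * radius L + coeff_size\<^sup>2 * radius L))"
    by (intro mult_left_mono) auto
  also have "\<dots> = (C3 - 3) * radius L * 2 ^ L" by (simp add: C3_def algebra_simps)
  also have "\<dots> \<le> C3 * radius L * 2 ^ L"
    using order_trans[OF zero_le_power2 rad] by (intro mult_right_mono) auto
  finally have *: "b\<^sup>2 * (series w x)\<^sup>2 \<le> C3 * radius L * 2 ^ L" .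
  have "\<bar>pd u x - p0 x\<bar> \<le> b * \<bar>series w x\<bar>"
  proof -
    have "series u x - c \<le> 2 * H" "series v x \<le> 2 * H"
      using series_facts(2)[OF u x] series_v(2)[OF x] c H_nonneg by linarith+
    from abs_exp_diff_le[OF this] show ?thesis
      using sw[OF x] pd_eq[OF x] p0_eq[OF x] by (simp add: b_def)
  qed
  then have "\<bar>pd u x - p0 x\<bar>\<^sup>2 \<le> (b * \<bar>series w x\<bar>)\<^sup>2" by (intro power_mono) auto
  also have "\<dots> \<le> C3 * radius L * 2 ^ L" using * by (simp add: power_mult_distrib)
  finally have "\<bar>pd u x - p0 x\<bar> \<le> sqrt (C3 * radius L * 2 ^ L)" by (rule real_le_rsqrt)
  also have "\<dots> = sqrt (C3 * radius L) * 2 powr (real L / 2)"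
    by (simp add: real_sqrt_mult powr_half_sqrt[symmetric] powr_powr powr_realpow[symmetric])
  finally show ?thesis .
qed

text \<open>The 4 combines the 2 of \<open>Lr_norm_le\<close> with L \<le> 2 log n, the power of 2
  accounts for rounding the resolution level down, and the summand 1 makes the final inequality
  strict.\<close>

definition M :: "ereal \<Rightarrow> real" where
  "M r = 1 + 4 * sqrt (C3 * R) * 2 powr (\<alpha> - 1/2 + real_of_ereal (1 / max 2 r))"

lemma M_pos: "0 < M r"
proof -
  have "0 \<le> C3 * R" using C3_ge R_pos by simp
  then show ?thesis unfolding M_def by (smt (verit) mult_nonneg_nonneg powr_ge_zero real_sqrt_ge_zero)
qed

text \<open>The level dependence is 2^(-\<alpha> L) * 2^(L (1/2 - \<beta>)) = 2^(-\<kappa> L), and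
  2^(-L) is at most twice n^(-1/(2\<alpha> + 1)). Nonnegativity of \<kappa> allows this last bound
  to be raised to the power \<kappa>.\<close>

lemma Lr_norm_rate:
  fixes r :: ereal
  assumes u: "u \<in> space \<mu>" and L: "J0 \<le> L" "1 \<le> L" and near: "sq_dist u \<le> 3 * radius L" and r: "1 \<le> r"
    and n: "2 powr (real L * (2 * \<alpha> + 1)) \<le> real n" "real n \<le> 2 powr ((real L + 1) * (2 * \<alpha> + 1))"
    and \<kappa>0: "0 \<le> \<alpha> - 1/2 + real_of_ereal (1 / max 2 r)"
  shows "Lr_norm r (\<lambda>x. pd u x - p0 x) <
    M r * real n powr (- (\<alpha> - 1/2 + real_of_ereal (1 / max 2 r)) / (2 * \<alpha> + 1)) * ln (real n)"
proof -
  define \<beta> where "\<beta> = real_of_ereal (1 / max 2 r)"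
  define \<kappa> where "\<kappa> = \<alpha> - 1/2 + \<beta>"
  have \<kappa>: "0 \<le> \<kappa>" using \<kappa>0 by (simp add: \<kappa>_def \<beta>_def)
  define t where "t = sqrt (C3 * radius L)"
  have rad: "0 < radius L" using R_pos L q by (simp add: radius_def)
  then have t: "0 < t" "t\<^sup>2 = C3 * radius L" using C3_ge by (auto simp: t_def)
  have cp: "continuous_on {0..1} (pd u)"
    unfolding pd_def using series_facts[OF u] by (rule exp_density_continuous)
  have n1: "1 < real n"
  proof -
    have "1 < 2 powr (real L * (2 * \<alpha> + 1))" using L \<alpha> by (intro gr_one_powr) auto
    then show ?thesis using n by linarith
  qed
  have "(\<integral>x. (pd u x - p0 x)\<^sup>2 \<partial>unif) \<le> t\<^sup>2"
    using near C3_ge rad mult_right_mono[of 3 C3 "radius L"] unfolding t(2) sq_dist_def by linarith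
  then have "Lr_norm r (\<lambda>x. pd u x - p0 x) \<le> 2 * t * 2 powr (real L * (1/2 - \<beta>))"
    unfolding \<beta>_def using sup_norm_from_L2[OF u L near] cp
    by (intro Lr_norm_le[OF _ _ t(1) _ r] continuous_on_measurable_unif continuous_intros p0_continuous)
      (auto simp: t_def)
  also have "t = sqrt (C3 * R) * sqrt (real L) * 2 powr (- real L * \<alpha>)"
    using q by (simp add: t_def radius_def real_sqrt_mult q_power mult_ac)
  also have "2 * (sqrt (C3 * R) * sqrt (real L) * 2 powr (- real L * \<alpha>)) * 2 powr (real L * (1/2 - \<beta>)) =
      2 * sqrt (C3 * R) * sqrt (real L) * 2 powr (- (real L * \<kappa>))"
    by (simp add: \<kappa>_def powr_add[symmetric] mult.assoc algebra_simps)
  also have "\<dots> \<le> 2 * sqrt (C3 * R) * (2 * ln (real n)) * (2 powr \<kappa> * real n powr (- \<kappa> / (2 * \<alpha> + 1)))"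
  proof (intro mult_mono)
    \<comment> \<open>Here the square root of the logarithm is given up for its first power, which
      fixes the exponent 1 of the logarithm.\<close>
    have "sqrt (real L) \<le> real L"
      using L by (intro real_le_lsqrt) (auto simp: power2_eq_square mult_le_cancel_left1)
    also have "real L \<le> 2 * ln (real n)"
    proof -
      have "real L * (2 * \<alpha> + 1) * ln 2 = ln (2 powr (real L * (2 * \<alpha> + 1)))" by (simp add: ln_powr)
      also have "\<dots> \<le> ln (real n)" using n n1 by (intro ln_mono) auto
      finally have "real L * (2 * \<alpha> + 1) * ln 2 \<le> ln (real n)" .
      moreover have "real L * 1 * (1/2) \<le> real L * (2 * \<alpha> + 1) * ln 2"
        using \<alpha> ln2_ge_two_thirds by (intro mult_mono) auto
      ultimately show ?thesis by simp
    qed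
    finally show "sqrt (real L) \<le> 2 * ln (real n)" .
    have "2 powr (- (real L * \<kappa>)) = 2 powr \<kappa> * (2 powr ((real L + 1) * (2 * \<alpha> + 1))) powr (- \<kappa> / (2 * \<alpha> + 1))"
    proof -
      define d where "d = 2 * \<alpha> + 1"
      have "0 < d" using \<alpha> by (simp add: d_def)
      then have "(real L + 1) * d * (- \<kappa> / d) = - (real L * \<kappa>) - \<kappa>" by (simp add: field_simps)
      then show ?thesis unfolding d_def[symmetric] by (simp only: powr_powr powr_add[symmetric]) simp
    qed
    also have "\<dots> \<le> 2 powr \<kappa> * real n powr (- \<kappa> / (2 * \<alpha> + 1))"
      using n n1 \<kappa> \<alpha> by (intro mult_left_mono powr_mono2') auto
    finally show "2 powr (- (real L * \<kappa>)) \<le> 2 powr \<kappa> * real n powr (- \<kappa> / (2 * \<alpha> + 1))" .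
  qed (use C3_ge R_pos n1 in auto)
  also have "\<dots> = (M r - 1) * real n powr (- \<kappa> / (2 * \<alpha> + 1)) * ln (real n)"
    by (simp add: M_def \<kappa>_def \<beta>_def)
  also have "\<dots> < M r * real n powr (- \<kappa> / (2 * \<alpha> + 1)) * ln (real n)"
    using n1 by (intro mult_strict_right_mono) auto
  finally show ?thesis by (simp add: \<kappa>_def \<beta>_def)
qed

end

text \<open>The largest level with 2^(L (2\<alpha> + 1)) \<le> n, for which n e^2 and 2^L
  balance.\<close>

definition resolution :: "real \<Rightarrow> nat \<Rightarrow> nat" where
  "resolution \<alpha> n = nat \<lfloor>log 2 (real n) / (2 * \<alpha> + 1)\<rfloor>"

lemma resolution_bounds:
  assumes "0 < \<alpha>" "1 \<le> n"
  shows "2 powr (real (resolution \<alpha> n) * (2 * \<alpha> + 1)) \<le> real n"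
    "real n \<le> 2 powr ((real (resolution \<alpha> n) + 1) * (2 * \<alpha> + 1))"
proof -
  define d where "d = 2 * \<alpha> + 1"
  define y where "y = log 2 (real n) / d"
  have d: "0 < d" using assms by (simp add: d_def)
  have n: "0 < real n" using assms(2) by simp
  have "0 \<le> log 2 (real n)" using assms(2) by (intro zero_le_log_cancel_iff[THEN iffD2]) auto
  then have y: "0 \<le> y" using d by (simp add: y_def)
  have "real (nat \<lfloor>y\<rfloor>) \<le> y" "y \<le> real (nat \<lfloor>y\<rfloor>) + 1" using y by linarith+
  moreover have "y * d = log 2 (real n)" using d by (simp add: y_def)
  ultimately have "real (nat \<lfloor>y\<rfloor>) * d \<le> log 2 (real n)" "log 2 (real n) \<le> (real (nat \<lfloor>y\<rfloor>) + 1) * d"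
    using d by (metis mult_right_mono less_imp_le)+
  then have "2 powr (real (nat \<lfloor>y\<rfloor>) * d) \<le> real n" "real n \<le> 2 powr ((real (nat \<lfloor>y\<rfloor>) + 1) * d)"
    using n by (simp_all only: le_log_iff[of 2] log_le_iff[of 2] one_less_numeral_iff semiring_norm)
  then show "2 powr (real (resolution \<alpha> n) * (2 * \<alpha> + 1)) \<le> real n"
    "real n \<le> 2 powr ((real (resolution \<alpha> n) + 1) * (2 * \<alpha> + 1))"
    by (simp_all only: resolution_def y_def d_def)
qed

lemma resolution_at_top:
  assumes "0 < \<alpha>"
  shows "filterlim (resolution \<alpha>) at_top sequentially"
  unfolding filterlim_at_top
proof
  fix Z :: nat
  define d where "d = 2 * \<alpha> + 1"
  have d: "0 < d" using assms by (simp add: d_def)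
  show "\<forall>\<^sub>F n in sequentially. Z \<le> resolution \<alpha> n"
  proof (rule eventually_sequentiallyI[of "nat \<lceil>2 powr (real Z * d)\<rceil>"])
    fix n assume "nat \<lceil>2 powr (real Z * d)\<rceil> \<le> n"
    then have n: "2 powr (real Z * d) \<le> real n" by linarith
    then have "0 < real n" by (rule less_le_trans[rotated]) simp
    with n have "real Z * d \<le> log 2 (real n)" by (simp add: le_log_iff)
    then have "real Z \<le> log 2 (real n) / d" using d by (simp add: pos_le_divide_eq)
    then show "Z \<le> resolution \<alpha> n" unfolding resolution_def d_def[symmetric] by linarith
  qed
qed

context wavelet_posterior
begin

theorem posterior_contraction:
  fixes r :: ereal
  assumes r: "1 \<le> r" and \<kappa>: "0 \<le> \<alpha> - 1/2 + real_of_ereal (1 / max 2 r)"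
  shows "tendsto_zero_in_prob (iid_law (law_of_density p0))
    (\<lambda>n X. posterior (wavelet_prior J0 \<Phi> \<Psi> B \<alpha>) n X
      {p \<in> mspace C01 \<inter> densities_01. Lr_norm r (\<lambda>x. p x - p0 x) \<ge>
        M r * real n powr (- (\<alpha> - 1/2 + real_of_ereal (1 / max 2 r)) / (2 * \<alpha> + 1)) * ln (real n) powr 1})"
  unfolding tendsto_zero_in_prob_def sample_eq[symmetric]
proof (intro allI impI)
  fix \<epsilon> :: real assume \<epsilon>: "0 < \<epsilon>"
  let ?U = "\<lambda>n. {p \<in> mspace C01 \<inter> densities_01. Lr_norm r (\<lambda>x. p x - p0 x) \<ge>
        M r * real n powr (- (\<alpha> - 1/2 + real_of_ereal (1 / max 2 r)) / (2 * \<alpha> + 1)) * ln (real n) powr 1}"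
  let ?bad = "\<lambda>n. {X \<in> space sample. \<epsilon> < \<bar>posterior (wavelet_prior J0 \<Phi> \<Psi> B \<alpha>) n X (?U n)\<bar>}"
  let ?L = "resolution \<alpha>"
  have ev: "\<forall>\<^sub>F n in sequentially. J0 \<le> ?L n" "\<forall>\<^sub>F n in sequentially. 1 \<le> ?L n"
    using resolution_at_top[OF \<alpha>] unfolding filterlim_at_top by blast+
  have bound: "\<forall>\<^sub>F n in sequentially. measure sample (?bad n) \<le> exp (- real (?L n)) * (2 + 1 / \<epsilon>)"
    using ev eventually_ge_at_top[of 1]
  proof eventually_elim
    case (elim n)
    note n = resolution_bounds[OF \<alpha> elim(3)]
    obtain Z where Z: "Z \<in> sets sample" "measure sample Z \<le> exp (- real (?L n)) * (2 + 1 / \<epsilon>)"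
      and post: "\<And>x U. x \<in> space sample - Z \<Longrightarrow> (\<forall>u\<in>space \<mu>. pd u \<in> U \<longrightarrow> 3 * radius (?L n) < sq_dist u) \<Longrightarrow>
        \<bar>posterior (wavelet_prior J0 \<Phi> \<Psi> B \<alpha>) n x U\<bar> \<le> \<epsilon>"
      using likelihood_outside_ball[OF elim(1,2) n \<epsilon>] by blast
    \<comment> \<open>Contrapositive of \<open>Lr_norm_rate\<close>: within the L2 ball the L^r
      distance would be strictly below the threshold.\<close>
    have far: "\<forall>u\<in>space \<mu>. pd u \<in> ?U n \<longrightarrow> 3 * radius (?L n) < sq_dist u"
    proof (intro ballI impI, rule ccontr)
      fix u assume u: "u \<in> space \<mu>" "pd u \<in> ?U n" and "\<not> 3 * radius (?L n) < sq_dist u"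
      then have "sq_dist u \<le> 3 * radius (?L n)" by simp
      from Lr_norm_rate[OF u(1) elim(1,2) this r n \<kappa>] u(2) elim(3)
      show False by simp
    qed
    have "?bad n \<subseteq> Z"
    proof (rule subsetI, rule ccontr)
      fix x assume x: "x \<in> ?bad n" "x \<notin> Z"
      then have "\<bar>posterior (wavelet_prior J0 \<Phi> \<Psi> B \<alpha>) n x (?U n)\<bar> \<le> \<epsilon>" by (intro post far) auto
      then show False using x(1) by simp
    qed
    then have "measure sample (?bad n) \<le> measure sample Z"
      using Z(1) by (rule Sample.finite_measure_mono)
    then show ?case using Z(2) by linarith
  qed
  have "(\<lambda>m. exp (- real m)) \<longlonglongrightarrow> 0"
  proof -
    have "exp (- real m) = exp (- 1) ^ m" for m by (simp add: exp_of_nat_mult[symmetric])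
    moreover have "(\<lambda>m. exp (- 1 :: real) ^ m) \<longlonglongrightarrow> 0" by (intro LIMSEQ_power_zero) simp
    ultimately show ?thesis by simp
  qed
  then have "(\<lambda>n. exp (- real (?L n))) \<longlonglongrightarrow> 0"
    by (rule filterlim_compose[OF _ resolution_at_top[OF \<alpha>]])
  from tendsto_mult_right[OF this, of "2 + 1 / \<epsilon>"]
  have lim: "(\<lambda>n. exp (- real (?L n)) * (2 + 1 / \<epsilon>)) \<longlonglongrightarrow> 0" by simp
  show "(\<lambda>n. measure sample (?bad n)) \<longlonglongrightarrow> 0"
    by (rule tendsto_sandwich[OF _ bound tendsto_const lim]) simp
qed

end

text \<open>For r \<le> 2 the exponent is \<alpha> itself, and 1 - 1/r vanishes only at r = 1. For r
  > 2 the condition reads \<alpha> \<ge> 1/2.\<close>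

lemma exponent_cases:
  fixes r :: ereal
  assumes r: "1 \<le> r" and \<alpha>: "1 - 1 / real_of_ereal (min r 2) \<le> \<alpha>"
  shows "0 \<le> \<alpha>" "0 \<le> \<alpha> - 1/2 + real_of_ereal (1 / max 2 r)" "\<alpha> = 0 \<Longrightarrow> r = 1"
proof -
  have "0 \<le> \<alpha> \<and> 0 \<le> \<alpha> - 1/2 + real_of_ereal (1 / max 2 r) \<and> (\<alpha> = 0 \<longrightarrow> r = 1)"
  proof (cases "r \<le> 2")
    case True
    then obtain r' where r': "r = ereal r'" using r by (cases r) auto
    then have bnd: "1 \<le> r'" "r' \<le> 2" using r True by auto
    then have \<alpha>': "1 - 1 / r' \<le> \<alpha>" using \<alpha> True r' by (simp add: min_def)
    have "1 / r' \<le> 1" using bnd by simp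
    then have "0 \<le> \<alpha>" using \<alpha>' by linarith
    moreover have "real_of_ereal (1 / max 2 r) = 1 / 2"
    proof -
      have "max 2 r = ereal 2" using True by (simp add: max_def)
      then show ?thesis by (simp add: one_ereal_def)
    qed
    moreover have "r = 1" if "\<alpha> = 0"
    proof -
      have "1 \<le> 1 / r'" using \<alpha>' that by simp
      then have "r' \<le> 1" using bnd by (simp add: le_divide_eq)
      then show ?thesis using bnd r' by (simp add: one_ereal_def)
    qed
    ultimately show ?thesis by simp
  next
    case False
    then have "min r 2 = ereal 2" by (simp add: min_def)
    then have "1 - 1 / 2 \<le> \<alpha>" using \<alpha> by simp
    moreover have "0 \<le> real_of_ereal (1 / max 2 r)"
    proof -
      have "max 2 r = r" using False by (intro max_absorb2) (simp only: not_le less_imp_le)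
      moreover have "0 \<le> 1 / r" using r by (cases r) (auto simp: one_ereal_def)
      ultimately show ?thesis by (simp add: real_of_ereal_pos)
    qed
    ultimately show ?thesis by simp
  qed
  then show "0 \<le> \<alpha>" "0 \<le> \<alpha> - 1/2 + real_of_ereal (1 / max 2 r)" "\<alpha> = 0 \<Longrightarrow> r = 1" by auto
qed

lemma densities_01_L1_dist:
  assumes "p \<in> densities_01" "p0 \<in> densities_01"
  shows "Lr_norm 1 (\<lambda>x. p x - p0 x) \<le> 2"
proof -
  have p: "integrable unif p" "(\<integral>x. p x \<partial>unif) = 1" "\<And>x. x \<in> {0..1} \<Longrightarrow> 0 \<le> p x"
    and p0: "integrable unif p0" "(\<integral>x. p0 x \<partial>unif) = 1" "\<And>x. x \<in> {0..1} \<Longrightarrow> 0 \<le> p0 x"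
    using assms unfolding densities_01_def set_integrable_eq_unif LBINT_eq_unif by auto
  have "(\<integral>x. \<bar>p x - p0 x\<bar> \<partial>unif) \<le> (\<integral>x. p x + p0 x \<partial>unif)"
  proof (rule integral_mono)
    fix x assume "x \<in> space unif"
    then show "\<bar>p x - p0 x\<bar> \<le> p x + p0 x" using p(3)[of x] p0(3)[of x] by simp
  qed (use p p0 in auto)
  also have "\<dots> = 2" using p p0 by simp
  finally show ?thesis
    by (simp add: Lr_norm_def LBINT_eq_unif one_ereal_def)
qed

theorem proposition1:
  fixes \<alpha> :: real and r :: ereal
  assumes "1 \<le> r" and "\<alpha> \<ge> 1 - 1 / real_of_ereal (min r 2)"
  shows "\<exists>\<eta>>0. \<forall>B N J0 \<Phi> \<Psi> p0.
    0 < B \<longrightarrow> \<alpha> < real N \<longrightarrow> cdv_basis N J0 \<Phi> \<Psi> \<longrightarrow>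
    p0 \<in> densities_01 \<longrightarrow> (\<forall>x\<in>{0..1}. 0 < p0 x) \<longrightarrow>
    (\<lambda>x. ln (p0 x)) \<in> besov_space J0 \<Phi> \<Psi> \<alpha> \<longrightarrow>
    besov_norm J0 \<Phi> \<Psi> \<alpha> (\<lambda>x. ln (p0 x)) \<le> ennreal B \<longrightarrow>
    (\<exists>M>0. tendsto_zero_in_prob (iid_law (law_of_density p0))
       (\<lambda>n X. posterior (wavelet_prior J0 \<Phi> \<Psi> B \<alpha>) n X
          {p \<in> mspace C01 \<inter> densities_01.
             Lr_norm r (\<lambda>x. p x - p0 x) \<ge>
               M * real n powr (- (\<alpha> - 1/2 + real_of_ereal (1 / max 2 r)) / (2 * \<alpha> + 1))
                 * ln (real n) powr \<eta>}))"
\<comment> \<open>The exponent 1 is independent of all later data, as required. At \<alpha> > 0 it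
  absorbs the factor sqrt L, and at \<alpha> = 0 any positive exponent makes the threshold
  diverge.\<close>
proof (rule exI[of _ "1::real"], intro conjI allI impI)
  show "0 < (1::real)" by simp
  fix B :: real and N J0 :: nat and \<Phi> \<Psi> p0
  assume B: "0 < B" and N: "\<alpha> < real N" and cdv: "cdv_basis N J0 \<Phi> \<Psi>"
    and p0: "p0 \<in> densities_01" and p0_pos: "\<forall>x\<in>{0..1}. 0 < p0 x"
    and besov: "(\<lambda>x. ln (p0 x)) \<in> besov_space J0 \<Phi> \<Psi> \<alpha>"
    and norm: "besov_norm J0 \<Phi> \<Psi> \<alpha> (\<lambda>x. ln (p0 x)) \<le> ennreal B"
  note exps = exponent_cases[OF assms]
  show "\<exists>M>0. tendsto_zero_in_prob (iid_law (law_of_density p0))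
       (\<lambda>n X. posterior (wavelet_prior J0 \<Phi> \<Psi> B \<alpha>) n X
          {p \<in> mspace C01 \<inter> densities_01.
             Lr_norm r (\<lambda>x. p x - p0 x) \<ge>
               M * real n powr (- (\<alpha> - 1/2 + real_of_ereal (1 / max 2 r)) / (2 * \<alpha> + 1))
                 * ln (real n) powr 1})"
  \<comment> \<open>At \<alpha> = 0 the geometric decay over levels is lost because q = 1, so this
    case is settled without the series.\<close>
  proof (cases "\<alpha> = 0")
    case True
    then have r: "r = 1" by (rule exps(3))
    let ?U = "\<lambda>n. {p \<in> mspace C01 \<inter> densities_01. Lr_norm r (\<lambda>x. p x - p0 x) \<ge>
          1 * real n powr (- (\<alpha> - 1/2 + real_of_ereal (1 / max 2 r)) / (2 * \<alpha> + 1)) * ln (real n) powr 1}"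
    have "max 2 (1::ereal) = ereal 2" by (simp add: max_def)
    then have rate: "real_of_ereal (1 / max 2 r) = 1/2" by (simp add: r one_ereal_def)
    \<comment> \<open>The rate is the constant \<open>1\<close> up to the logarithm, which eventually exceeds the largest possible
      \<open>L\<^sup>1\<close> distance of two densities.\<close>
    have zero: "posterior (wavelet_prior J0 \<Phi> \<Psi> B \<alpha>) n X (?U n) = 0"
      if n: "exp 3 \<le> real n" for n X
    proof -
      have n0: "0 < real n" using n exp_gt_zero less_le_trans by blast
      have "3 \<le> ln (real n)" using n n0 by (simp add: ln_ge_iff)
      then have "?U n = {}"
        using densities_01_L1_dist[OF _ p0] n0 unfolding rate by (force simp: True r)
      then show ?thesis by (simp only: posterior_def set_lebesgue_integral_def) simp
    qed
    have "\<forall>\<^sub>F n in sequentially. \<forall>X. posterior (wavelet_prior J0 \<Phi> \<Psi> B \<alpha>) n X (?U n) = 0"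
    proof (intro eventually_sequentiallyI[of "nat \<lceil>exp (3::real)\<rceil>"] allI)
      fix n X assume "nat \<lceil>exp (3::real)\<rceil> \<le> n"
      then have "exp 3 \<le> real n" by linarith
      then show "posterior (wavelet_prior J0 \<Phi> \<Psi> B \<alpha>) n X (?U n) = 0"
        by (rule zero)
    qed
    then show ?thesis
      unfolding tendsto_zero_in_prob_def
      by (intro exI[of _ 1] conjI allI impI tendsto_eventually) (auto elim!: eventually_mono)
  next
    case False
    then have \<alpha>: "0 < \<alpha>" using exps(1) by simp
    then have "0 < real N" using N by linarith
    then have "0 < N" by simp
    then obtain A a where "wavelet_basis J0 \<Phi> \<Psi> A a"
      using cdv_basis_wavelet_basis[OF cdv] by blast
    then interpret W: wavelet_prior_space J0 \<Phi> \<Psi> A a \<alpha> B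
      using \<alpha> B by (simp add: wavelet_prior_space_def wavelet_series_space_def
          wavelet_series_space_axioms_def wavelet_prior_space_axioms_def)
    have "continuous_on {0..1} (\<lambda>x. ln (p0 x))" using besov \<alpha> by (simp add: besov_space_def)
    then obtain v where v: "\<forall>i\<in>W.I. \<bar>v i\<bar> \<le> B" "\<forall>x\<in>{0..1}. W.series v x = ln (p0 x)"
      using W.besov_ball_series[OF _ norm B] by blast
    interpret D: wavelet_posterior J0 \<Phi> \<Psi> A a \<alpha> B v p0
    proof
      show "\<bar>v i\<bar> \<le> B" if "i \<in> W.I" for i using v(1) that by blast
      show "p0 x = exp (W.series v x)" if "x \<in> {0..1}" for x using v(2) p0_pos that by simp
      show "(\<integral>x. p0 x \<partial>unif) = 1" using p0 by (simp add: densities_01_def LBINT_eq_unif)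
    qed
    show ?thesis
      using D.posterior_contraction[OF assms(1) exps(2)] D.M_pos by blast
  qed
qed

end
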